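(* Let $\mathsf{k}$ be an algebraically closed field of characteristic zero, let $D=\mathsf{k}[h]$ or $D=\mathsf{k}[h^{\pm1}]$, and let $D^n(a^n,\sigma^n)$ be a tensorial generalized Weyl algebra of degree $n$ obtained from a degree $1$ generalized Weyl algebra $D(a,\sigma)$ with $\sigma$ of infinite order. Let $m\geq1$ and $p\mid m$. Then $D^n(a^n,\sigma^n)^{G(m,p,n)}$ is a free module over its (Harish-Chandra) subalgebra $D^*=(D^{\otimes n})^{S_n}$, acting by left multiplication.
   Context: Degree $1$ generalized Weyl algebra $D(a,\sigma)$: $\sigma$ a $\mathsf{k}$-algebra automorphism of $D$, $0\neq a\in D$; generated over $D$ by $X^\pm$ with $X^{\pm}d=\sigma^{\pm1}(d)X^{\pm}$, $X^-X^+=a$, $X^+X^-=\sigma(a)$. The tensorial GWA of degree $n$ is $D^n(a^n,\sigma^n):=D(a,\sigma)^{\otimes n}$; here $D^n:=D^{\otimes n}$ (tensor power over $\mathsf{k}$), and $X_i^\pm$ denotes $X^\pm$ placed in the $i$-th tensor factor. $S_n$ acts on $D^n(a^n,\sigma^n)$ by permuting tensor factors, so $\pi(X_i^\pm)=X_{\pi(i)}^\pm$. $D^*:=(D^n)^{S_n}$, i.e. $\mathsf{k}[h_1,\dots,h_n]^{S_n}$ or $\mathsf{k}[h_1^{\pm1},\dots,h_n^{\pm1}]^{S_n}$. $G_m\subset\mathsf{k}^\times$ is the group of $m$-th roots of unity; $(\zeta_1,\dots,\zeta_n)\in G_m^n$ acts on $D^n(a^n,\sigma^n)$ by fixing $D^n$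 and $X_i^{\pm}\mapsto\zeta_i^{\pm1}X_i^{\pm}$. $A(m,p,n)=\{(\zeta_i)\in G_m^n\mid(\prod_i\zeta_i)^{m/p}=1\}$ and $G(m,p,n)=A(m,p,n)\rtimes S_n$. *)

theory Defs
  imports
    "HOL-Library.Poly_Mapping"
    "HOL-Combinatorics.Permutations"
    "HOL-Computational_Algebra.Polynomial"
    "HOL-Algebra.QuotRing"
    "HOL-Algebra.Module"
begin

text \<open>
  The ground field is a type \<open>'k\<close>; a \<open>'k\<close>-algebra is a record \<open>('k, 'a) module\<close> of HOL-Algebra,
  with a (not necessarily commutative) ring part, and its \<open>smult\<close> is the action of \<open>'k\<close>.
\<close>

section \<open>Monoid algebras, quotients and induced maps\<close>

definition monoid_algebra :: "('a, 'm) monoid_scheme \<Rightarrow> ('k::comm_ring_1, 'a \<Rightarrow>\<^sub>0 'k) module" where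
  "monoid_algebra M =
     \<lparr>carrier = {f. Poly_Mapping.keys f \<subseteq> carrier M},
      mult = (\<lambda>f g. \<Sum>x\<in>Poly_Mapping.keys f. \<Sum>y\<in>Poly_Mapping.keys g.
        Poly_Mapping.single (x \<otimes>\<^bsub>M\<^esub> y) (Poly_Mapping.lookup f x * Poly_Mapping.lookup g y)),
      one = Poly_Mapping.single \<one>\<^bsub>M\<^esub> 1,
      ring.zero = 0,
      add = (+),
      smult = (\<lambda>c. Poly_Mapping.map ((*) c))\<rparr>"

definition lin_ext :: "('a \<Rightarrow> 'b \<Rightarrow>\<^sub>0 'k) \<Rightarrow> ('a \<Rightarrow>\<^sub>0 'k) \<Rightarrow> ('b \<Rightarrow>\<^sub>0 'k::comm_ring_1)" where
  "lin_ext \<phi> f =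
     (\<Sum>x\<in>Poly_Mapping.keys f. Poly_Mapping.map ((*) (Poly_Mapping.lookup f x)) (\<phi> x))"

definition quot_alg :: "('k, 'a) module \<Rightarrow> 'a set \<Rightarrow> ('k, 'a set) module" where
  "quot_alg A I = ring.extend (A Quot I) (module.fields (\<lambda>c X. \<Union>x\<in>X. I +>\<^bsub>A\<^esub> (c \<odot>\<^bsub>A\<^esub> x)))"

text \<open>
  The map \<open>A / I \<rightarrow> B / J\<close> induced by a map \<open>\<phi> : A \<rightarrow> B\<close> with \<open>\<phi> I \<subseteq> J\<close>; a class
  \<open>X = I + x\<close> is sent to \<open>J + \<phi> x\<close>.
\<close>
definition quot_map :: "('k, 'b) module \<Rightarrow> 'b set \<Rightarrow> ('a \<Rightarrow> 'b) \<Rightarrow> 'a set \<Rightarrow> 'b set" where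
  "quot_map B J \<phi> X = (\<Union>x\<in>X. J +>\<^bsub>B\<^esub> \<phi> x)"

section \<open>The base rings and their automorphisms\<close>

definition laurent_alg :: "('k::comm_ring_1, int \<Rightarrow>\<^sub>0 'k) module" where
  "laurent_alg =
     \<lparr>carrier = UNIV, mult = (*), one = 1, ring.zero = 0, add = (+),
      smult = (\<lambda>c. Poly_Mapping.map ((*) c))\<rparr>"

text \<open>
  \<open>k[h]\<close> is realised inside \<open>k[h, h\<^sup>-\<^sup>1]\<close> (a Laurent polynomial maps an exponent to its
  coefficient), so that both base rings live on the same type.
\<close>
definition poly_alg :: "('k::comm_ring_1, int \<Rightarrow>\<^sub>0 'k) module" where
  "poly_alg = laurent_alg\<lparr>carrier := {f. Poly_Mapping.keys f \<subseteq> {0..}}\<rparr>"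

definition alg_auts :: "('k, 'a) module \<Rightarrow> ('a \<Rightarrow> 'a) set" where
  "alg_auts A = {\<phi> \<in> ring_iso A A. \<forall>c. \<forall>x\<in>carrier A. \<phi> (c \<odot>\<^bsub>A\<^esub> x) = c \<odot>\<^bsub>A\<^esub> \<phi> x}"

definition infinite_order :: "('k, 'a) module \<Rightarrow> ('a \<Rightarrow> 'a) \<Rightarrow> bool" where
  "infinite_order A \<phi> \<longleftrightarrow> (\<forall>j>0. \<exists>x\<in>carrier A. (\<phi> ^^ j) x \<noteq> x)"

section \<open>Generalized Weyl algebras of degree one\<close>

datatype 'd gwa_gen = Coef 'd | XPlus | XMinus

definition gwa_words :: "('k, 'd) module \<Rightarrow> 'd gwa_gen list monoid" where
  "gwa_words D = \<lparr>carrier = lists (insert XPlus (insert XMinus (Coef ` carrier D))),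
     mult = (@), one = []\<rparr>"

definition gwa_free :: "('k::comm_ring_1, 'd) module \<Rightarrow> ('k, 'd gwa_gen list \<Rightarrow>\<^sub>0 'k) module" where
  "gwa_free D = monoid_algebra (gwa_words D)"

abbreviation word :: "'d gwa_gen list \<Rightarrow> ('d gwa_gen list \<Rightarrow>\<^sub>0 'k::comm_ring_1)" where
  "word w \<equiv> Poly_Mapping.single w 1"

text \<open>
  The first four families say that \<open>d \<mapsto> Coef d\<close> is a homomorphism of unital \<open>k\<close>-algebras, the
  others are the defining relations of \<open>D(a, \<sigma>)\<close>.
\<close>
definition gwa_rels ::
  "('k::comm_ring_1, 'd) module \<Rightarrow> 'd \<Rightarrow> ('d \<Rightarrow> 'd) \<Rightarrow> ('d gwa_gen list \<Rightarrow>\<^sub>0 'k) set" where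
  "gwa_rels D a \<sigma> =
     {word [Coef (d \<oplus>\<^bsub>D\<^esub> e)] - (word [Coef d] + word [Coef e]) | d e. d \<in> carrier D \<and> e \<in> carrier D} \<union>
     {word [Coef (d \<otimes>\<^bsub>D\<^esub> e)] - word [Coef d, Coef e] | d e. d \<in> carrier D \<and> e \<in> carrier D} \<union>
     {word [Coef (c \<odot>\<^bsub>D\<^esub> d)] - Poly_Mapping.single [Coef d] c | c d. d \<in> carrier D} \<union>
     {word [Coef \<one>\<^bsub>D\<^esub>] - word []} \<union>
     {word [XPlus, Coef d] - word [Coef (\<sigma> d), XPlus] | d. d \<in> carrier D} \<union>
     {word [XMinus, Coef d] - word [Coef (inv_into (carrier D) \<sigma> d), XMinus] | d. d \<in> carrier D} \<union>
     {word [XMinus, XPlus] - word [Coef a]} \<union>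
     {word [XPlus, XMinus] - word [Coef (\<sigma> a)]}"

definition gwa_ideal ::
  "('k::comm_ring_1, 'd) module \<Rightarrow> 'd \<Rightarrow> ('d \<Rightarrow> 'd) \<Rightarrow> ('d gwa_gen list \<Rightarrow>\<^sub>0 'k) set" where
  "gwa_ideal D a \<sigma> = Idl\<^bsub>gwa_free D\<^esub> (gwa_rels D a \<sigma>)"

definition gwa ::
  "('k::comm_ring_1, 'd) module \<Rightarrow> 'd \<Rightarrow> ('d \<Rightarrow> 'd) \<Rightarrow> ('k, ('d gwa_gen list \<Rightarrow>\<^sub>0 'k) set) module" where
  "gwa D a \<sigma> = quot_alg (gwa_free D) (gwa_ideal D a \<sigma>)"

definition gwa_incl ::
  "('k::comm_ring_1, 'd) module \<Rightarrow> 'd \<Rightarrow> ('d \<Rightarrow> 'd) \<Rightarrow> 'd \<Rightarrow> ('d gwa_gen list \<Rightarrow>\<^sub>0 'k) set" where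
  "gwa_incl D a \<sigma> d = gwa_ideal D a \<sigma> +>\<^bsub>gwa_free D\<^esub> word [Coef d]"

fun gen_weight :: "'k::field \<Rightarrow> 'd gwa_gen \<Rightarrow> 'k" where
  "gen_weight z (Coef d) = 1"
| "gen_weight z XPlus = z"
| "gen_weight z XMinus = inverse z"

text \<open>The automorphism of \<open>D(a, \<sigma>)\<close> fixing \<open>D\<close> and scaling \<open>X\<^sup>+\<close> by \<open>z\<close>, \<open>X\<^sup>-\<close> by \<open>z\<^sup>-\<^sup>1\<close>.\<close>
definition gwa_scale ::
  "('k::field, 'd) module \<Rightarrow> 'd \<Rightarrow> ('d \<Rightarrow> 'd) \<Rightarrow> 'k \<Rightarrow>
     ('d gwa_gen list \<Rightarrow>\<^sub>0 'k) set \<Rightarrow> ('d gwa_gen list \<Rightarrow>\<^sub>0 'k) set" where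
  "gwa_scale D a \<sigma> z = quot_map (gwa_free D) (gwa_ideal D a \<sigma>)
     (lin_ext (\<lambda>w. Poly_Mapping.single w (prod_list (map (gen_weight z) w))))"

section \<open>Tensor powers of algebras\<close>

text \<open>
  Tuples \<open>x \<in> A\<^sup>n\<close> are indexed by \<open>{1..n}\<close>. The tensor power over \<open>k\<close> is the span of all tuples (pure
  tensors, multiplied componentwise) modulo multilinearity. A product of a multilinearity relation
  with a tuple is again such a relation, so the ideal they generate is their linear span.
\<close>
definition tuple_monoid :: "nat \<Rightarrow> ('k, 'a) module \<Rightarrow> (nat \<Rightarrow> 'a) monoid" where
  "tuple_monoid n A = \<lparr>carrier = {1..n} \<rightarrow>\<^sub>E carrier A,
     mult = (\<lambda>x y. \<lambda>i\<in>{1..n}. x i \<otimes>\<^bsub>A\<^esub> y i), one = (\<lambda>i\<in>{1..n}. \<one>\<^bsub>A\<^esub>)\<rparr>"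

definition tuple_alg :: "nat \<Rightarrow> ('k::comm_ring_1, 'a) module \<Rightarrow> ('k, (nat \<Rightarrow> 'a) \<Rightarrow>\<^sub>0 'k) module" where
  "tuple_alg n A = monoid_algebra (tuple_monoid n A)"

definition tensor_rels :: "nat \<Rightarrow> ('k::comm_ring_1, 'a) module \<Rightarrow> ((nat \<Rightarrow> 'a) \<Rightarrow>\<^sub>0 'k) set" where
  "tensor_rels n A =
     {Poly_Mapping.single (x(i := u \<oplus>\<^bsub>A\<^esub> v)) 1
        - (Poly_Mapping.single (x(i := u)) 1 + Poly_Mapping.single (x(i := v)) 1) | x i u v.
        x \<in> {1..n} \<rightarrow>\<^sub>E carrier A \<and> i \<in> {1..n} \<and> u \<in> carrier A \<and> v \<in> carrier A} \<union>
     {Poly_Mapping.single (x(i := c \<odot>\<^bsub>A\<^esub> x i)) 1 - Poly_Mapping.single x c | x i c.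
        x \<in> {1..n} \<rightarrow>\<^sub>E carrier A \<and> i \<in> {1..n}}"

definition tensor_ideal :: "nat \<Rightarrow> ('k::comm_ring_1, 'a) module \<Rightarrow> ((nat \<Rightarrow> 'a) \<Rightarrow>\<^sub>0 'k) set" where
  "tensor_ideal n A = Idl\<^bsub>tuple_alg n A\<^esub> (tensor_rels n A)"

definition tensor_pow ::
  "nat \<Rightarrow> ('k::comm_ring_1, 'a) module \<Rightarrow> ('k, ((nat \<Rightarrow> 'a) \<Rightarrow>\<^sub>0 'k) set) module" where
  "tensor_pow n A = quot_alg (tuple_alg n A) (tensor_ideal n A)"

text \<open>\<open>\<psi> 1 \<otimes> \<dots> \<otimes> \<psi> n\<close>, with values in the \<open>n\<close>-th tensor power of \<open>B\<close>.\<close>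
definition tensor_map ::
  "nat \<Rightarrow> ('k::comm_ring_1, 'b) module \<Rightarrow> (nat \<Rightarrow> 'a \<Rightarrow> 'b) \<Rightarrow>
     ((nat \<Rightarrow> 'a) \<Rightarrow>\<^sub>0 'k) set \<Rightarrow> ((nat \<Rightarrow> 'b) \<Rightarrow>\<^sub>0 'k) set" where
  "tensor_map n B \<psi> = quot_map (tuple_alg n B) (tensor_ideal n B)
     (lin_ext (\<lambda>x. Poly_Mapping.single (\<lambda>i\<in>{1..n}. \<psi> i (x i)) 1))"

text \<open>The left action of permutations that moves the factor at position \<open>i\<close> to position \<open>\<pi> i\<close>.\<close>
definition tensor_perm ::
  "nat \<Rightarrow> ('k::comm_ring_1, 'a) module \<Rightarrow> (nat \<Rightarrow> nat) \<Rightarrow>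
     ((nat \<Rightarrow> 'a) \<Rightarrow>\<^sub>0 'k) set \<Rightarrow> ((nat \<Rightarrow> 'a) \<Rightarrow>\<^sub>0 'k) set" where
  "tensor_perm n A \<pi> = quot_map (tuple_alg n A) (tensor_ideal n A)
     (lin_ext (\<lambda>x. Poly_Mapping.single (\<lambda>i\<in>{1..n}. x (inv_into UNIV \<pi> i)) 1))"

section \<open>The groups \<open>G(m, p, n)\<close> and their invariants\<close>

definition A_mpn :: "nat \<Rightarrow> nat \<Rightarrow> nat \<Rightarrow> (nat \<Rightarrow> 'k::field) set" where
  "A_mpn m p n = {\<zeta> \<in> {1..n} \<rightarrow>\<^sub>E {z. z ^ m = 1}. (\<Prod>i\<in>{1..n}. \<zeta> i) ^ (m div p) = 1}"

definition G_mpn :: "nat \<Rightarrow> nat \<Rightarrow> nat \<Rightarrow> ((nat \<Rightarrow> 'k::field) \<times> (nat \<Rightarrow> nat)) monoid" where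
  "G_mpn m p n = \<lparr>carrier = A_mpn m p n \<times> {\<pi>. \<pi> permutes {1..n}},
     mult = (\<lambda>(\<zeta>, \<pi>) (\<xi>, \<rho>). (\<lambda>i\<in>{1..n}. \<zeta> i * \<xi> (inv_into UNIV \<pi> i), \<pi> \<circ> \<rho>)),
     one = (\<lambda>i\<in>{1..n}. 1, id)\<rparr>"

definition tensor_gwa ::
  "nat \<Rightarrow> ('k::comm_ring_1, 'd) module \<Rightarrow> 'd \<Rightarrow> ('d \<Rightarrow> 'd) \<Rightarrow>
     ('k, ((nat \<Rightarrow> ('d gwa_gen list \<Rightarrow>\<^sub>0 'k) set) \<Rightarrow>\<^sub>0 'k) set) module" where
  "tensor_gwa n D a \<sigma> = tensor_pow n (gwa D a \<sigma>)"

definition G_mpn_act ::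
  "nat \<Rightarrow> ('k::field, 'd) module \<Rightarrow> 'd \<Rightarrow> ('d \<Rightarrow> 'd) \<Rightarrow> (nat \<Rightarrow> 'k) \<times> (nat \<Rightarrow> nat) \<Rightarrow>
     ((nat \<Rightarrow> ('d gwa_gen list \<Rightarrow>\<^sub>0 'k) set) \<Rightarrow>\<^sub>0 'k) set \<Rightarrow>
     ((nat \<Rightarrow> ('d gwa_gen list \<Rightarrow>\<^sub>0 'k) set) \<Rightarrow>\<^sub>0 'k) set" where
  "G_mpn_act n D a \<sigma> = (\<lambda>(\<zeta>, \<pi>) x.
     tensor_map n (gwa D a \<sigma>) (\<lambda>i. gwa_scale D a \<sigma> (\<zeta> i)) (tensor_perm n (gwa D a \<sigma>) \<pi> x))"

definition tensor_gwa_invariants ::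
  "nat \<Rightarrow> nat \<Rightarrow> nat \<Rightarrow> ('k::field, 'd) module \<Rightarrow> 'd \<Rightarrow> ('d \<Rightarrow> 'd) \<Rightarrow>
     ('k, ((nat \<Rightarrow> ('d gwa_gen list \<Rightarrow>\<^sub>0 'k) set) \<Rightarrow>\<^sub>0 'k) set) module" where
  "tensor_gwa_invariants m p n D a \<sigma> = (tensor_gwa n D a \<sigma>)
     \<lparr>carrier := {x \<in> carrier (tensor_gwa n D a \<sigma>).
        \<forall>g\<in>carrier (G_mpn m p n). G_mpn_act n D a \<sigma> g x = x}\<rparr>"

text \<open>The symmetric part of the \<open>n\<close>-th tensor power of \<open>D\<close>, embedded into that of \<open>D(a, \<sigma>)\<close>.\<close>
definition D_star ::
  "nat \<Rightarrow> ('k::comm_ring_1, 'd) module \<Rightarrow> 'd \<Rightarrow> ('d \<Rightarrow> 'd) \<Rightarrow>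
     ('k, ((nat \<Rightarrow> ('d gwa_gen list \<Rightarrow>\<^sub>0 'k) set) \<Rightarrow>\<^sub>0 'k) set) module" where
  "D_star n D a \<sigma> = (tensor_gwa n D a \<sigma>)
     \<lparr>carrier := tensor_map n (gwa D a \<sigma>) (\<lambda>i. gwa_incl D a \<sigma>) `
        {x \<in> carrier (tensor_pow n D). \<forall>\<pi>. \<pi> permutes {1..n} \<longrightarrow> tensor_perm n D \<pi> x = x}\<rparr>"

section \<open>Free modules\<close>

definition left_mult_module :: "('k, 'a) module \<Rightarrow> ('a, 'a) module" where
  "left_mult_module A = ring.extend (ring.truncate A) (module.fields (monoid.mult A))"

definition is_basis :: "('r, 'm) ring_scheme \<Rightarrow> ('r, 'v) module \<Rightarrow> 'v set \<Rightarrow> bool" where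
  "is_basis R M B \<longleftrightarrow> B \<subseteq> carrier M \<and>
     (\<forall>x\<in>carrier M. \<exists>F c. finite F \<and> F \<subseteq> B \<and> c \<in> F \<rightarrow> carrier R \<and>
        x = (\<Oplus>\<^bsub>M\<^esub>b\<in>F. c b \<odot>\<^bsub>M\<^esub> b)) \<and>
     (\<forall>F c. finite F \<longrightarrow> F \<subseteq> B \<longrightarrow> c \<in> F \<rightarrow> carrier R \<longrightarrow>
        (\<Oplus>\<^bsub>M\<^esub>b\<in>F. c b \<odot>\<^bsub>M\<^esub> b) = \<zero>\<^bsub>M\<^esub> \<longrightarrow> (\<forall>b\<in>F. c b = \<zero>\<^bsub>R\<^esub>))"

definition free_module :: "('r, 'm) ring_scheme \<Rightarrow> ('r, 'v) module \<Rightarrow> bool" where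
  "free_module R M \<longleftrightarrow> Module.module R M \<and> (\<exists>B. is_basis R M B)"

end

theory Submission
  imports Defs "HOL-Library.Function_Algebras" "HOL-Library.Product_Plus"
begin

text \<open>
  As a left module over \<open>D\<^sup>n\<close>, the tensorial algebra is free on the monomials \<open>X\<^sup>\<alpha>\<close> with \<open>\<alpha> \<in> \<int>\<^sup>n\<close>.
  The torus part of \<open>G(m, p, n)\<close> only selects the exponents \<open>\<alpha>\<close> in a sublattice, so the question is
  about \<open>S\<^sub>n\<close> acting on the direct sum of the \<open>D\<^sup>n X\<^sup>\<alpha>\<close>. A Maschke averaging argument, applied to the
  monomials below the staircase, gives a finite-dimensional \<open>S\<^sub>n\<close>-stable space \<open>V\<close> of polynomials
  such that \<open>D\<^sup>n = D\<^sup>* \<otimes> V\<close>. With \<open>W\<close> the linear span of the \<open>v X\<^sup>\<alpha>\<close>, the torus invariants are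
  \<open>D\<^sup>* \<otimes> W\<close>, and averaging over \<open>S\<^sub>n\<close> shows that the invariants of \<open>G(m, p, n)\<close> are \<open>D\<^sup>* \<otimes> W\<^sup>G\<close>:
  every linear basis of \<open>W\<^sup>G\<close> is a basis over \<open>D\<^sup>*\<close>.
\<close>

section \<open>Linear maps between spaces of finitely supported functions\<close>

text \<open>The algebras are quotients by ideals of relations, so nothing can be computed in them
  before a basis is known. Both presentations are therefore identified, as vector spaces only, with
  Laurent polynomials in commuting variables. This identification is not multiplicative, but it
  respects left multiplication by D^n, and a statement on left modules over \<open>D_star\<close>
  sees no other products. Splitting the invariants by orbits of \<alpha> would lead to the
  invariants of each stabilizer in D^n, each with its own basis over D^*. A stable V treats all
  orbits at once. The span of the staircase monomials is in general not stable, but the ideal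
  generated by the symmetric polynomials without constant term is, and V is the image of an
  equivariant linear section of the quotient by that ideal. With respect to degree the resulting
  elements are triangular over the staircase, hence again a basis. Constant terms are multiplicative
  only on polynomials, so V is built inside the polynomial ring also when D is the Laurent
  ring.\<close>

abbreviation "lookup \<equiv> Poly_Mapping.lookup"
abbreviation "keys \<equiv> Poly_Mapping.keys"
abbreviation "single \<equiv> Poly_Mapping.single"

abbreviation sc :: "'k::comm_ring_1 \<Rightarrow> ('a \<Rightarrow>\<^sub>0 'k) \<Rightarrow> ('a \<Rightarrow>\<^sub>0 'k)" where
  "sc c \<equiv> Poly_Mapping.map ((*) c)"

lemma lookup_sc [simp]: "lookup (sc c f) x = c * lookup f x"
  by transfer (simp add: when_def)

lemma sc_add_right: "sc c (f + g) = sc c f + sc c g"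
  by (rule poly_mapping_eqI) (simp add: lookup_add distrib_left)

lemma sc_add_left: "sc (c + d) f = sc c f + sc d f"
  by (rule poly_mapping_eqI) (simp add: lookup_add distrib_right)

lemma sc_sc [simp]: "sc c (sc d f) = sc (c * d) f"
  by (rule poly_mapping_eqI) (simp add: mult.assoc)

lemma sc_one [simp]: "sc 1 f = f"
  by (rule poly_mapping_eqI) simp

lemma sc_id [simp]: "Poly_Mapping.map (\<lambda>x. x) f = f" for f :: "'b \<Rightarrow>\<^sub>0 'k::comm_ring_1"
  by (rule poly_mapping_eqI, transfer) (simp add: when_def)

lemma sc_zero_fun [simp]: "Poly_Mapping.map (\<lambda>x. 0) f = 0" for f :: "'b \<Rightarrow>\<^sub>0 'k::comm_ring_1"
  by (rule poly_mapping_eqI, transfer) simp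

lemma sc_0_left [simp]: "sc 0 f = 0"
  by (rule poly_mapping_eqI) simp

lemma sc_0_right [simp]: "sc c 0 = 0"
  by (rule poly_mapping_eqI) simp

lemma sc_single [simp]: "sc c (single x d) = single x (c * d)"
  by (rule poly_mapping_eqI) (simp add: lookup_single when_def)

lemma sc_diff: "sc c (f - g) = sc c f - sc c g"
  by (rule poly_mapping_eqI) (simp add: lookup_minus right_diff_distrib)

lemma sc_sum: "sc c (sum f A) = (\<Sum>x\<in>A. sc c (f x))"
  by (induction A rule: infinite_finite_induct) (simp_all add: sc_add_right)

lemma keys_sc: "keys (sc c f) \<subseteq> keys f"
  by (auto simp: in_keys_iff)

lemma sum_single_lookup:
  fixes f :: "'a \<Rightarrow>\<^sub>0 'k::comm_monoid_add"
  assumes "finite A" "keys f \<subseteq> A"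
  shows "(\<Sum>x\<in>A. single x (lookup f x)) = f"
proof (rule poly_mapping_eqI)
  fix y
  have "lookup (\<Sum>x\<in>A. single x (lookup f x)) y = (\<Sum>x\<in>A. if x = y then lookup f y else 0)"
    unfolding lookup_sum by (intro sum.cong) (auto simp: lookup_single when_def)
  also have "\<dots> = lookup f y"
    using assms by (auto simp: in_keys_iff)
  finally show "lookup (\<Sum>x\<in>A. single x (lookup f x)) y = lookup f y" .
qed

text \<open>Reduces a linear claim about elements of a carrier to monomials. The add case repeats
  the support conditions because such claims often hold only on the carrier.\<close>

lemma poly_mapping_induct_on [consumes 1, case_names zero sgl add]:
  fixes f :: "'a \<Rightarrow>\<^sub>0 'k::comm_monoid_add"
  assumes "keys f \<subseteq> K" and zero: "P 0"
    and sgl: "\<And>b c. b \<in> K \<Longrightarrow> P (single b c)"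
    and add: "\<And>f g. keys f \<subseteq> K \<Longrightarrow> keys g \<subseteq> K \<Longrightarrow> P f \<Longrightarrow> P g \<Longrightarrow> P (f + g)"
  shows "P f"
proof -
  have "P (\<Sum>x\<in>A. single x (lookup f x)) \<and> keys (\<Sum>x\<in>A. single x (lookup f x)) \<subseteq> K"
    if "finite A" "A \<subseteq> K" for A
    using that
  proof (induction A rule: finite_induct)
    case (insert x A)
    have *: "keys (single x (lookup f x)) \<subseteq> K"
      using insert by auto
    moreover have "keys (single x (lookup f x) + (\<Sum>x\<in>A. single x (lookup f x))) \<subseteq> K"
      using insert * Poly_Mapping.keys_add by (metis (no_types, lifting) Un_subset_iff insert_subset subset_trans)
    ultimately show ?case using insert by (auto intro!: add sgl)
  qed (use zero in auto)
  from this[OF finite_keys assms(1)] show ?thesis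
    by (simp add: sum_single_lookup)
qed

lemma lin_ext_superset:
  assumes "finite A" "keys f \<subseteq> A"
  shows "lin_ext \<phi> f = (\<Sum>x\<in>A. sc (lookup f x) (\<phi> x))"
  unfolding lin_ext_def using assms by (intro sum.mono_neutral_left) (auto simp: in_keys_iff)

lemma lin_ext_0 [simp]: "lin_ext \<phi> 0 = 0"
  by (simp add: lin_ext_def)

lemma lin_ext_add: "lin_ext \<phi> (f + g) = lin_ext \<phi> f + lin_ext \<phi> g"
proof -
  let ?A = "keys f \<union> keys g"
  have "lin_ext \<phi> (f + g) = (\<Sum>x\<in>?A. sc (lookup (f + g) x) (\<phi> x))"
    by (rule lin_ext_superset) (use Poly_Mapping.keys_add[of f g] in auto)
  also have "\<dots> = (\<Sum>x\<in>?A. sc (lookup f x) (\<phi> x)) + (\<Sum>x\<in>?A. sc (lookup g x) (\<phi> x))"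
    by (simp add: lookup_add sc_add_left sum.distrib)
  also have "\<dots> = lin_ext \<phi> f + lin_ext \<phi> g"
    by (simp add: lin_ext_superset[of ?A])
  finally show ?thesis .
qed

lemma lin_ext_single [simp]: "lin_ext \<phi> (single x c) = sc c (\<phi> x)"
  by (subst lin_ext_superset[of "{x}"]) auto

lemma lin_ext_sc: "lin_ext \<phi> (sc c f) = sc c (lin_ext \<phi> f)"
  by (subst (1 2) lin_ext_superset[of "keys f"]) (auto simp: keys_sc[THEN subsetD] sc_sum)

lemma lin_ext_diff: "lin_ext \<phi> (f - g) = lin_ext \<phi> f - lin_ext \<phi> g"
  by (metis add_diff_cancel diff_add_cancel lin_ext_add)

lemma lin_ext_sum: "lin_ext \<phi> (sum f A) = (\<Sum>x\<in>A. lin_ext \<phi> (f x))"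
  by (induction A rule: infinite_finite_induct) (simp_all add: lin_ext_add)

lemma lin_ext_cong:
  assumes "\<And>x. x \<in> keys f \<Longrightarrow> \<phi> x = \<psi> x"
  shows "lin_ext \<phi> f = lin_ext \<psi> f"
  unfolding lin_ext_def by (intro sum.cong) (auto simp: assms)

lemma keys_lin_ext:
  assumes "\<And>x. x \<in> keys f \<Longrightarrow> keys (\<phi> x) \<subseteq> K"
  shows "keys (lin_ext \<phi> f) \<subseteq> K"
  unfolding lin_ext_def
  by (intro order.trans[OF keys_sum] UN_least order.trans[OF keys_sc] assms)

lemma lin_ext_lin_ext: "lin_ext \<psi> (lin_ext \<phi> f) = lin_ext (\<lambda>x. lin_ext \<psi> (\<phi> x)) f"
  by (simp add: lin_ext_def[of \<phi>] lin_ext_def[of "\<lambda>x. lin_ext \<psi> (\<phi> x)"] lin_ext_sum lin_ext_sc)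

lemma lin_ext_single_id [simp]: "lin_ext (\<lambda>x. single x 1) f = f"
  by (simp add: lin_ext_def sum_single_lookup)

lemma lin_ext_fun_add: "lin_ext (\<lambda>x. \<phi> x + \<psi> x) f = lin_ext \<phi> f + lin_ext \<psi> f"
  by (simp add: lin_ext_def sc_add_right sum.distrib)

lemma lin_ext_fun_sc: "lin_ext (\<lambda>x. sc c (\<phi> x)) f = sc c (lin_ext \<phi> f)"
  by (simp add: lin_ext_def sc_sum mult.commute)

lemma lin_ext_fun_0 [simp]: "lin_ext (\<lambda>x. 0) f = 0"
  by (simp add: lin_ext_def)

subsection \<open>Monoid algebras\<close>

lemma monoid_algebra_simps [simp]:
  "carrier (monoid_algebra M) = {f. keys f \<subseteq> carrier M}"
  "\<one>\<^bsub>monoid_algebra M\<^esub> = single \<one>\<^bsub>M\<^esub> 1"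
  "\<zero>\<^bsub>monoid_algebra M\<^esub> = 0"
  "x \<oplus>\<^bsub>monoid_algebra M\<^esub> y = x + y"
  "c \<odot>\<^bsub>monoid_algebra M\<^esub> x = sc c x"
  by (simp_all add: monoid_algebra_def)

text \<open>As an iterated linear extension the product is bilinear on all finitely supported
  functions. Membership in the carrier matters only for closure, associativity and the unit.\<close>

lemma monoid_algebra_mult:
  "f \<otimes>\<^bsub>monoid_algebra M\<^esub> g = lin_ext (\<lambda>x. lin_ext (\<lambda>y. single (x \<otimes>\<^bsub>M\<^esub> y) 1) g) f"
  by (simp add: monoid_algebra_def lin_ext_def sc_sum)

lemma monoid_algebra_mult_single:
  "single x c \<otimes>\<^bsub>monoid_algebra M\<^esub> single y d = single (x \<otimes>\<^bsub>M\<^esub> y) (c * d)"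
  by (simp add: monoid_algebra_mult)

lemma monoid_algebra_l_distr:
  "(f + g) \<otimes>\<^bsub>monoid_algebra M\<^esub> h = f \<otimes>\<^bsub>monoid_algebra M\<^esub> h + g \<otimes>\<^bsub>monoid_algebra M\<^esub> h"
  by (simp add: monoid_algebra_mult lin_ext_add)

lemma monoid_algebra_r_distr:
  "h \<otimes>\<^bsub>monoid_algebra M\<^esub> (f + g) = h \<otimes>\<^bsub>monoid_algebra M\<^esub> f + h \<otimes>\<^bsub>monoid_algebra M\<^esub> g"
  by (simp add: monoid_algebra_mult lin_ext_add lin_ext_fun_add)

lemma monoid_algebra_0_mult:
  "0 \<otimes>\<^bsub>monoid_algebra M\<^esub> f = 0" "f \<otimes>\<^bsub>monoid_algebra M\<^esub> 0 = 0"
  by (simp_all add: monoid_algebra_mult)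

lemma monoid_algebra_sc_mult:
  "sc c f \<otimes>\<^bsub>monoid_algebra M\<^esub> g = sc c (f \<otimes>\<^bsub>monoid_algebra M\<^esub> g)"
  "f \<otimes>\<^bsub>monoid_algebra M\<^esub> sc c g = sc c (f \<otimes>\<^bsub>monoid_algebra M\<^esub> g)"
  by (simp_all add: monoid_algebra_mult lin_ext_sc lin_ext_fun_sc)

lemma monoid_algebra_diff_mult:
  "(f - g) \<otimes>\<^bsub>monoid_algebra M\<^esub> h = f \<otimes>\<^bsub>monoid_algebra M\<^esub> h - g \<otimes>\<^bsub>monoid_algebra M\<^esub> h"
  "h \<otimes>\<^bsub>monoid_algebra M\<^esub> (f - g) = h \<otimes>\<^bsub>monoid_algebra M\<^esub> f - h \<otimes>\<^bsub>monoid_algebra M\<^esub> g"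
  by (metis add_diff_cancel diff_add_cancel monoid_algebra_l_distr)
     (metis add_diff_cancel diff_add_cancel monoid_algebra_r_distr)

lemma monoid_algebra_closed:
  assumes "monoid M" "keys f \<subseteq> carrier M" "keys g \<subseteq> carrier M"
  shows "keys (f \<otimes>\<^bsub>monoid_algebra M\<^esub> g) \<subseteq> carrier M"
  unfolding monoid_algebra_mult
  using assms by (intro keys_lin_ext) (auto intro!: monoid.m_closed)

lemma monoid_algebra_assoc:
  assumes "monoid M" "keys f \<subseteq> carrier M" "keys g \<subseteq> carrier M" "keys h \<subseteq> carrier M"
  shows "f \<otimes>\<^bsub>monoid_algebra M\<^esub> g \<otimes>\<^bsub>monoid_algebra M\<^esub> h = f \<otimes>\<^bsub>monoid_algebra M\<^esub> (g \<otimes>\<^bsub>monoid_algebra M\<^esub> h)"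
  using assms(2)
proof (induction f rule: poly_mapping_induct_on)
  case (sgl x c)
  show ?case using assms(3)
  proof (induction g rule: poly_mapping_induct_on)
    case (sgl y d)
    show ?case using assms(4)
      by (induction h rule: poly_mapping_induct_on)
         (use \<open>x \<in> carrier M\<close> sgl in \<open>simp_all add: monoid_algebra_mult_single monoid_algebra_r_distr
           monoid_algebra_0_mult monoid.m_assoc[OF assms(1)] mult.assoc\<close>)
  qed (simp_all add: monoid_algebra_l_distr monoid_algebra_r_distr monoid_algebra_0_mult)
qed (simp_all add: monoid_algebra_l_distr monoid_algebra_0_mult)

lemma ring_monoid_algebra:
  assumes "monoid M"
  shows "ring (monoid_algebra M :: ('k::comm_ring_1, 'a \<Rightarrow>\<^sub>0 'k) module)"
proof -
  let ?A = "monoid_algebra M :: ('k::comm_ring_1, 'a \<Rightarrow>\<^sub>0 'k) module"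
  interpret M: monoid M by fact
  have "abelian_group ?A"
  proof (rule abelian_groupI)
    fix x assume "x \<in> carrier ?A"
    then show "\<exists>y\<in>carrier ?A. y \<oplus>\<^bsub>?A\<^esub> x = \<zero>\<^bsub>?A\<^esub>"
      by (intro bexI[of _ "- x"]) auto
  qed (auto simp: add_ac dest!: Poly_Mapping.keys_add[THEN subsetD])
  moreover have "monoid ?A"
  proof (rule monoidI)
    fix x :: "'a \<Rightarrow>\<^sub>0 'k" assume "x \<in> carrier ?A"
    then have *: "keys x \<subseteq> carrier M" by simp
    show "\<one>\<^bsub>?A\<^esub> \<otimes>\<^bsub>?A\<^esub> x = x"
      using * by (induction x rule: poly_mapping_induct_on)
        (simp_all add: monoid_algebra_mult_single monoid_algebra_r_distr monoid_algebra_0_mult)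
    show "x \<otimes>\<^bsub>?A\<^esub> \<one>\<^bsub>?A\<^esub> = x"
      using * by (induction x rule: poly_mapping_induct_on)
        (simp_all add: monoid_algebra_mult_single monoid_algebra_l_distr monoid_algebra_0_mult)
  qed (simp_all add: monoid_algebra_closed[OF assms] monoid_algebra_assoc[OF assms])
  ultimately show ?thesis
    by (intro ringI) (simp_all add: monoid_algebra_l_distr monoid_algebra_r_distr)
qed

subsection \<open>Quotients of monoid algebras given by generators and relations\<close>

lemma quot_alg_simps:
  "carrier (quot_alg A I) = a_rcosets\<^bsub>A\<^esub> I"
  "\<one>\<^bsub>quot_alg A I\<^esub> = I +>\<^bsub>A\<^esub> \<one>\<^bsub>A\<^esub>"
  "\<zero>\<^bsub>quot_alg A I\<^esub> = I"
  "X \<oplus>\<^bsub>quot_alg A I\<^esub> Y = set_add A X Y"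
  "X \<otimes>\<^bsub>quot_alg A I\<^esub> Y = rcoset_mult A I X Y"
  "c \<odot>\<^bsub>quot_alg A I\<^esub> X = (\<Union>x\<in>X. I +>\<^bsub>A\<^esub> (c \<odot>\<^bsub>A\<^esub> x))"
  by (simp_all add: quot_alg_def ring.extend_def module.fields_def FactRing_def)

lemma ring_extend:
  assumes "ring R"
  shows "ring (ring.extend R (ext :: 'e))"
proof -
  interpret R: ring R by fact
  let ?S = "ring.extend R ext"
  have [simp]: "carrier ?S = carrier R" "mult ?S = mult R" "one ?S = one R"
    "ring.zero ?S = ring.zero R" "add ?S = add R"
    by (simp_all add: ring.extend_def)
  show ?thesis
  proof (rule ringI)
    show "abelian_group ?S"
      by (rule abelian_groupI) (auto simp: R.a_ac intro: R.l_neg bexI[of _ "\<ominus>\<^bsub>R\<^esub> _"])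
    show "monoid ?S"
      by (rule monoidI) (auto simp: R.m_assoc)
  qed (auto simp: R.l_distr R.r_distr)
qed

lemma ring_quot_alg:
  assumes "ideal I A"
  shows "ring (quot_alg A I)"
  unfolding quot_alg_def by (intro ring_extend ideal.quotient_is_ring assms)

lemma ideal_monoid_algebra:
  fixes I :: "('a \<Rightarrow>\<^sub>0 'k::comm_ring_1) set"
  assumes "monoid M" "ideal I (monoid_algebra M)"
  shows ideal_monoid_algebra_carrier: "f \<in> I \<Longrightarrow> keys f \<subseteq> carrier M"
    and ideal_monoid_algebra_0: "0 \<in> I"
    and ideal_monoid_algebra_add: "f \<in> I \<Longrightarrow> g \<in> I \<Longrightarrow> f + g \<in> I"
    and ideal_monoid_algebra_sc: "f \<in> I \<Longrightarrow> sc c f \<in> I"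
    and ideal_monoid_algebra_uminus: "f \<in> I \<Longrightarrow> - f \<in> I"
    and ideal_monoid_algebra_diff: "f \<in> I \<Longrightarrow> g \<in> I \<Longrightarrow> f - g \<in> I"
    and ideal_monoid_algebra_l: "f \<in> I \<Longrightarrow> keys h \<subseteq> carrier M \<Longrightarrow> h \<otimes>\<^bsub>monoid_algebra M\<^esub> f \<in> I"
    and ideal_monoid_algebra_r: "f \<in> I \<Longrightarrow> keys h \<subseteq> carrier M \<Longrightarrow> f \<otimes>\<^bsub>monoid_algebra M\<^esub> h \<in> I"
proof -
  interpret I: ideal I "monoid_algebra M :: ('k, 'a \<Rightarrow>\<^sub>0 'k) module" by fact
  interpret M: monoid M by fact
  have carrier: "keys f \<subseteq> carrier M" if "f \<in> I" for f
    using I.Icarr[OF that] by simp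
  then show "f \<in> I \<Longrightarrow> keys f \<subseteq> carrier M" .
  show "0 \<in> I" using additive_subgroup.zero_closed[OF I.additive_subgroup_axioms] by simp
  have add: "f + g \<in> I" if "f \<in> I" "g \<in> I" for f g using additive_subgroup.a_closed[OF I.additive_subgroup_axioms that] by simp
  then show "f \<in> I \<Longrightarrow> g \<in> I \<Longrightarrow> f + g \<in> I" .
  have l: "h \<otimes>\<^bsub>monoid_algebra M\<^esub> f \<in> I" if "f \<in> I" "keys h \<subseteq> carrier M" for f h
    using I.I_l_closed[of f h] that by simp
  then show "f \<in> I \<Longrightarrow> keys h \<subseteq> carrier M \<Longrightarrow> h \<otimes>\<^bsub>monoid_algebra M\<^esub> f \<in> I" .
  show "f \<in> I \<Longrightarrow> keys h \<subseteq> carrier M \<Longrightarrow> f \<otimes>\<^bsub>monoid_algebra M\<^esub> h \<in> I"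
    using I.I_r_closed[of f h] by simp
  \<comment> \<open>Scalars act as left multiplication by multiples of the unit, so an ideal of the
    ring is also a linear subspace.\<close>
  have sc: "sc c f \<in> I" if "f \<in> I" for f c
  proof -
    have "sc c f = sc c (\<one>\<^bsub>monoid_algebra M\<^esub> \<otimes>\<^bsub>monoid_algebra M\<^esub> f)"
      using I.l_one[of f] carrier[OF that] by (simp del: monoid_algebra_simps(2))
    also have "\<dots> = single \<one>\<^bsub>M\<^esub> c \<otimes>\<^bsub>monoid_algebra M\<^esub> f"
      by (simp add: monoid_algebra_sc_mult(1)[symmetric])
    finally show ?thesis using l[OF that, of "single \<one>\<^bsub>M\<^esub> c"] by simp
  qed
  then show "f \<in> I \<Longrightarrow> sc c f \<in> I" .
  have uminus: "- f \<in> I" if "f \<in> I" for f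
  proof -
    have "- f = sc (-1) f" by (rule poly_mapping_eqI) simp
    then show ?thesis using sc[OF that] by simp
  qed
  then show "f \<in> I \<Longrightarrow> - f \<in> I" .
  show "f \<in> I \<Longrightarrow> g \<in> I \<Longrightarrow> f - g \<in> I"
    using add[of f "- g"] uminus[of g] by simp
qed

text \<open>
  The algebra presented by the generators \<open>M\<close> and the relations \<open>R\<close> is identified with the image of
  \<open>lin_ext e\<close>: the map \<open>s\<close> picks a normal form for each basis element of the target.
\<close>
locale presentation =
  fixes M :: "'a monoid" and R :: "('a \<Rightarrow>\<^sub>0 'k::comm_ring_1) set"
    and e :: "'a \<Rightarrow> 'b \<Rightarrow>\<^sub>0 'k" and s :: "'b \<Rightarrow> 'a \<Rightarrow>\<^sub>0 'k"
  assumes monoid: "monoid M"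
    and rels_closed: "\<And>r. r \<in> R \<Longrightarrow> keys r \<subseteq> carrier M"
    and kill: "\<And>r u v. r \<in> R \<Longrightarrow> u \<in> carrier M \<Longrightarrow> v \<in> carrier M \<Longrightarrow>
      lin_ext e (single u 1 \<otimes>\<^bsub>monoid_algebra M\<^esub> r \<otimes>\<^bsub>monoid_algebra M\<^esub> single v 1) = 0"
    and normal_form: "\<And>w. w \<in> carrier M \<Longrightarrow> single w 1 - lin_ext s (e w) \<in> Idl\<^bsub>monoid_algebra M\<^esub> R"
begin

definition A :: "('k, 'a \<Rightarrow>\<^sub>0 'k) module" where "A = monoid_algebra M"

definition I :: "('a \<Rightarrow>\<^sub>0 'k) set" where "I = Idl\<^bsub>A\<^esub> R"

text \<open>The chosen representative is irrelevant: \<open>lin_ext e\<close> is constant on each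
  class, see \<open>coset_eq\<close>.\<close>

definition val :: "('a \<Rightarrow>\<^sub>0 'k) set \<Rightarrow> 'b \<Rightarrow>\<^sub>0 'k" where "val X = lin_ext e (SOME x. x \<in> X)"

sublocale A: ring A
  unfolding A_def by (rule ring_monoid_algebra[OF monoid])

sublocale I: ideal I A
  unfolding I_def using rels_closed by (intro A.genideal_ideal) (auto simp: A_def)

lemmas I_props = ideal_monoid_algebra[OF monoid I.ideal_axioms[unfolded A_def], folded A_def]

lemma normal_form_lin_ext:
  assumes "keys f \<subseteq> carrier M"
  shows "f - lin_ext s (lin_ext e f) \<in> I"
  using assms
proof (induction f rule: poly_mapping_induct_on)
  case zero
  then show ?case using I_props by simp
next
  case (sgl w c)
  have "sc c (single w 1 - lin_ext s (e w)) \<in> I"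
    using normal_form[OF sgl] I_props by (simp add: I_def A_def)
  then show ?case by (simp add: sc_diff lin_ext_sc)
next
  case (add f g)
  then show ?case
    using I_props(3)[OF add(3,4)] by (simp add: lin_ext_add algebra_simps)
qed

text \<open>\<open>normal_form_lin_ext\<close> puts the kernel of \<open>lin_ext e\<close> inside
  \<open>I\<close>. For the converse, \<open>lin_ext e\<close> is merely linear, so its kernel is
  not visibly an ideal. The set \<open>J\<close> of elements all of whose two-sided multiples by
  monoid elements are killed is an ideal; it contains the relations by \<open>kill\<close>, and
  taking both multipliers to be the unit leads back to the kernel.\<close>

lemma I_eq: "I = {f. keys f \<subseteq> carrier M \<and> lin_ext e f = 0}"
proof (intro equalityI subsetI)
  fix f assume f: "f \<in> {f. keys f \<subseteq> carrier M \<and> lin_ext e f = 0}"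
  then show "f \<in> I" using normal_form_lin_ext[of f] by simp
next
  let ?m = "mult A"
  define J where "J = {f. keys f \<subseteq> carrier M \<and> (\<forall>u\<in>carrier M. \<forall>v\<in>carrier M.
    lin_ext e (?m (?m (single u 1) f) (single v 1)) = 0)}"
  interpret M: monoid M by (rule monoid)
  have mult_single: "?m (single u 1) (single x c) = single (u \<otimes>\<^bsub>M\<^esub> x) c"
    "?m (single x c) (single u 1) = single (x \<otimes>\<^bsub>M\<^esub> u) c" for u x c
    by (simp_all add: A_def monoid_algebra_mult_single)
  note mult_simps = monoid_algebra_l_distr monoid_algebra_r_distr monoid_algebra_0_mult monoid_algebra_sc_mult
    lin_ext_add lin_ext_sc A_def
  have assoc: "?m (?m f g) h = ?m f (?m g h)"
    if "keys f \<subseteq> carrier M" "keys g \<subseteq> carrier M" "keys h \<subseteq> carrier M" for f g h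
    using that by (simp add: A_def monoid_algebra_assoc[OF monoid])
  have closed: "keys (?m f g) \<subseteq> carrier M"
    if "keys f \<subseteq> carrier M" "keys g \<subseteq> carrier M" for f g
    using that by (simp add: A_def monoid_algebra_closed[OF monoid])
  have "ideal J A"
  proof (rule idealI)
    show "ring A" ..
    show "subgroup J (add_monoid A)"
    proof (rule A.add.subgroupI)
      show "J \<subseteq> carrier A" by (auto simp: J_def A_def)
      have "0 \<in> J" by (simp add: J_def mult_simps)
      then show "J \<noteq> {}" by auto
    next
      fix a assume a: "a \<in> J"
      then have "a \<in> carrier A" by (auto simp: J_def A_def)
      then have "\<ominus>\<^bsub>A\<^esub> a = - a"
        by (intro A.minus_equality) (auto simp: A_def)
      moreover have "- a = sc (-1) a" by (rule poly_mapping_eqI) simp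
      moreover have "sc (-1) a \<in> J"
        using a keys_sc[of "-1" a] by (auto simp: J_def mult_simps)
      ultimately show "\<ominus>\<^bsub>A\<^esub> a \<in> J" by simp
    next
      fix a b assume "a \<in> J" "b \<in> J"
      then show "a \<oplus>\<^bsub>A\<^esub> b \<in> J"
        using Poly_Mapping.keys_add[of a b] by (auto simp: J_def mult_simps)
    qed
  next
    fix f x assume f: "f \<in> J" and x: "x \<in> carrier A"
    have kf: "keys f \<subseteq> carrier M" and kx: "keys x \<subseteq> carrier M"
      using f x by (auto simp: J_def A_def)
    have "lin_ext e (?m (?m (single u 1) (?m x f)) (single v 1)) = 0"
      if "u \<in> carrier M" "v \<in> carrier M" for u v
      using kx
    proof (induction x rule: poly_mapping_induct_on)
      case (sgl w c)
      have "?m (single u 1) (?m (single w c) f) = ?m (?m (single u 1) (single w c)) f"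
        using that sgl kf by (subst assoc) auto
      also have "\<dots> = sc c (?m (single (u \<otimes>\<^bsub>M\<^esub> w) 1) f)"
        by (simp add: monoid_algebra_mult_single A_def monoid_algebra_sc_mult(1)[symmetric])
      finally show ?case using f that sgl M.m_closed by (simp add: J_def mult_simps)
    qed (simp_all add: mult_simps)
    then show "x \<otimes>\<^bsub>A\<^esub> f \<in> J" using closed[OF kx kf] by (auto simp: J_def)
    have "lin_ext e (?m (?m (single u 1) (?m f x)) (single v 1)) = 0"
      if "u \<in> carrier M" "v \<in> carrier M" for u v
      using kx
    proof (induction x rule: poly_mapping_induct_on)
      case (sgl w c)
      have "?m (?m (single u 1) (?m f (single w c))) (single v 1)
          = ?m (?m (single u 1) f) (?m (single w c) (single v 1))"
        using that sgl kf by (simp add: assoc closed)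
      also have "\<dots> = sc c (?m (?m (single u 1) f) (single (w \<otimes>\<^bsub>M\<^esub> v) 1))"
        by (simp add: monoid_algebra_mult_single A_def monoid_algebra_sc_mult(2)[symmetric])
      finally show ?case using f that sgl M.m_closed by (simp add: J_def mult_simps)
    qed (simp_all add: mult_simps)
    then show "f \<otimes>\<^bsub>A\<^esub> x \<in> J" using closed[OF kf kx] by (auto simp: J_def)
  qed
  moreover have "R \<subseteq> J"
    using rels_closed kill by (auto simp: J_def A_def)
  ultimately have "I \<subseteq> J"
    unfolding I_def by (rule A.genideal_minimal)
  fix f assume "f \<in> I"
  then have f: "f \<in> J" using \<open>I \<subseteq> J\<close> by auto
  then have "lin_ext e (?m (?m (single \<one>\<^bsub>M\<^esub> 1) f) (single \<one>\<^bsub>M\<^esub> 1)) = 0"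
    by (auto simp: J_def)
  moreover have "single \<one>\<^bsub>M\<^esub> 1 = \<one>\<^bsub>A\<^esub>" by (simp add: A_def)
  moreover have "f \<in> carrier A" using f by (simp add: J_def A_def)
  ultimately have "lin_ext e f = 0" by simp
  with f show "f \<in> {f. keys f \<subseteq> carrier M \<and> lin_ext e f = 0}" by (auto simp: J_def)
qed

text \<open>As \<open>I\<close> is the kernel of \<open>lin_ext e\<close>, its cosets are the fibres
  of that map. This is what turns \<open>val\<close> into an injective coordinate map on the
  quotient.\<close>

lemma coset_eq:
  assumes "keys f \<subseteq> carrier M"
  shows "I +>\<^bsub>A\<^esub> f = {g. keys g \<subseteq> carrier M \<and> lin_ext e g = lin_ext e f}"
proof -
  have "I +>\<^bsub>A\<^esub> f = {i + f | i. i \<in> I}"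
    by (auto simp: a_r_coset_def r_coset_def A_def)
  also have "\<dots> = {g. keys g \<subseteq> carrier M \<and> lin_ext e g = lin_ext e f}"
  proof (intro equalityI subsetI)
    fix g assume "g \<in> {i + f | i. i \<in> I}"
    then show "g \<in> {g. keys g \<subseteq> carrier M \<and> lin_ext e g = lin_ext e f}"
      using assms Poly_Mapping.keys_add[of _ f] by (fastforce simp: I_eq lin_ext_add)
  next
    fix g assume "g \<in> {g. keys g \<subseteq> carrier M \<and> lin_ext e g = lin_ext e f}"
    then have "g - f \<in> I"
      using assms keys_diff[of g f] by (auto simp: I_eq lin_ext_diff)
    then show "g \<in> {i + f | i. i \<in> I}" by (intro CollectI exI[of _ "g - f"]) auto
  qed
  finally show ?thesis .
qed

lemma val_eq:
  assumes "X \<noteq> {}" "\<And>x. x \<in> X \<Longrightarrow> lin_ext e x = y"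
  shows "val X = y"
  unfolding val_def using assms by (auto intro: someI2)

lemma val_coset: "keys f \<subseteq> carrier M \<Longrightarrow> val (I +>\<^bsub>A\<^esub> f) = lin_ext e f"
  by (rule val_eq) (auto simp: coset_eq)

definition Q :: "('k, ('a \<Rightarrow>\<^sub>0 'k) set) module" where "Q = quot_alg A I"

sublocale Q: ring Q
  unfolding Q_def by (rule ring_quot_alg) (rule I.ideal_axioms)

lemma Q_carrier: "carrier Q = {I +>\<^bsub>A\<^esub> f | f. keys f \<subseteq> carrier M}"
  by (auto simp: Q_def quot_alg_simps A_RCOSETS_def RCOSETS_def a_r_coset_def A_def)

lemma Q_cases:
  assumes "X \<in> carrier Q"
  obtains f where "keys f \<subseteq> carrier M" "X = I +>\<^bsub>A\<^esub> f" "val X = lin_ext e f"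
  using assms by (auto simp: Q_carrier val_coset)

lemma coset_in_Q: "keys f \<subseteq> carrier M \<Longrightarrow> I +>\<^bsub>A\<^esub> f \<in> carrier Q"
  by (auto simp: Q_carrier)

lemma Q_memD: "X \<in> carrier Q \<Longrightarrow> x \<in> X \<Longrightarrow> keys x \<subseteq> carrier M \<and> lin_ext e x = val X"
  by (auto elim!: Q_cases simp: coset_eq)

lemma Q_nonempty: "X \<in> carrier Q \<Longrightarrow> X \<noteq> {}"
  by (elim Q_cases) (use coset_eq in blast)

lemma val_inj: "inj_on val (carrier Q)"
  by (auto simp: inj_on_def coset_eq elim!: Q_cases)

lemma val_image: "val ` carrier Q = lin_ext e ` {f. keys f \<subseteq> carrier M}"
proof -
  have "carrier Q = (\<lambda>f. I +>\<^bsub>A\<^esub> f) ` {f. keys f \<subseteq> carrier M}"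
    by (auto simp: Q_carrier)
  then show ?thesis
    by (simp add: image_image val_coset)
qed

lemma Q_mult_coset:
  assumes "keys f \<subseteq> carrier M" "keys g \<subseteq> carrier M"
  shows "(I +>\<^bsub>A\<^esub> f) \<otimes>\<^bsub>Q\<^esub> (I +>\<^bsub>A\<^esub> g) = I +>\<^bsub>A\<^esub> (f \<otimes>\<^bsub>A\<^esub> g)"
  using assms I.rcoset_mult_add[of f g] by (simp add: Q_def quot_alg_simps A_def)

lemma Q_one: "\<one>\<^bsub>Q\<^esub> = I +>\<^bsub>A\<^esub> single \<one>\<^bsub>M\<^esub> 1"
  by (simp add: Q_def quot_alg_simps A_def)

lemma val_add:
  assumes "X \<in> carrier Q" "Y \<in> carrier Q"
  shows "val (X \<oplus>\<^bsub>Q\<^esub> Y) = val X + val Y"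
proof -
  obtain f where f: "keys f \<subseteq> carrier M" "X = I +>\<^bsub>A\<^esub> f" "val X = lin_ext e f"
    using assms(1) by (rule Q_cases)
  obtain g where g: "keys g \<subseteq> carrier M" "Y = I +>\<^bsub>A\<^esub> g" "val Y = lin_ext e g"
    using assms(2) by (rule Q_cases)
  have k: "keys (f + g) \<subseteq> carrier M"
    using f(1) g(1) Poly_Mapping.keys_add[of f g] by (meson Un_least subset_trans)
  have "X \<oplus>\<^bsub>Q\<^esub> Y = I +>\<^bsub>A\<^esub> (f \<oplus>\<^bsub>A\<^esub> g)"
    using f(1) g(1) unfolding f(2) g(2) Q_def quot_alg_simps by (intro I.a_rcos_sum) (simp_all add: A_def)
  also have "f \<oplus>\<^bsub>A\<^esub> g = f + g" by (simp add: A_def)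
  finally show ?thesis unfolding f(3) g(3) by (simp add: val_coset[OF k] lin_ext_add)
qed

lemma Q_smult_coset:
  assumes f: "keys f \<subseteq> carrier M"
  shows "c \<odot>\<^bsub>Q\<^esub> (I +>\<^bsub>A\<^esub> f) = I +>\<^bsub>A\<^esub> sc c f"
proof -
  let ?X = "I +>\<^bsub>A\<^esub> f"
  have X: "?X \<in> carrier Q" by (rule coset_in_Q[OF f])
  have "I +>\<^bsub>A\<^esub> sc c x = I +>\<^bsub>A\<^esub> sc c f" if "x \<in> ?X" for x
  proof -
    have x: "keys x \<subseteq> carrier M" "lin_ext e x = lin_ext e f"
      using Q_memD[OF X that] val_coset[OF f] by auto
    have "keys (sc c x) \<subseteq> carrier M" "keys (sc c f) \<subseteq> carrier M"
      using x(1) f keys_sc by (meson subset_trans)+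
    then show ?thesis by (simp add: coset_eq lin_ext_sc x(2))
  qed
  then have "(\<Union>x\<in>?X. I +>\<^bsub>A\<^esub> sc c x) = (\<Union>x\<in>?X. I +>\<^bsub>A\<^esub> sc c f)"
    by (intro SUP_cong refl)
  then show ?thesis
    using Q_nonempty[OF X] by (simp add: Q_def quot_alg_simps A_def)
qed

lemma val_smult:
  assumes "X \<in> carrier Q"
  shows Q_smult_closed: "c \<odot>\<^bsub>Q\<^esub> X \<in> carrier Q" and "val (c \<odot>\<^bsub>Q\<^esub> X) = sc c (val X)"
proof -
  obtain f where f: "keys f \<subseteq> carrier M" "X = I +>\<^bsub>A\<^esub> f" "val X = lin_ext e f"
    using assms by (rule Q_cases)
  have k: "keys (sc c f) \<subseteq> carrier M"
    using f(1) keys_sc by (rule subset_trans[rotated])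
  show "c \<odot>\<^bsub>Q\<^esub> X \<in> carrier Q"
    unfolding f(2) Q_smult_coset[OF f(1)] by (rule coset_in_Q[OF k])
  show "val (c \<odot>\<^bsub>Q\<^esub> X) = sc c (val X)"
    unfolding f(3) unfolding f(2) Q_smult_coset[OF f(1)] by (simp add: val_coset[OF k] lin_ext_sc)
qed

lemma smult_mult:
  assumes "X \<in> carrier Q" "Y \<in> carrier Q"
  shows smult_mult_left: "(c \<odot>\<^bsub>Q\<^esub> X) \<otimes>\<^bsub>Q\<^esub> Y = c \<odot>\<^bsub>Q\<^esub> (X \<otimes>\<^bsub>Q\<^esub> Y)"
    and smult_mult_right: "X \<otimes>\<^bsub>Q\<^esub> (c \<odot>\<^bsub>Q\<^esub> Y) = c \<odot>\<^bsub>Q\<^esub> (X \<otimes>\<^bsub>Q\<^esub> Y)"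
proof -
  obtain f where f: "keys f \<subseteq> carrier M" "X = I +>\<^bsub>A\<^esub> f"
    using assms(1) by (rule Q_cases)
  obtain g where g: "keys g \<subseteq> carrier M" "Y = I +>\<^bsub>A\<^esub> g"
    using assms(2) by (rule Q_cases)
  have k: "keys (sc c f) \<subseteq> carrier M" "keys (sc c g) \<subseteq> carrier M"
    using f(1) g(1) keys_sc by (meson subset_trans)+
  have m: "keys (f \<otimes>\<^bsub>A\<^esub> g) \<subseteq> carrier M"
    unfolding A_def by (rule monoid_algebra_closed[OF monoid f(1) g(1)])
  have A: "sc c f \<otimes>\<^bsub>A\<^esub> g = sc c (f \<otimes>\<^bsub>A\<^esub> g)" "f \<otimes>\<^bsub>A\<^esub> sc c g = sc c (f \<otimes>\<^bsub>A\<^esub> g)"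
    by (simp_all add: A_def monoid_algebra_sc_mult)
  show "(c \<odot>\<^bsub>Q\<^esub> X) \<otimes>\<^bsub>Q\<^esub> Y = c \<odot>\<^bsub>Q\<^esub> (X \<otimes>\<^bsub>Q\<^esub> Y)" "X \<otimes>\<^bsub>Q\<^esub> (c \<odot>\<^bsub>Q\<^esub> Y) = c \<odot>\<^bsub>Q\<^esub> (X \<otimes>\<^bsub>Q\<^esub> Y)"
    unfolding f(2) g(2) Q_smult_coset[OF f(1)] Q_smult_coset[OF g(1)]
      Q_mult_coset[OF f(1) g(1)] Q_mult_coset[OF k(1) g(1)] Q_mult_coset[OF f(1) k(2)]
      Q_smult_coset[OF m] A by simp_all
qed

text \<open>\<open>quot_map\<close> takes a union over all representatives. Since their images share
  the value \<open>y\<close>, they lie in a single coset, and the union is that coset.\<close>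

lemma quot_map:
  assumes "X \<noteq> {}" "\<And>x. x \<in> X \<Longrightarrow> keys (\<phi> x) \<subseteq> carrier M" "\<And>x. x \<in> X \<Longrightarrow> lin_ext e (\<phi> x) = y"
  shows quot_map_closed: "quot_map A I \<phi> X \<in> carrier Q"
    and val_quot_map: "val (quot_map A I \<phi> X) = y"
proof -
  obtain x where x: "x \<in> X" using assms(1) by auto
  have "I +>\<^bsub>A\<^esub> \<phi> x' = I +>\<^bsub>A\<^esub> \<phi> x" if "x' \<in> X" for x'
    using assms(2,3) that x by (simp add: coset_eq)
  then have "(\<Union>x'\<in>X. I +>\<^bsub>A\<^esub> \<phi> x') = (\<Union>x'\<in>X. I +>\<^bsub>A\<^esub> \<phi> x)"
    by (intro SUP_cong refl)
  then have *: "quot_map A I \<phi> X = I +>\<^bsub>A\<^esub> \<phi> x"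
    using assms(1) by (simp add: quot_map_def)
  show "quot_map A I \<phi> X \<in> carrier Q" "val (quot_map A I \<phi> X) = y"
    unfolding * using assms(2,3)[OF x] by (simp_all add: coset_in_Q val_coset)
qed

end

subsection \<open>Ring homomorphisms between monoid rings\<close>

lemma sc_conv_mult: "sc c f = single 0 c * f"
  by (rule mult_map_scale_conv_mult)

lemma sc_mult_left: "sc c f * g = sc c (f * g)" for f g :: "'a::comm_monoid_add \<Rightarrow>\<^sub>0 'k::comm_ring_1"
  by (simp add: sc_conv_mult mult.assoc)

lemma sc_mult_right: "f * sc c g = sc c (f * g)" for f g :: "'a::comm_monoid_add \<Rightarrow>\<^sub>0 'k::comm_ring_1"
  by (simp add: sc_conv_mult mult.left_commute)

text \<open>A linear extension is multiplicative as soon as it is so on monomials. This one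
  criterion serves for \<open>emb\<close>, \<open>scale1\<close>, \<open>iota\<close>,
  \<open>permp\<close>, \<open>subst\<close>, \<open>embn\<close> and \<open>scalen\<close>.\<close>

lemma lin_ext_mult:
  fixes f g :: "'a::comm_monoid_add \<Rightarrow>\<^sub>0 'k::comm_ring_1" and \<chi> :: "'a \<Rightarrow> 'b::comm_monoid_add \<Rightarrow>\<^sub>0 'k"
  assumes "\<And>x y. x \<in> K \<Longrightarrow> y \<in> K \<Longrightarrow> \<chi> (x + y) = \<chi> x * \<chi> y" "keys f \<subseteq> K" "keys g \<subseteq> K"
  shows "lin_ext \<chi> (f * g) = lin_ext \<chi> f * lin_ext \<chi> g"
  using assms(2)
proof (induction f rule: poly_mapping_induct_on)
  case (sgl x c)
  show ?case using assms(3)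
    by (induction g rule: poly_mapping_induct_on)
      (use sgl in \<open>simp_all add: mult_single assms(1) lin_ext_add distrib_left distrib_right sc_add_right sc_mult_left sc_mult_right mult.commute\<close>)
qed (simp_all add: lin_ext_add distrib_right)

lemma lin_ext_1:
  fixes \<chi> :: "'a::comm_monoid_add \<Rightarrow> 'b::comm_monoid_add \<Rightarrow>\<^sub>0 'k::comm_ring_1"
  assumes "\<chi> 0 = 1"
  shows "lin_ext \<chi> 1 = 1"
  using lin_ext_single[of \<chi> 0 1] assms by simp

lemma keys_mult_closed:
  fixes f g :: "'a::comm_monoid_add \<Rightarrow>\<^sub>0 'k::comm_ring_1"
  assumes "\<And>x y. x \<in> K \<Longrightarrow> y \<in> K \<Longrightarrow> x + y \<in> K" "keys f \<subseteq> K" "keys g \<subseteq> K"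
  shows "keys (f * g) \<subseteq> K"
  using assms keys_mult[of f g] by blast

lemma keys_add_closed: "keys f \<subseteq> K \<Longrightarrow> keys g \<subseteq> K \<Longrightarrow> keys (f + g) \<subseteq> K"
  using Poly_Mapping.keys_add[of f g] by blast

lemma keys_diff_closed: "keys f \<subseteq> K \<Longrightarrow> keys g \<subseteq> K \<Longrightarrow> keys (f - g) \<subseteq> K"
  using keys_diff[of f g] by blast

lemma keys_sc_closed: "keys f \<subseteq> K \<Longrightarrow> keys (sc c f) \<subseteq> K"
  using keys_sc[of c f] by blast

subsection \<open>The normal form of a generalized Weyl algebra\<close>

text \<open>The target consists of Laurent polynomials in two commuting variables h and t. The
  exponent pair \<open>(i, j)\<close> stands for h^i X^j in D(a, \<sigma>), where X^j is a power of
  X^+ for j >= 0 and the power of X^- with exponent -j otherwise. The commutative product of the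
  target models only left multiplication by D.\<close>

definition emb :: "(int \<Rightarrow>\<^sub>0 'k::comm_ring_1) \<Rightarrow> (int \<times> int \<Rightarrow>\<^sub>0 'k)" where
  "emb = lin_ext (\<lambda>i. single (i, 0) 1)"

definition tpow :: "int \<Rightarrow> (int \<times> int \<Rightarrow>\<^sub>0 'k::comm_ring_1)" where
  "tpow j = single (0, j) 1"

definition scale1 :: "'k::field \<Rightarrow> (int \<times> int \<Rightarrow>\<^sub>0 'k) \<Rightarrow> (int \<times> int \<Rightarrow>\<^sub>0 'k)" where
  "scale1 z = lin_ext (\<lambda>x. single x (z powi snd x))"

lemma emb_add: "emb (f + g) = emb f + emb g"
  by (simp add: emb_def lin_ext_add)

lemma emb_sc: "emb (sc c f) = sc c (emb f)"
  by (simp add: emb_def lin_ext_sc)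

lemma emb_0 [simp]: "emb 0 = 0"
  by (simp add: emb_def)

lemma emb_1 [simp]: "emb 1 = 1"
  unfolding emb_def by (rule lin_ext_1) (simp flip: zero_prod_def)

lemma emb_single: "emb (single i c) = single (i, 0) c"
  by (simp add: emb_def)

lemma emb_mult: "emb (f * g) = emb f * emb g"
  unfolding emb_def by (rule lin_ext_mult[of UNIV]) (simp_all add: mult_single)

lemma emb_tpow: "emb (single i c) * tpow j = single (i, j) c"
  by (simp add: emb_single tpow_def mult_single)

lemma tpow_0 [simp]: "tpow 0 = 1"
  by (simp add: tpow_def flip: zero_prod_def)

lemma scale1_emb: "scale1 z (emb d) = emb d"
  by (simp add: scale1_def emb_def lin_ext_lin_ext)

lemma scale1_tpow: "scale1 z (tpow j) = sc (z powi j) (tpow j)"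
  by (simp add: scale1_def tpow_def)

lemma scale1_mult: "z \<noteq> 0 \<Longrightarrow> scale1 z (f * g) = scale1 z f * scale1 z g"
  unfolding scale1_def by (rule lin_ext_mult[of UNIV]) (simp_all add: mult_single power_int_add)

lemma scale1_1 [simp]: "scale1 z 1 = 1"
  unfolding scale1_def by (rule lin_ext_1) simp

lemma scale1_sc: "scale1 z (sc c f) = sc c (scale1 z f)"
  by (simp add: scale1_def lin_ext_sc)

text \<open>\<open>S\<close> is the set of admissible exponents of h. That it is a submonoid of the
  integers is all that the normal form requires, which treats both base rings at once.\<close>

locale gwa_data =
  fixes S :: "int set" and D :: "('k::field, int \<Rightarrow>\<^sub>0 'k) module"
    and a :: "int \<Rightarrow>\<^sub>0 'k" and \<sigma> :: "(int \<Rightarrow>\<^sub>0 'k) \<Rightarrow> (int \<Rightarrow>\<^sub>0 'k)"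
  assumes S_0: "0 \<in> S" and S_add: "\<And>i j. i \<in> S \<Longrightarrow> j \<in> S \<Longrightarrow> i + j \<in> S"
    and D_def: "D = laurent_alg\<lparr>carrier := {f. keys f \<subseteq> S}\<rparr>"
    and a: "a \<in> carrier D" and \<sigma>: "\<sigma> \<in> alg_auts D"
begin

lemma D_simps [simp]:
  "carrier D = {f. keys f \<subseteq> S}" "\<one>\<^bsub>D\<^esub> = 1" "\<zero>\<^bsub>D\<^esub> = 0"
  "x \<oplus>\<^bsub>D\<^esub> y = x + y" "x \<otimes>\<^bsub>D\<^esub> y = x * y" "c \<odot>\<^bsub>D\<^esub> x = sc c x"
  by (simp_all add: D_def laurent_alg_def)

abbreviation C :: "(int \<Rightarrow>\<^sub>0 'k) set" where "C \<equiv> {f. keys f \<subseteq> S}"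

lemma C_add: "f \<in> C \<Longrightarrow> g \<in> C \<Longrightarrow> f + g \<in> C"
  by (simp add: keys_add_closed)

lemma C_mult: "f \<in> C \<Longrightarrow> g \<in> C \<Longrightarrow> f * g \<in> C"
  using keys_mult_closed[of S f g] S_add by simp

lemma C_sc: "f \<in> C \<Longrightarrow> sc c f \<in> C"
  by (simp add: keys_sc_closed)

lemma C_1: "1 \<in> C"
  using S_0 by simp

lemma C_single: "i \<in> S \<Longrightarrow> single i c \<in> C"
  by simp

definition alg_endo :: "((int \<Rightarrow>\<^sub>0 'k) \<Rightarrow> (int \<Rightarrow>\<^sub>0 'k)) \<Rightarrow> bool" where
  "alg_endo \<rho> \<longleftrightarrow> (\<forall>f\<in>C. \<forall>g\<in>C. \<rho> f \<in> C \<and> \<rho> (f + g) = \<rho> f + \<rho> g \<and> \<rho> (f * g) = \<rho> f * \<rho> g) \<and>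
    \<rho> 1 = 1 \<and> (\<forall>f\<in>C. \<forall>c. \<rho> (sc c f) = sc c (\<rho> f))"

lemma alg_endoD:
  assumes "alg_endo \<rho>"
  shows "f \<in> C \<Longrightarrow> \<rho> f \<in> C" "f \<in> C \<Longrightarrow> g \<in> C \<Longrightarrow> \<rho> (f + g) = \<rho> f + \<rho> g"
    "f \<in> C \<Longrightarrow> g \<in> C \<Longrightarrow> \<rho> (f * g) = \<rho> f * \<rho> g" "\<rho> 1 = 1"
    "f \<in> C \<Longrightarrow> \<rho> (sc c f) = sc c (\<rho> f)" "\<rho> 0 = 0"
proof -
  have "\<rho> (sc 0 1) = sc 0 (\<rho> 1)"
    using assms C_1 unfolding alg_endo_def by blast
  then show "\<rho> 0 = 0" by simp
qed (use assms in \<open>auto simp: alg_endo_def\<close>)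

definition \<tau> :: "(int \<Rightarrow>\<^sub>0 'k) \<Rightarrow> (int \<Rightarrow>\<^sub>0 'k)" where "\<tau> = inv_into C \<sigma>"

lemma alg_endo_\<sigma>: "alg_endo \<sigma>"
  using \<sigma> C_1 by (auto simp: alg_endo_def alg_auts_def ring_iso_def ring_hom_def)

lemma bij_\<sigma>: "bij_betw \<sigma> C C"
  using \<sigma> by (simp add: alg_auts_def ring_iso_def)

lemma \<tau>_\<sigma>: "f \<in> C \<Longrightarrow> \<tau> (\<sigma> f) = f"
  unfolding \<tau>_def using bij_\<sigma> by (meson bij_betw_imp_inj_on inv_into_f_f)

lemma \<sigma>_\<tau>: "f \<in> C \<Longrightarrow> \<sigma> (\<tau> f) = f"
  unfolding \<tau>_def using bij_\<sigma> by (meson bij_betw_inv_into_right)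

lemma \<tau>_C: "f \<in> C \<Longrightarrow> \<tau> f \<in> C"
  unfolding \<tau>_def using bij_\<sigma> by (metis bij_betwE bij_betw_inv_into)

lemma alg_endo_\<tau>: "alg_endo \<tau>"
proof -
  have eq: "\<tau> g = f" if "f \<in> C" "\<sigma> f = g" for f g using \<tau>_\<sigma> that by auto
  note \<sigma> = alg_endoD[OF alg_endo_\<sigma>]
  show ?thesis
    unfolding alg_endo_def
  proof (intro conjI ballI allI)
    fix f g c assume f: "f \<in> C"
    show "\<tau> f \<in> C" by (rule \<tau>_C[OF f])
    show "\<tau> (sc c f) = sc c (\<tau> f)"
      using \<sigma>(5)[OF \<tau>_C[OF f]] \<sigma>_\<tau>[OF f] C_sc[OF \<tau>_C[OF f]] by (intro eq) auto
    assume g: "g \<in> C"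
    show "\<tau> (f + g) = \<tau> f + \<tau> g"
      using \<sigma>(2)[OF \<tau>_C[OF f] \<tau>_C[OF g]] \<sigma>_\<tau>[OF f] \<sigma>_\<tau>[OF g] C_add[OF \<tau>_C[OF f] \<tau>_C[OF g]]
      by (intro eq) auto
    show "\<tau> (f * g) = \<tau> f * \<tau> g"
      using \<sigma>(3)[OF \<tau>_C[OF f] \<tau>_C[OF g]] \<sigma>_\<tau>[OF f] \<sigma>_\<tau>[OF g] C_mult[OF \<tau>_C[OF f] \<tau>_C[OF g]]
      by (intro eq) auto
  qed (use eq[OF C_1 \<sigma>(4)] in auto)
qed

text \<open>
  \<open>op g\<close> is left multiplication by the generator \<open>g\<close> on the free \<open>D\<close>-module with basis
  \<open>(X\<^sup>+)\<^sup>j\<close> and \<open>(X\<^sup>-)\<^sup>j\<close>, written as \<open>tpow j\<close> and \<open>tpow (-j)\<close>.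
\<close>
definition shift_op :: "((int \<Rightarrow>\<^sub>0 'k) \<Rightarrow> (int \<Rightarrow>\<^sub>0 'k)) \<Rightarrow> (int \<Rightarrow> int \<Rightarrow>\<^sub>0 'k) \<Rightarrow> int \<Rightarrow>
    (int \<times> int \<Rightarrow>\<^sub>0 'k) \<Rightarrow> (int \<times> int \<Rightarrow>\<^sub>0 'k)" where
  "shift_op \<rho> u \<delta> = lin_ext (\<lambda>(i, j). emb (\<rho> (single i 1) * u j) * tpow (j + \<delta>))"

text \<open>On X^j with j >= 0 the generator X^+ just raises the power. On X^j with j < 0 it meets a
  letter X^-, and X^+ X^- = \<sigma>(a) leaves the coefficient \<open>\<sigma> a\<close>.
  Symmetrically, X^- cancels against X^+ with coefficient \<open>a\<close> exactly when j >
  0.\<close>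

fun op :: "(int \<Rightarrow>\<^sub>0 'k) gwa_gen \<Rightarrow> (int \<times> int \<Rightarrow>\<^sub>0 'k) \<Rightarrow> (int \<times> int \<Rightarrow>\<^sub>0 'k)" where
  "op (Coef d) = (\<lambda>v. emb d * v)"
| "op XPlus = shift_op \<sigma> (\<lambda>j. if j \<ge> 0 then 1 else \<sigma> a) 1"
| "op XMinus = shift_op \<tau> (\<lambda>j. if j \<le> 0 then 1 else a) (-1)"

abbreviation V :: "(int \<times> int \<Rightarrow>\<^sub>0 'k) set" where "V \<equiv> {v. keys v \<subseteq> S \<times> UNIV}"

lemma emb_V: "d \<in> C \<Longrightarrow> emb d * tpow j \<in> V"
proof -
  assume "d \<in> C"
  then have "keys d \<subseteq> S" by simp
  then have "keys (emb d * tpow j) \<subseteq> S \<times> UNIV"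
    by (induction d rule: poly_mapping_induct_on)
      (simp_all add: emb_tpow emb_add distrib_right keys_add_closed)
  then show ?thesis by simp
qed

lemma V_induct [consumes 1, case_names basis sc add]:
  assumes "v \<in> V" and basis: "\<And>i j. i \<in> S \<Longrightarrow> P (emb (single i 1) * tpow j)"
    and sc: "\<And>v c. v \<in> V \<Longrightarrow> P v \<Longrightarrow> P (sc c v)" and add: "\<And>v w. v \<in> V \<Longrightarrow> w \<in> V \<Longrightarrow> P v \<Longrightarrow> P w \<Longrightarrow> P (v + w)"
  shows "P v"
proof -
  from assms(1) have "keys v \<subseteq> S \<times> UNIV" by simp
  then show ?thesis
  proof (induction v rule: poly_mapping_induct_on)
    case zero
    show ?case using sc[OF emb_V[OF C_single[OF S_0]] basis[OF S_0], of 0] by simp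
  next
    case (sgl x c)
    obtain i j where x: "x = (i, j)" "i \<in> S" using sgl by auto
    have "P (sc c (emb (single i 1) * tpow j))"
      by (intro sc basis emb_V C_single x(2))
    then show ?case by (simp add: emb_tpow x(1))
  qed (use add in auto)
qed

lemma shift_op_add: "shift_op \<rho> u \<delta> (v + w) = shift_op \<rho> u \<delta> v + shift_op \<rho> u \<delta> w"
  by (simp add: shift_op_def lin_ext_add)

lemma shift_op_sc: "shift_op \<rho> u \<delta> (sc c v) = sc c (shift_op \<rho> u \<delta> v)"
  by (simp add: shift_op_def lin_ext_sc)

lemma shift_op_emb:
  assumes "alg_endo \<rho>" "d \<in> C"
  shows "shift_op \<rho> u \<delta> (emb d * tpow j) = emb (\<rho> d * u j) * tpow (j + \<delta>)"
proof -
  have "keys d \<subseteq> S" using assms(2) by simp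
  then show ?thesis
  proof (induction d rule: poly_mapping_induct_on)
    case zero
    then show ?case by (simp add: shift_op_def alg_endoD[OF assms(1)])
  next
    case (sgl i c)
    have "\<rho> (single i c) = sc c (\<rho> (single i 1))"
      using alg_endoD(5)[OF assms(1) C_single[OF sgl], of c 1] by simp
    then show ?case
      by (simp add: emb_tpow shift_op_def emb_sc sc_mult_left)
  next
    case (add f g)
    then show ?case
      using alg_endoD(2)[OF assms(1), of f g] by (simp add: emb_add distrib_right shift_op_add)
  qed
qed

lemma shift_op_V:
  assumes "alg_endo \<rho>" "\<And>j. u j \<in> C" "v \<in> V"
  shows "shift_op \<rho> u \<delta> v \<in> V"
  using assms(3)
proof (induction v rule: V_induct)
  case (basis i j)
  have "\<rho> (single i 1) * u j \<in> C"
    by (intro C_mult assms(2) alg_endoD(1)[OF assms(1)] C_single[OF basis])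
  then show ?case
    unfolding shift_op_emb[OF assms(1) C_single[OF basis]] by (rule emb_V)
qed (simp_all add: shift_op_add shift_op_sc keys_add_closed keys_sc_closed)

text \<open>This is the commutation relation X d = \<rho>(d) X as an identity of operators; it holds
  because \<rho> is multiplicative and the power of X is moved independently of the
  coefficient.\<close>

lemma shift_op_emb_mult:
  assumes "alg_endo \<rho>" "d \<in> C" "v \<in> V"
  shows "shift_op \<rho> u \<delta> (emb d * v) = emb (\<rho> d) * shift_op \<rho> u \<delta> v"
  using assms(3)
proof (induction v rule: V_induct)
  case (basis i j)
  have "emb d * (emb (single i 1) * tpow j) = emb (d * single i 1) * tpow j"
    by (simp add: emb_mult mult.assoc)
  then show ?case
    using shift_op_emb[OF assms(1) C_mult[OF assms(2) C_single[OF basis]], of u \<delta> 1 j]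
      shift_op_emb[OF assms(1) C_single[OF basis], of u \<delta> 1 j]
      alg_endoD(3)[OF assms(1,2) C_single[OF basis], of 1]
    by (simp add: emb_mult mult.assoc)
qed (simp_all add: shift_op_add shift_op_sc distrib_left sc_mult_right)

text \<open>Shifting X^j by \<delta> and back multiplies its coefficient by \<rho>'(u j) u'(j +
  \<delta>), and the assumption \<open>u\<close> asks for the same value b at every j. For X^- X^+
  the factor a arises in the second step if j >= 0, and as \<tau>(\<sigma> a) from the first step if
  j < 0.\<close>

lemma shift_op_shift_op:
  assumes "alg_endo \<rho>" "alg_endo \<rho>'" "\<And>f. f \<in> C \<Longrightarrow> \<rho>' (\<rho> f) = f" "v \<in> V" "\<And>j. u j \<in> C"
    and u: "\<And>j. \<rho>' (u j) * u' (j + \<delta>) = b"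
  shows "shift_op \<rho>' u' (-\<delta>) (shift_op \<rho> u \<delta> v) = emb b * v"
  using assms(4)
proof (induction v rule: V_induct)
  case (basis i j)
  let ?h = "single i 1 :: int \<Rightarrow>\<^sub>0 'k"
  have h: "?h \<in> C" by (rule C_single[OF basis])
  have "shift_op \<rho>' u' (-\<delta>) (shift_op \<rho> u \<delta> (emb ?h * tpow j))
      = emb (\<rho>' (\<rho> ?h * u j) * u' (j + \<delta>)) * tpow j"
    using shift_op_emb[OF assms(2) C_mult[OF alg_endoD(1)[OF assms(1) h] assms(5)], of u' "-\<delta>" j "j + \<delta>"]
    by (simp add: shift_op_emb[OF assms(1) h])
  also have "\<rho>' (\<rho> ?h * u j) * u' (j + \<delta>) = b * ?h"
    using alg_endoD(3)[OF assms(2) alg_endoD(1)[OF assms(1) h] assms(5)] assms(3)[OF h] u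
    by (simp add: mult_ac)
  finally show ?case by (simp add: emb_mult mult.assoc)
qed (simp_all add: shift_op_add shift_op_sc distrib_left sc_mult_right)

lemma op_add: "op g (v + w) = op g v + op g w"
  by (cases g) (simp_all add: shift_op_add distrib_left)

lemma op_sc: "op g (sc c v) = sc c (op g v)"
  by (cases g) (simp_all add: shift_op_sc sc_mult_right)

lemma op_0 [simp]: "op g 0 = 0"
  using op_sc[of g 0 0] by simp

abbreviation "gens \<equiv> insert XPlus (insert XMinus (Coef ` C))"

lemma \<sigma>_a: "\<sigma> a \<in> C"
  using a alg_endoD(1)[OF alg_endo_\<sigma>] by simp

lemma V_mult: "v \<in> V \<Longrightarrow> w \<in> V \<Longrightarrow> v * w \<in> V"
  using keys_mult_closed[of "S \<times> UNIV" v w] S_add by auto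

lemma a_C: "a \<in> C"
  using a by simp

lemma op_V: "g \<in> gens \<Longrightarrow> v \<in> V \<Longrightarrow> op g v \<in> V"
proof (elim insertE imageE)
  assume v: "v \<in> V"
  show "g = XPlus \<Longrightarrow> op g v \<in> V"
    using shift_op_V[OF alg_endo_\<sigma> _ v, of "\<lambda>j. if j \<ge> 0 then 1 else \<sigma> a" 1] C_1 \<sigma>_a by simp
  show "g = XMinus \<Longrightarrow> op g v \<in> V"
    using shift_op_V[OF alg_endo_\<tau> _ v, of "\<lambda>j. if j \<le> 0 then 1 else a" "-1"] C_1 a_C by simp
  show "op g v \<in> V" if "g = Coef d" "d \<in> C" for d
    using V_mult[OF emb_V[OF that(2), of 0] v] that(1) by simp
qed

definition rep :: "(int \<Rightarrow>\<^sub>0 'k) gwa_gen list \<Rightarrow> (int \<times> int \<Rightarrow>\<^sub>0 'k) \<Rightarrow> (int \<times> int \<Rightarrow>\<^sub>0 'k)" where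
  "rep w v = foldr op w v"

lemma rep_add: "rep w (u + v) = rep w u + rep w v"
  by (induction w) (simp_all add: rep_def op_add)

lemma rep_sc: "rep w (sc c v) = sc c (rep w v)"
  by (induction w) (simp_all add: rep_def op_sc)

lemma rep_0 [simp]: "rep w 0 = 0"
  using rep_sc[of w 0 0] by simp

lemma rep_V: "w \<in> lists gens \<Longrightarrow> v \<in> V \<Longrightarrow> rep w v \<in> V"
proof (induction w)
  case (Cons g w)
  then have "op g (rep w v) \<in> V" by (intro op_V) auto
  then show ?case by (simp add: rep_def)
qed (simp add: rep_def)

lemma rep_simps: "rep [] v = v" "rep (g # w) v = op g (rep w v)"
  by (simp_all add: rep_def)

lemma rep_append: "rep (w @ w') v = rep w (rep w' v)"
  by (simp add: rep_def)

lemma V_1: "1 \<in> V"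
  using S_0 by (simp add: zero_prod_def)

lemma op_XMinus_XPlus: "v \<in> V \<Longrightarrow> op XMinus (op XPlus v) = emb a * v"
  using shift_op_shift_op[OF alg_endo_\<sigma> alg_endo_\<tau> \<tau>_\<sigma>, of v "\<lambda>j. if j \<ge> 0 then 1 else \<sigma> a"
      "\<lambda>j. if j \<le> 0 then 1 else a" 1 a] C_1 \<sigma>_a \<tau>_\<sigma>[OF a_C] alg_endoD(4)[OF alg_endo_\<tau>]
  by simp

lemma op_XPlus_XMinus: "v \<in> V \<Longrightarrow> op XPlus (op XMinus v) = emb (\<sigma> a) * v"
  using shift_op_shift_op[OF alg_endo_\<tau> alg_endo_\<sigma> \<sigma>_\<tau>, of v "\<lambda>j. if j \<le> 0 then 1 else a"
      "\<lambda>j. if j \<ge> 0 then 1 else \<sigma> a" "-1" "\<sigma> a"] a_C C_1 alg_endoD(4)[OF alg_endo_\<sigma>]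
  by simp

subsection \<open>Generalized Weyl algebras are free over their base ring\<close>

abbreviation "W \<equiv> gwa_words D"
abbreviation "F \<equiv> monoid_algebra (gwa_words D) :: ('k, (int \<Rightarrow>\<^sub>0 'k) gwa_gen list \<Rightarrow>\<^sub>0 'k) module"
abbreviation "J \<equiv> gwa_ideal D a \<sigma>"

definition ev :: "(int \<Rightarrow>\<^sub>0 'k) gwa_gen list \<Rightarrow> (int \<times> int \<Rightarrow>\<^sub>0 'k)" where
  "ev w = rep w 1"

definition Xpow :: "int \<Rightarrow> (int \<Rightarrow>\<^sub>0 'k) gwa_gen list" where
  "Xpow j = (if j \<ge> 0 then replicate (nat j) XPlus else replicate (nat (- j)) XMinus)"

definition nf :: "int \<times> int \<Rightarrow> ((int \<Rightarrow>\<^sub>0 'k) gwa_gen list \<Rightarrow>\<^sub>0 'k)" where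
  "nf = (\<lambda>(i, j). word (Coef (single i 1) # Xpow j))"

lemma W_simps [simp]: "carrier W = lists gens" "x \<otimes>\<^bsub>W\<^esub> y = x @ y" "\<one>\<^bsub>W\<^esub> = []"
  by (simp_all add: gwa_words_def)

lemma monoid_W: "monoid W"
  by (rule monoidI) auto

lemma Xpow_W: "Xpow j \<in> lists gens"
  by (simp add: Xpow_def in_lists_conv_set)

lemma rep_Xpow: "rep (Xpow j) 1 = tpow j"
proof -
  have "rep (replicate n XPlus) 1 = tpow (int n)" for n
  proof (induction n)
    case (Suc n)
    have "op XPlus (tpow (int n)) = tpow (int n + 1)"
      using shift_op_emb[OF alg_endo_\<sigma> C_1, of _ 1 "int n"] alg_endoD(4)[OF alg_endo_\<sigma>] by simp
    then show ?case using Suc by (simp add: rep_def add.commute del: op.simps)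
  qed (simp add: rep_def)
  moreover have "rep (replicate n XMinus) 1 = tpow (- int n)" for n
  proof (induction n)
    case (Suc n)
    have "- int n + - 1 = - int (Suc n)" by simp
    then have "op XMinus (tpow (- int n)) = tpow (- int (Suc n))"
      using shift_op_emb[OF alg_endo_\<tau> C_1, of _ "-1" "- int n"] alg_endoD(4)[OF alg_endo_\<tau>]
      by (simp only: op.simps) simp
    then show ?case using Suc by (simp add: rep_def del: op.simps of_nat_Suc)
  qed (simp add: rep_def)
  ultimately show ?thesis
    by (simp add: Xpow_def)
qed

lemma ev_nf: "lin_ext ev (lin_ext nf v) = v"
  unfolding lin_ext_lin_ext
proof (rule trans[OF lin_ext_cong lin_ext_single_id])
  fix x :: "int \<times> int"
  show "lin_ext ev (nf x) = single x 1"
    by (cases x) (simp add: nf_def ev_def rep_simps rep_Xpow emb_tpow)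
qed

lemma gwa_rels_cases:
  assumes "r \<in> gwa_rels D a \<sigma>"
  obtains (add) d e where "r = word [Coef (d + e)] - (word [Coef d] + word [Coef e])" "d \<in> C" "e \<in> C"
    | (mult) d e where "r = word [Coef (d * e)] - word [Coef d, Coef e]" "d \<in> C" "e \<in> C"
    | (sc) c d where "r = word [Coef (sc c d)] - single [Coef d] c" "d \<in> C"
    | (one) "r = word [Coef 1] - word []"
    | (XPlus) d where "r = word [XPlus, Coef d] - word [Coef (\<sigma> d), XPlus]" "d \<in> C"
    | (XMinus) d where "r = word [XMinus, Coef d] - word [Coef (\<tau> d), XMinus]" "d \<in> C"
    | (XMinus_XPlus) "r = word [XMinus, XPlus] - word [Coef a]"
    | (XPlus_XMinus) "r = word [XPlus, XMinus] - word [Coef (\<sigma> a)]"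
  using assms unfolding gwa_rels_def D_simps \<tau>_def Un_iff by (elim disjE) blast+

lemma gwa_rels_closed: "r \<in> gwa_rels D a \<sigma> \<Longrightarrow> keys r \<subseteq> lists gens"
proof -
  have 1: "keys (word x - single y c :: _ \<Rightarrow>\<^sub>0 'k) \<subseteq> lists gens"
    if "x \<in> lists gens" "y \<in> lists gens" for x y c
    using that by (intro keys_diff_closed) auto
  have 2: "keys (word x - (word y + word z) :: _ \<Rightarrow>\<^sub>0 'k) \<subseteq> lists gens"
    if "x \<in> lists gens" "y \<in> lists gens" "z \<in> lists gens" for x y z
    using that by (intro keys_diff_closed keys_add_closed) auto
  have Coef: "[Coef d] \<in> lists gens" "[XPlus, Coef d] \<in> lists gens" "[XMinus, Coef d] \<in> lists gens"
    "[Coef d, XPlus] \<in> lists gens" "[Coef d, XMinus] \<in> lists gens" "f \<in> C \<Longrightarrow> [Coef d, Coef f] \<in> lists gens"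
    if "d \<in> C" for d f
    using that by auto
  have X: "[] \<in> lists gens" "[XPlus, XMinus] \<in> lists gens" "[XMinus, XPlus] \<in> lists gens"
    by auto
  assume "r \<in> gwa_rels D a \<sigma>"
  then show ?thesis
  proof (cases rule: gwa_rels_cases)
    case (add d e)
    show ?thesis unfolding add(1) by (intro 2 Coef C_add add(2,3))
  next
    case (mult d e)
    show ?thesis unfolding mult(1) by (intro 1 Coef C_mult mult(2,3))
  next
    case (sc c d)
    show ?thesis unfolding sc(1) by (intro 1 Coef C_sc sc(2))
  next
    case one
    show ?thesis unfolding one(1) by (intro 1 Coef C_1 X)
  next
    case (XPlus d)
    show ?thesis unfolding XPlus(1) by (intro 1 Coef alg_endoD(1)[OF alg_endo_\<sigma>] XPlus(2))
  next
    case (XMinus d)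
    show ?thesis unfolding XMinus(1) by (intro 1 Coef \<tau>_C XMinus(2))
  next
    case XMinus_XPlus
    show ?thesis unfolding XMinus_XPlus by (intro 1 Coef X a_C)
  next
    case XPlus_XMinus
    show ?thesis unfolding XPlus_XMinus by (intro 1 Coef X \<sigma>_a)
  qed
qed

text \<open>\<open>ev\<close> lets words act on the vector 1, so a relation between two words acts
  on the vector \<open>ev v\<close> and is then followed by \<open>rep u\<close>. Hence relations
  only have to vanish as operators on \<open>V\<close>.\<close>

lemma lin_ext_ev_word:
  "lin_ext ev (word u \<otimes>\<^bsub>F\<^esub> r \<otimes>\<^bsub>F\<^esub> word v) = rep u (lin_ext (\<lambda>x. rep x (ev v)) r)"
proof -
  have "keys r \<subseteq> UNIV" by simp
  then show ?thesis
    by (induction r rule: poly_mapping_induct_on)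
       (simp_all add: monoid_algebra_mult_single ev_def rep_append rep_sc monoid_algebra_l_distr
         monoid_algebra_r_distr monoid_algebra_0_mult lin_ext_add rep_add)
qed

lemma gwa_rels_kill:
  assumes "r \<in> gwa_rels D a \<sigma>" "y \<in> V"
  shows "lin_ext (\<lambda>x. rep x y) r = 0"
  using assms(1)
proof (cases rule: gwa_rels_cases)
  case (XPlus d)
  then show ?thesis
    using shift_op_emb_mult[OF alg_endo_\<sigma> _ assms(2)] by (simp add: lin_ext_diff rep_simps)
next
  case (XMinus d)
  then show ?thesis
    using shift_op_emb_mult[OF alg_endo_\<tau> _ assms(2)] by (simp add: lin_ext_diff rep_simps)
qed (use op_XMinus_XPlus[OF assms(2)] op_XPlus_XMinus[OF assms(2)] in
      \<open>simp_all add: lin_ext_diff lin_ext_add rep_simps emb_add emb_mult emb_sc distrib_right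
        mult.assoc sc_mult_left\<close>)

lemma ideal_J: "ideal J F"
  unfolding gwa_ideal_def gwa_free_def
  by (rule ring.genideal_ideal[OF ring_monoid_algebra[OF monoid_W]]) (use gwa_rels_closed in auto)

lemmas J_props = ideal_monoid_algebra[OF monoid_W ideal_J]

lemma J_rel: "r \<in> gwa_rels D a \<sigma> \<Longrightarrow> r \<in> J"
  unfolding gwa_ideal_def gwa_free_def
  using ring.genideal_self[OF ring_monoid_algebra[OF monoid_W], of "gwa_rels D a \<sigma>"] gwa_rels_closed
  by auto

lemma J_rels:
  "d \<in> C \<Longrightarrow> f \<in> C \<Longrightarrow> word [Coef (d + f)] - (word [Coef d] + word [Coef f]) \<in> J"
  "d \<in> C \<Longrightarrow> f \<in> C \<Longrightarrow> word [Coef (d * f)] - word [Coef d, Coef f] \<in> J"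
  "d \<in> C \<Longrightarrow> word [Coef (sc c d)] - single [Coef d] c \<in> J"
  "word [Coef 1] - word [] \<in> J"
  "d \<in> C \<Longrightarrow> word [XPlus, Coef d] - word [Coef (\<sigma> d), XPlus] \<in> J"
  "d \<in> C \<Longrightarrow> word [XMinus, Coef d] - word [Coef (\<tau> d), XMinus] \<in> J"
  "word [XMinus, XPlus] - word [Coef a] \<in> J"
  "word [XPlus, XMinus] - word [Coef (\<sigma> a)] \<in> J"
  by (rule J_rel, unfold gwa_rels_def D_simps \<tau>_def Un_iff, blast)+

lemma J_trans: "f - g \<in> J \<Longrightarrow> g - h \<in> J \<Longrightarrow> f - h \<in> J"
  using J_props(3)[of "f - g" "g - h"] by simp

lemma J_subst:
  assumes "word x - f \<in> J" "u \<in> lists gens" "v \<in> lists gens"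
  shows "word (u @ x @ v) - word u \<otimes>\<^bsub>F\<^esub> f \<otimes>\<^bsub>F\<^esub> word v \<in> J"
proof -
  have "word u \<otimes>\<^bsub>F\<^esub> (word x - f) \<otimes>\<^bsub>F\<^esub> word v \<in> J"
    using assms by (intro J_props(7,8)) auto
  then show ?thesis
    by (simp add: monoid_algebra_diff_mult monoid_algebra_mult_single)
qed

lemma J_subst_word:
  "word x - single y c \<in> J \<Longrightarrow> u \<in> lists gens \<Longrightarrow> v \<in> lists gens \<Longrightarrow>
    word (u @ x @ v) - single (u @ y @ v) c \<in> J"
  using J_subst[of x "single y c" u v] by (simp add: monoid_algebra_mult_single)

lemma J_Coef:
  assumes "d \<in> C"
  shows "word (Coef d # Xpow j) - lin_ext nf (emb d * tpow j) \<in> J"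
proof -
  have "keys d \<subseteq> S" using assms by simp
  then show ?thesis
  proof (induction d rule: poly_mapping_induct_on)
    case zero
    have "word [Coef 0] - single [Coef 0] 0 \<in> J"
      using J_rels(3)[of 0 0] by simp
    then have "word ([] @ [Coef 0] @ Xpow j) - single ([] @ [] @ Xpow j) 0 \<in> J"
      using Xpow_W by (intro J_subst_word) auto
    then show ?case by simp
  next
    case (sgl i c)
    have "word [Coef (single i c)] - single [Coef (single i 1)] c \<in> J"
      using J_rels(3)[OF C_single[OF sgl, of 1], of c] by simp
    then have "word ([] @ [Coef (single i c)] @ Xpow j) - single ([] @ [Coef (single i 1)] @ Xpow j) c \<in> J"
      using Xpow_W by (intro J_subst_word) auto
    then show ?case by (simp add: emb_tpow nf_def)
  next
    case (add f g)
    have "word [Coef (f + g)] - (word [Coef f] + word [Coef g]) \<in> J"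
      using add by (intro J_rels(1)) auto
    then have "word ([] @ [Coef (f + g)] @ Xpow j) - word [] \<otimes>\<^bsub>F\<^esub> (word [Coef f] + word [Coef g]) \<otimes>\<^bsub>F\<^esub> word (Xpow j) \<in> J"
      using Xpow_W by (intro J_subst) auto
    then have "word (Coef (f + g) # Xpow j) - (word (Coef f # Xpow j) + word (Coef g # Xpow j)) \<in> J"
      by (simp add: monoid_algebra_l_distr monoid_algebra_r_distr monoid_algebra_mult_single)
    from J_props(3)[OF this J_props(3)[OF add(3,4)]] show ?case
      by (simp add: emb_add distrib_right lin_ext_add algebra_simps)
  qed
qed

lemma J_Coef_Coef:
  assumes "d \<in> C" "f \<in> C" "u \<in> lists gens" "v \<in> lists gens"
  shows "word (u @ [Coef d, Coef f] @ v) - word (u @ [Coef (d * f)] @ v) \<in> J"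
proof (rule J_subst_word)
  from J_props(5)[OF J_rels(2)[OF assms(1,2)]] show "word [Coef d, Coef f] - word [Coef (d * f)] \<in> J" by simp
qed (use assms in auto)

text \<open>The generator passes the coefficient by twisting it, then either prolongs the power of X
  or cancels against its first letter, and finally the two coefficients are merged. The disjunction
  on \<open>X\<close> lets one argument serve both generators.\<close>

lemma J_X_basis:
  fixes u :: "int \<Rightarrow> int \<Rightarrow>\<^sub>0 'k" and \<delta> :: int
  assumes X: "X = XPlus \<and> \<rho> = \<sigma> \<and> \<delta> = 1 \<and> u = (\<lambda>j. if j \<ge> 0 then 1 else \<sigma> a) \<or>
      X = XMinus \<and> \<rho> = \<tau> \<and> \<delta> = -1 \<and> u = (\<lambda>j. if j \<le> 0 then 1 else a)"
    and i: "i \<in> S"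
  shows "word (X # Coef (single i 1) # Xpow j) - lin_ext nf (op X (single (i, j) 1)) \<in> J"
proof -
  let ?h = "single i 1 :: int \<Rightarrow>\<^sub>0 'k"
  have h: "?h \<in> C" using i by simp
  have \<rho>: "alg_endo \<rho>" using X alg_endo_\<sigma> alg_endo_\<tau> by auto
  have u: "u j \<in> C" using X C_1 \<sigma>_a a_C by (auto split: if_splits)
  note \<rho>h = alg_endoD(1)[OF \<rho> h]
  have "word [X, Coef ?h] - word [Coef (\<rho> ?h), X] \<in> J"
    using X J_rels(5,6)[OF h] by auto
  then have 1: "word ([] @ [X, Coef ?h] @ Xpow j) - word ([] @ [Coef (\<rho> ?h), X] @ Xpow j) \<in> J"
    using Xpow_W by (intro J_subst_word) auto
  have 2: "word ([Coef (\<rho> ?h)] @ (X # Xpow j) @ []) - word ([Coef (\<rho> ?h)] @ (Coef (u j) # Xpow (j + \<delta>)) @ []) \<in> J"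
  proof (rule J_subst_word)
    consider "u j = 1" "Xpow (j + \<delta>) = X # Xpow j"
      | X' where "Xpow j = X' # Xpow (j + \<delta>)" "word [X, X'] - word [Coef (u j)] \<in> J"
    proof -
      have *: "nat (1 + k) = Suc (nat k)" if "k \<ge> 0" for k using that by simp
      show ?thesis
      proof (cases "(X = XPlus \<and> j \<ge> 0) \<or> (X = XMinus \<and> j \<le> 0)")
        case True
        then have "u j = 1" "Xpow (j + \<delta>) = X # Xpow j"
          using X *[of j] *[of "-j"] by (auto simp: Xpow_def add.commute)
        then show ?thesis by (rule that(1))
      next
        case False
        then show ?thesis
          using X *[of "-1-j"] *[of "j - 1"]
          by (intro that(2)[of "if X = XPlus then XMinus else XPlus"])
             (use J_rels(7,8) in \<open>auto simp: Xpow_def\<close>)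
      qed
    qed
    then show "word (X # Xpow j) - word (Coef (u j) # Xpow (j + \<delta>)) \<in> J"
    proof cases
      case 1
      from J_props(5)[OF J_rels(4)] have "word [] - word [Coef 1] \<in> J" by simp
      then have "word ([] @ [] @ Xpow (j + \<delta>)) - word ([] @ [Coef 1] @ Xpow (j + \<delta>)) \<in> J"
        using Xpow_W by (intro J_subst_word) auto
      then show ?thesis using 1 by simp
    next
      case 2
      have "word ([] @ [X, X'] @ Xpow (j + \<delta>)) - word ([] @ [Coef (u j)] @ Xpow (j + \<delta>)) \<in> J"
        using Xpow_W 2(2) by (intro J_subst_word) auto
      then show ?thesis using 2 by simp
    qed
  qed (use \<rho>h in auto)
  have 3: "word ([] @ [Coef (\<rho> ?h), Coef (u j)] @ Xpow (j + \<delta>)) - word ([] @ [Coef (\<rho> ?h * u j)] @ Xpow (j + \<delta>)) \<in> J"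
    using \<rho>h u Xpow_W by (intro J_Coef_Coef) auto
  have 4: "word (Coef (\<rho> ?h * u j) # Xpow (j + \<delta>)) - lin_ext nf (emb (\<rho> ?h * u j) * tpow (j + \<delta>)) \<in> J"
    by (intro J_Coef C_mult \<rho>h u)
  have "op X (single (i, j) 1) = emb (\<rho> ?h * u j) * tpow (j + \<delta>)"
    using shift_op_emb[OF \<rho> h, of u \<delta> j] X by (auto simp: emb_tpow)
  then show ?thesis
    using J_trans[OF J_trans[OF J_trans[OF 1[simplified] 2[simplified]] 3[simplified]] 4] by simp
qed

lemma J_basis:
  assumes "g \<in> gens" "i \<in> S"
  shows "word (g # Coef (single i 1) # Xpow j) - lin_ext nf (op g (single (i, j) 1)) \<in> J"
  using assms(1)
proof (elim insertE imageE)
  fix d assume d: "g = Coef d" "d \<in> C"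
  have "word ([] @ [Coef d, Coef (single i 1)] @ Xpow j) - word ([] @ [Coef (d * single i 1)] @ Xpow j) \<in> J"
    using d assms(2) Xpow_W by (intro J_Coef_Coef) auto
  moreover have "word (Coef (d * single i 1) # Xpow j) - lin_ext nf (emb (d * single i 1) * tpow j) \<in> J"
    using d assms(2) by (intro J_Coef C_mult) auto
  moreover have "emb (d * single i 1) * tpow j = emb d * single (i, j) 1"
    by (simp add: emb_mult mult.assoc emb_tpow)
  ultimately show ?thesis
    using d J_trans by fastforce
qed (use J_X_basis assms(2) in blast)+

text \<open>Words are built up from the right. By linearity it is enough to put one generator in
  front of a word that is already in normal form, which is \<open>J_basis\<close>.\<close>

lemma J_normal_form:
  assumes "w \<in> lists gens"
  shows "word w - lin_ext nf (ev w) \<in> J"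
  using assms
proof (induction w)
  case Nil
  have "lin_ext nf 1 = nf 0"
    using lin_ext_single[of nf 0 1] by simp
  also have "nf 0 = word [Coef 1]"
    by (simp add: nf_def zero_prod_def Xpow_def)
  finally show ?case
    using J_props(5)[OF J_rels(4)] by (simp add: ev_def rep_simps)
next
  case (Cons g w)
  have g: "g \<in> gens" and w: "w \<in> lists gens" using Cons by auto
  have "word ([g] @ w @ []) - word [g] \<otimes>\<^bsub>F\<^esub> lin_ext nf (ev w) \<otimes>\<^bsub>F\<^esub> word [] \<in> J"
    using J_subst[OF Cons.IH, of "[g]" "[]"] g by simp
  moreover have "word [g] \<otimes>\<^bsub>F\<^esub> lin_ext nf y \<otimes>\<^bsub>F\<^esub> word [] - lin_ext nf (op g y) \<in> J" if "keys y \<subseteq> S \<times> UNIV" for y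
    using that
  proof (induction y rule: poly_mapping_induct_on)
    case zero
    then show ?case using J_props(2) by (simp add: monoid_algebra_0_mult)
  next
    case (sgl x c)
    obtain i j where x: "x = (i, j)" "i \<in> S" using sgl by auto
    have "op g (single x c) = sc c (op g (single x 1))" using op_sc[of g c "single x 1"] by simp
    then show ?case
      using J_props(4)[OF J_basis[OF g x(2), of j], of c]
      by (simp add: x nf_def monoid_algebra_mult_single sc_diff lin_ext_sc)
  next
    case (add f g)
    then show ?case
      using J_props(3)[OF add(3,4)]
      by (simp add: lin_ext_add op_add monoid_algebra_l_distr monoid_algebra_r_distr algebra_simps)
  qed
  moreover have "keys (ev w) \<subseteq> S \<times> UNIV"
    using rep_V[OF w V_1] by (simp add: ev_def)
  ultimately show ?case
    using J_trans by (fastforce simp: ev_def rep_simps)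
qed

lemma presentation: "presentation W (gwa_rels D a \<sigma>) ev nf"
proof
  fix r u v assume "r \<in> gwa_rels D a \<sigma>" "u \<in> carrier W" "v \<in> carrier W"
  then show "lin_ext ev (word u \<otimes>\<^bsub>F\<^esub> r \<otimes>\<^bsub>F\<^esub> word v) = 0"
    using rep_V[OF _ V_1, of v] gwa_rels_kill[of r "ev v"]
    by (subst lin_ext_ev_word) (simp add: ev_def)
qed (use monoid_W gwa_rels_closed J_normal_form in \<open>auto simp: gwa_ideal_def gwa_free_def\<close>)

interpretation P: presentation W "gwa_rels D a \<sigma>" ev nf
  by (rule presentation)

definition \<phi> :: "((int \<Rightarrow>\<^sub>0 'k) gwa_gen list \<Rightarrow>\<^sub>0 'k) set \<Rightarrow> (int \<times> int \<Rightarrow>\<^sub>0 'k)" where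
  "\<phi> = P.val"

abbreviation "G \<equiv> gwa D a \<sigma>"

lemma P_simps: "P.A = gwa_free D" "P.I = J" "P.Q = G"
  by (simp_all add: P.A_def P.I_def P.Q_def gwa_free_def gwa_ideal_def gwa_def)

lemma ring_G: "ring G"
  using P.Q.ring_axioms unfolding P_simps .

lemma \<phi>_add: "X \<in> carrier G \<Longrightarrow> Y \<in> carrier G \<Longrightarrow> \<phi> (X \<oplus>\<^bsub>G\<^esub> Y) = \<phi> X + \<phi> Y"
  using P.val_add unfolding P_simps \<phi>_def .

lemma \<phi>_smult: "X \<in> carrier G \<Longrightarrow> \<phi> (c \<odot>\<^bsub>G\<^esub> X) = sc c (\<phi> X)"
  and G_smult_closed: "X \<in> carrier G \<Longrightarrow> c \<odot>\<^bsub>G\<^esub> X \<in> carrier G"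
  by (simp_all add: \<phi>_def P.val_smult(2)[unfolded P_simps] P.Q_smult_closed[unfolded P_simps])

lemma G_smult_mult:
  assumes "X \<in> carrier G" "Y \<in> carrier G"
  shows "(c \<odot>\<^bsub>G\<^esub> X) \<otimes>\<^bsub>G\<^esub> Y = c \<odot>\<^bsub>G\<^esub> (X \<otimes>\<^bsub>G\<^esub> Y)" "X \<otimes>\<^bsub>G\<^esub> (c \<odot>\<^bsub>G\<^esub> Y) = c \<odot>\<^bsub>G\<^esub> (X \<otimes>\<^bsub>G\<^esub> Y)"
  using assms P.smult_mult by (simp_all add: P_simps)

lemma \<phi>_one: "\<phi> \<one>\<^bsub>G\<^esub> = 1"
  using P.val_coset[of "word []"] P.Q_one by (simp add: \<phi>_def P_simps ev_def rep_simps)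

text \<open>This is the basis theorem for D(a, \<sigma>): the elements h^i X^j with i in
  \<open>S\<close> are linearly independent because words act faithfully enough through
  \<open>ev\<close> (\<open>ev_nf\<close>), and they span because every word is congruent to its
  normal form.\<close>

lemma \<phi>_bij: "bij_betw \<phi> (carrier G) V"
proof -
  have "lin_ext ev ` {f. keys f \<subseteq> carrier W} = V"
  proof (intro equalityI subsetI)
    fix v assume v: "v \<in> V"
    have "keys (nf x) \<subseteq> carrier W" if "x \<in> keys v" for x
    proof -
      have "x \<in> S \<times> UNIV" using v that by auto
      then obtain i j where x: "x = (i, j)" "i \<in> S" by auto
      have "Coef (single i 1) # Xpow j \<in> lists gens"
        by (intro lists.Cons insertI2 imageI C_single Xpow_W x(2))
      then show ?thesis by (simp add: x(1) nf_def)
    qed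
    then have "keys (lin_ext nf v) \<subseteq> carrier W"
      by (rule keys_lin_ext)
    then show "v \<in> lin_ext ev ` {f. keys f \<subseteq> carrier W}"
      by (intro image_eqI[of _ _ "lin_ext nf v"]) (simp_all add: ev_nf)
  next
    fix v assume "v \<in> lin_ext ev ` {f. keys f \<subseteq> carrier W}"
    then show "v \<in> V"
      using rep_V[OF _ V_1] by (auto simp: ev_def simp del: mem_Collect_eq intro!: CollectI keys_lin_ext) blast
  qed
  then show ?thesis
    unfolding bij_betw_def \<phi>_def using P.val_inj P.val_image by (simp add: P_simps)
qed

text \<open>A coefficient letter in front of a word acts as multiplication by \<open>emb d\<close>,
  so \<open>\<phi>\<close> respects left multiplication by D. On the right the twist by \<sigma>
  would intervene.\<close>

lemma gwa_incl:
  assumes "d \<in> C"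
  shows gwa_incl_closed: "gwa_incl D a \<sigma> d \<in> carrier G"
    and \<phi>_gwa_incl: "\<phi> (gwa_incl D a \<sigma> d) = emb d"
    and \<phi>_gwa_incl_mult: "Y \<in> carrier G \<Longrightarrow> \<phi> (gwa_incl D a \<sigma> d \<otimes>\<^bsub>G\<^esub> Y) = emb d * \<phi> Y"
proof -
  have d: "keys (word [Coef d] :: _ \<Rightarrow>\<^sub>0 'k) \<subseteq> carrier W" using assms by simp
  show "gwa_incl D a \<sigma> d \<in> carrier G"
    using P.coset_in_Q[OF d] by (simp add: gwa_incl_def P_simps)
  show "\<phi> (gwa_incl D a \<sigma> d) = emb d"
    using P.val_coset[OF d] by (simp add: gwa_incl_def P_simps \<phi>_def ev_def rep_simps)
  assume "Y \<in> carrier G"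
  then obtain f where f: "keys f \<subseteq> carrier W" "Y = J +>\<^bsub>gwa_free D\<^esub> f" "\<phi> Y = lin_ext ev f"
    using P.Q_cases unfolding P_simps \<phi>_def by metis
  have "lin_ext ev (word [Coef d] \<otimes>\<^bsub>F\<^esub> f) = emb d * lin_ext ev f"
    using f(1) by (induction f rule: poly_mapping_induct_on)
      (simp_all add: monoid_algebra_mult_single ev_def rep_simps monoid_algebra_r_distr
        monoid_algebra_0_mult lin_ext_add distrib_left sc_mult_right)
  then show "\<phi> (gwa_incl D a \<sigma> d \<otimes>\<^bsub>G\<^esub> Y) = emb d * \<phi> Y"
    using P.Q_mult_coset[OF d f(1)] P.val_coset[OF monoid_algebra_closed[OF monoid_W d f(1)]]
    by (simp add: gwa_incl_def P_simps \<phi>_def f(2) P.val_coset[OF f(1), unfolded P_simps] flip: gwa_free_def)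
qed

text \<open>Every generator shifts the exponent of t by a fixed amount 0, 1 or -1, and scaling
  depends on that exponent only. The two therefore commute up to the weight of the
  generator.\<close>

lemma scale1_op:
  assumes "z \<noteq> 0"
  shows "scale1 z (op g v) = sc (gen_weight z g) (op g (scale1 z v))"
proof -
  have shift: "scale1 z (shift_op \<rho> u \<delta> v) = sc (z powi \<delta>) (shift_op \<rho> u \<delta> (scale1 z v))" for \<rho> u \<delta>
  proof -
    have "keys v \<subseteq> UNIV" by simp
    then show ?thesis
    proof (induction v rule: poly_mapping_induct_on)
      case (sgl x c)
      obtain i j where x: "x = (i, j)" by (cases x)
      define E where "E = emb (\<rho> (single i 1) * u j) * tpow (j + \<delta>)"
      have L: "scale1 z (shift_op \<rho> u \<delta> (single x c)) = sc (c * z powi (j + \<delta>)) E"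
        by (simp add: x shift_op_def scale1_sc scale1_mult[OF assms] scale1_emb scale1_tpow sc_mult_right E_def)
      have R: "shift_op \<rho> u \<delta> (scale1 z (single x c)) = sc (c * z powi j) E"
        by (simp add: x shift_op_def scale1_def E_def)
      show ?case
        unfolding L R sc_sc using assms
        by (intro arg_cong[where f = "\<lambda>c. sc c E"]) (simp add: power_int_add)
    qed (simp_all add: shift_op_add scale1_def lin_ext_add sc_add_right shift_op_def)
  qed
  show ?thesis
    using shift by (cases g) (simp_all add: scale1_mult[OF assms] scale1_emb)
qed

lemma scale1_ev:
  assumes "z \<noteq> 0"
  shows "scale1 z (ev w) = sc (prod_list (map (gen_weight z) w)) (ev w)"
  by (induction w) (simp_all add: ev_def rep_simps scale1_op[OF assms] op_sc)

lemma gwa_scale: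
  assumes "z \<noteq> 0" "X \<in> carrier G"
  shows gwa_scale_closed: "gwa_scale D a \<sigma> z X \<in> carrier G"
    and \<phi>_gwa_scale: "\<phi> (gwa_scale D a \<sigma> z X) = scale1 z (\<phi> X)"
proof -
  let ?h = "lin_ext (\<lambda>w. single w (prod_list (map (gen_weight z) w)))"
  have X: "X \<in> carrier P.Q" using assms(2) by (simp add: P_simps)
  have 1: "keys (?h x) \<subseteq> carrier W" if "x \<in> X" for x
    using P.Q_memD[OF X that] by (intro keys_lin_ext) auto
  have 2: "lin_ext ev (?h x) = scale1 z (\<phi> X)" if "x \<in> X" for x
  proof -
    have "lin_ext ev (?h x) = lin_ext (\<lambda>w. scale1 z (ev w)) x"
      by (simp add: lin_ext_lin_ext scale1_ev[OF assms(1)])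
    also have "\<dots> = scale1 z (lin_ext ev x)"
      by (simp add: scale1_def lin_ext_lin_ext)
    finally show ?thesis using P.Q_memD[OF X that] by (simp add: \<phi>_def)
  qed
  show "gwa_scale D a \<sigma> z X \<in> carrier G" "\<phi> (gwa_scale D a \<sigma> z X) = scale1 z (\<phi> X)"
    using P.quot_map[OF P.Q_nonempty[OF X] 1 2] unfolding P_simps \<phi>_def gwa_scale_def by auto
qed

end

subsection \<open>Tensor powers\<close>

declare One_nat_def [simp del]

lemma sum_fun_apply: "(\<Sum>i\<in>I. f i) x = (\<Sum>i\<in>I. f i x)" for f :: "'i \<Rightarrow> 'x \<Rightarrow> 'y::comm_monoid_add"
  by (induction I rule: infinite_finite_induct) simp_all

definition put :: "nat \<Rightarrow> 'b::zero \<Rightarrow> nat \<Rightarrow> 'b" where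
  "put i b = (\<lambda>j. if j = i then b else 0)"

definition iota :: "nat \<Rightarrow> ('b::zero \<Rightarrow>\<^sub>0 'k::comm_ring_1) \<Rightarrow> ((nat \<Rightarrow> 'b) \<Rightarrow>\<^sub>0 'k)" where
  "iota i = lin_ext (\<lambda>b. single (put i b) 1)"

lemma iota_single: "iota i (single b c) = single (put i b) c"
  by (simp add: iota_def)

lemma iota_add: "iota i (f + g) = iota i f + iota i g"
  by (simp add: iota_def lin_ext_add)

lemma iota_sc: "iota i (sc c f) = sc c (iota i f)"
  by (simp add: iota_def lin_ext_sc)

lemma iota_0 [simp]: "iota i 0 = 0"
  by (simp add: iota_def)

lemma put_0 [simp]: "put i 0 = 0"
  by (auto simp: put_def)

lemma put_add: "put i (b + c) = put i b + put i c" for b c :: "'b::comm_monoid_add"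
  by (auto simp: put_def)

lemma iota_mult: "iota i (f * g) = iota i f * iota i g"
  for f g :: "'b::comm_monoid_add \<Rightarrow>\<^sub>0 'k::comm_ring_1"
  unfolding iota_def by (rule lin_ext_mult[of UNIV]) (simp_all add: mult_single put_add)

lemma iota_1 [simp]: "iota i (1 :: 'b::comm_monoid_add \<Rightarrow>\<^sub>0 'k::comm_ring_1) = 1"
  unfolding iota_def by (rule lin_ext_1) simp

lemma prod_single:
  fixes x :: "'i \<Rightarrow> 'a::comm_monoid_add"
  shows "(\<Prod>i\<in>I. single (x i) (1::'k::comm_ring_1)) = single (\<Sum>i\<in>I. x i) 1"
  by (induction I rule: infinite_finite_induct) (simp_all add: mult_single)

text \<open>The value 0 outside \<open>{1..n}\<close> makes total functions represent n-tuples of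
  exponents uniquely.\<close>

definition mono_set :: "nat \<Rightarrow> 'b::zero set \<Rightarrow> (nat \<Rightarrow> 'b) set" where
  "mono_set n K = {\<gamma>. (\<forall>i\<in>{1..n}. \<gamma> i \<in> K) \<and> (\<forall>i. i \<notin> {1..n} \<longrightarrow> \<gamma> i = 0)}"

lemma sum_put:
  assumes "\<gamma> \<in> mono_set n K"
  shows "(\<Sum>i\<in>{1..n}. put i (\<gamma> i)) = \<gamma>"
proof
  fix x
  show "(\<Sum>i\<in>{1..n}. put i (\<gamma> i)) x = \<gamma> x"
    using assms by (auto simp: sum_fun_apply put_def mono_set_def)
qed

lemma keys_iota: "keys f \<subseteq> K \<Longrightarrow> keys (iota i f) \<subseteq> put i ` K"
  unfolding iota_def by (rule keys_lin_ext) auto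

lemma keys_prod_iota:
  fixes f :: "nat \<Rightarrow> 'b::comm_monoid_add \<Rightarrow>\<^sub>0 'k::comm_ring_1"
  assumes "\<And>i. i \<in> {1..n} \<Longrightarrow> keys (f i) \<subseteq> K"
  shows "keys (\<Prod>i\<in>{1..n}. iota i (f i)) \<subseteq> mono_set n K"
proof -
  have "keys (\<Prod>i\<in>I. iota i (f i)) \<subseteq> {\<gamma>. (\<forall>i\<in>I. \<gamma> i \<in> K) \<and> (\<forall>i. i \<notin> I \<longrightarrow> \<gamma> i = 0)}"
    if "finite I" "I \<subseteq> {1..n}" for I
    using that
  proof (induction I rule: finite_induct)
    case (insert i I)
    have sum: "\<gamma> + \<delta> \<in> {\<gamma>. (\<forall>j\<in>insert i I. \<gamma> j \<in> K) \<and> (\<forall>j. j \<notin> insert i I \<longrightarrow> \<gamma> j = 0)}"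
      if "\<gamma> \<in> put i ` K" "\<delta> \<in> {\<gamma>. (\<forall>i\<in>I. \<gamma> i \<in> K) \<and> (\<forall>i. i \<notin> I \<longrightarrow> \<gamma> i = 0)}" for \<gamma> \<delta>
      using that insert by (auto simp: put_def)
    have 1: "keys (iota i (f i)) \<subseteq> put i ` K"
      using insert assms by (intro keys_iota) auto
    have 2: "keys (\<Prod>i\<in>I. iota i (f i)) \<subseteq> {\<gamma>. (\<forall>i\<in>I. \<gamma> i \<in> K) \<and> (\<forall>i. i \<notin> I \<longrightarrow> \<gamma> i = 0)}"
      using insert by auto
    show ?case
    proof
      fix \<gamma> assume "\<gamma> \<in> keys (\<Prod>i\<in>insert i I. iota i (f i))"
      then have "\<gamma> \<in> keys (iota i (f i) * (\<Prod>i\<in>I. iota i (f i)))"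
        unfolding prod.insert[OF insert.hyps] .
      then obtain a b where "\<gamma> = a + b" "a \<in> keys (iota i (f i))" "b \<in> keys (\<Prod>i\<in>I. iota i (f i))"
        using keys_mult[of "iota i (f i)" "\<Prod>i\<in>I. iota i (f i)"] by blast
      then show "\<gamma> \<in> {\<gamma>. (\<forall>j\<in>insert i I. \<gamma> j \<in> K) \<and> (\<forall>j. j \<notin> insert i I \<longrightarrow> \<gamma> j = 0)}"
        using sum[of a b] 1 2 by blast
    qed
  qed (auto simp: zero_fun_def)
  from this[of "{1..n}"] show ?thesis by (simp add: mono_set_def)
qed

text \<open>\<open>\<phi>\<close> is a linear coordinate map and not a homomorphism, because the
  normal form of D(a, \<sigma>) is not multiplicative. The locale is used twice, for D with the
  identity and for D(a, \<sigma>) with its normal form.\<close>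

locale tensor_data =
  fixes A :: "('k::comm_ring_1, 'a) module" and \<phi> :: "'a \<Rightarrow> ('b::comm_monoid_add \<Rightarrow>\<^sub>0 'k)"
    and K :: "'b set" and n :: nat
  assumes ring_A: "ring A"
    and \<phi>_add: "\<And>x y. x \<in> carrier A \<Longrightarrow> y \<in> carrier A \<Longrightarrow> \<phi> (x \<oplus>\<^bsub>A\<^esub> y) = \<phi> x + \<phi> y"
    and smult_closed: "\<And>c x. x \<in> carrier A \<Longrightarrow> c \<odot>\<^bsub>A\<^esub> x \<in> carrier A"
    and \<phi>_smult: "\<And>c x. x \<in> carrier A \<Longrightarrow> \<phi> (c \<odot>\<^bsub>A\<^esub> x) = sc c (\<phi> x)"
    and smult_mult_left: "\<And>c x y. x \<in> carrier A \<Longrightarrow> y \<in> carrier A \<Longrightarrow> (c \<odot>\<^bsub>A\<^esub> x) \<otimes>\<^bsub>A\<^esub> y = c \<odot>\<^bsub>A\<^esub> (x \<otimes>\<^bsub>A\<^esub> y)"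
    and smult_mult_right: "\<And>c x y. x \<in> carrier A \<Longrightarrow> y \<in> carrier A \<Longrightarrow> x \<otimes>\<^bsub>A\<^esub> (c \<odot>\<^bsub>A\<^esub> y) = c \<odot>\<^bsub>A\<^esub> (x \<otimes>\<^bsub>A\<^esub> y)"
    and \<phi>_bij: "bij_betw \<phi> (carrier A) {f. keys f \<subseteq> K}"
    and \<phi>_one: "\<phi> \<one>\<^bsub>A\<^esub> = 1"
begin

interpretation A: ring A by (rule ring_A)

abbreviation "M \<equiv> tuple_monoid n A"
abbreviation "B \<equiv> monoid_algebra (tuple_monoid n A) :: ('k, (nat \<Rightarrow> 'a) \<Rightarrow>\<^sub>0 'k) module"
abbreviation "J \<equiv> tensor_ideal n A"
abbreviation "N \<equiv> {1..n}"

text \<open>Different positions use disjoint sets of variables. A pure tensor thus becomes an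
  ordinary product, and multilinearity becomes distributivity.\<close>

definition ev :: "(nat \<Rightarrow> 'a) \<Rightarrow> ((nat \<Rightarrow> 'b) \<Rightarrow>\<^sub>0 'k)" where
  "ev x = (\<Prod>i\<in>N. iota i (\<phi> (x i)))"

definition \<psi> :: "('b \<Rightarrow>\<^sub>0 'k) \<Rightarrow> 'a" where
  "\<psi> = inv_into (carrier A) \<phi>"

definition nf :: "(nat \<Rightarrow> 'b) \<Rightarrow> ((nat \<Rightarrow> 'a) \<Rightarrow>\<^sub>0 'k)" where
  "nf \<gamma> = single (\<lambda>i\<in>N. \<psi> (single (\<gamma> i) 1)) 1"

lemma M_simps [simp]: "carrier M = N \<rightarrow>\<^sub>E carrier A" "\<one>\<^bsub>M\<^esub> = (\<lambda>i\<in>N. \<one>\<^bsub>A\<^esub>)"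
  "x \<otimes>\<^bsub>M\<^esub> y = (\<lambda>i\<in>N. x i \<otimes>\<^bsub>A\<^esub> y i)"
  by (simp_all add: tuple_monoid_def)

lemma M_ext: "x \<in> N \<rightarrow>\<^sub>E carrier A \<Longrightarrow> (\<lambda>i\<in>N. x i) = x"
  by (auto simp: PiE_def extensional_def fun_eq_iff)

lemma M_mem: "x \<in> N \<rightarrow>\<^sub>E carrier A \<Longrightarrow> i \<in> N \<Longrightarrow> x i \<in> carrier A"
  by (rule PiE_mem)

lemma monoid_M: "monoid M"
proof (rule monoidI)
  fix x y z assume "x \<in> carrier M" "y \<in> carrier M" "z \<in> carrier M"
  then show "x \<otimes>\<^bsub>M\<^esub> y \<in> carrier M" "x \<otimes>\<^bsub>M\<^esub> y \<otimes>\<^bsub>M\<^esub> z = x \<otimes>\<^bsub>M\<^esub> (y \<otimes>\<^bsub>M\<^esub> z)"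
    by (auto simp: PiE_iff A.m_assoc fun_eq_iff)
next
  fix x assume x: "x \<in> carrier M"
  then have "(\<lambda>i\<in>N. (\<lambda>i\<in>N. \<one>\<^bsub>A\<^esub>) i \<otimes>\<^bsub>A\<^esub> x i) = (\<lambda>i\<in>N. x i)" "(\<lambda>i\<in>N. x i \<otimes>\<^bsub>A\<^esub> (\<lambda>i\<in>N. \<one>\<^bsub>A\<^esub>) i) = (\<lambda>i\<in>N. x i)"
    by (auto simp: PiE_iff fun_eq_iff)
  then show "\<one>\<^bsub>M\<^esub> \<otimes>\<^bsub>M\<^esub> x = x" "x \<otimes>\<^bsub>M\<^esub> \<one>\<^bsub>M\<^esub> = x"
    using M_ext x by simp_all
qed auto

lemma M_upd: "x \<in> N \<rightarrow>\<^sub>E carrier A \<Longrightarrow> i \<in> N \<Longrightarrow> w \<in> carrier A \<Longrightarrow> x(i := w) \<in> N \<rightarrow>\<^sub>E carrier A"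
  by (auto simp: PiE_iff extensional_def)

lemma \<psi>: "keys f \<subseteq> K \<Longrightarrow> \<psi> f \<in> carrier A" "keys f \<subseteq> K \<Longrightarrow> \<phi> (\<psi> f) = f" "x \<in> carrier A \<Longrightarrow> \<psi> (\<phi> x) = x"
proof -
  have inj: "inj_on \<phi> (carrier A)" and img: "\<phi> ` carrier A = {f. keys f \<subseteq> K}"
    using \<phi>_bij by (auto simp: bij_betw_def)
  show "keys f \<subseteq> K \<Longrightarrow> \<psi> f \<in> carrier A" "keys f \<subseteq> K \<Longrightarrow> \<phi> (\<psi> f) = f"
    unfolding \<psi>_def using img by (auto intro!: inv_into_into f_inv_into_f)
  show "x \<in> carrier A \<Longrightarrow> \<psi> (\<phi> x) = x"
    unfolding \<psi>_def using inj by simp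
qed

lemma \<phi>_K: "x \<in> carrier A \<Longrightarrow> keys (\<phi> x) \<subseteq> K"
  using \<phi>_bij unfolding bij_betw_def by auto

lemma \<psi>_eq: "x \<in> carrier A \<Longrightarrow> \<phi> x = f \<Longrightarrow> \<psi> f = x"
  using \<psi>(3) by auto

lemma \<psi>_sc: "keys f \<subseteq> K \<Longrightarrow> \<psi> (sc c f) = c \<odot>\<^bsub>A\<^esub> \<psi> f"
  by (rule \<psi>_eq) (simp_all add: \<psi> smult_closed \<phi>_smult)

lemma \<psi>_add: "keys f \<subseteq> K \<Longrightarrow> keys g \<subseteq> K \<Longrightarrow> \<psi> (f + g) = \<psi> f \<oplus>\<^bsub>A\<^esub> \<psi> g"
  by (rule \<psi>_eq) (simp_all add: \<psi> \<phi>_add)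

lemma ev_upd:
  assumes "i \<in> N"
  shows "ev (x(i := w)) = iota i (\<phi> w) * (\<Prod>j\<in>N-{i}. iota j (\<phi> (x j)))"
proof -
  have "ev (x(i := w)) = iota i (\<phi> w) * (\<Prod>j\<in>N-{i}. iota j (\<phi> ((x(i := w)) j)))"
    using assms by (simp add: ev_def prod.remove[of N i])
  also have "(\<Prod>j\<in>N-{i}. iota j (\<phi> ((x(i := w)) j))) = (\<Prod>j\<in>N-{i}. iota j (\<phi> (x j)))"
    by (rule prod.cong) auto
  finally show ?thesis .
qed

lemma tensor_rels_cases:
  assumes "r \<in> tensor_rels n A"
  obtains (add) x i u v where "r = single (x(i := u \<oplus>\<^bsub>A\<^esub> v)) 1 - (single (x(i := u)) 1 + single (x(i := v)) 1)"
      "x \<in> N \<rightarrow>\<^sub>E carrier A" "i \<in> N" "u \<in> carrier A" "v \<in> carrier A"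
    | (smult) x i c where "r = single (x(i := c \<odot>\<^bsub>A\<^esub> x i)) 1 - single x c" "x \<in> N \<rightarrow>\<^sub>E carrier A" "i \<in> N"
  using assms unfolding tensor_rels_def Un_iff by (elim disjE) blast+

lemma keys_single_le: "x \<in> K' \<Longrightarrow> keys (single x c) \<subseteq> K'"
  by simp

lemma tensor_rels_closed:
  assumes "r \<in> tensor_rels n A"
  shows "keys r \<subseteq> carrier M"
  using assms
proof (cases rule: tensor_rels_cases)
  case (add x i u v)
  show ?thesis
    unfolding add(1) M_simps
    by (intro keys_diff_closed keys_add_closed keys_single_le M_upd A.a_closed add)
next
  case (smult x i c)
  show ?thesis
    unfolding smult(1) M_simps
    by (intro keys_diff_closed keys_add_closed keys_single_le M_upd smult_closed M_mem smult)
qed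

lemma mult_upd:
  assumes "u \<in> N \<rightarrow>\<^sub>E carrier A" "x \<in> N \<rightarrow>\<^sub>E carrier A" "v \<in> N \<rightarrow>\<^sub>E carrier A" "i \<in> N"
  shows "u \<otimes>\<^bsub>M\<^esub> (x(i := w)) \<otimes>\<^bsub>M\<^esub> v = (u \<otimes>\<^bsub>M\<^esub> x \<otimes>\<^bsub>M\<^esub> v)(i := u i \<otimes>\<^bsub>A\<^esub> w \<otimes>\<^bsub>A\<^esub> v i)"
  using assms(4) by (auto simp: fun_eq_iff)

lemma tensor_rels_kill:
  assumes "r \<in> tensor_rels n A" and u: "u \<in> carrier M" and v: "v \<in> carrier M"
  shows "lin_ext ev (single u 1 \<otimes>\<^bsub>B\<^esub> r \<otimes>\<^bsub>B\<^esub> single v 1) = 0"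
  using assms(1)
proof (cases rule: tensor_rels_cases)
  case (add x i a b)
  have ui: "u i \<in> carrier A" "v i \<in> carrier A" using u v add by auto
  let ?y = "u \<otimes>\<^bsub>M\<^esub> x \<otimes>\<^bsub>M\<^esub> v"
  have "ev (?y(i := u i \<otimes>\<^bsub>A\<^esub> (a \<oplus>\<^bsub>A\<^esub> b) \<otimes>\<^bsub>A\<^esub> v i)) = ev (?y(i := u i \<otimes>\<^bsub>A\<^esub> a \<otimes>\<^bsub>A\<^esub> v i)) + ev (?y(i := u i \<otimes>\<^bsub>A\<^esub> b \<otimes>\<^bsub>A\<^esub> v i))"
    using add ui by (simp add: ev_upd A.r_distr A.l_distr \<phi>_add iota_add distrib_right del: M_simps)
  then show ?thesis
    using mult_upd[of u x v i] add u v
    by (simp add: monoid_algebra_diff_mult monoid_algebra_l_distr monoid_algebra_r_distr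
        monoid_algebra_mult_single lin_ext_diff lin_ext_add del: M_simps(3))
next
  case (smult x i c)
  have ui: "u i \<in> carrier A" "v i \<in> carrier A" "x i \<in> carrier A" using u v smult by auto
  let ?y = "u \<otimes>\<^bsub>M\<^esub> x \<otimes>\<^bsub>M\<^esub> v"
  have "ev (?y(i := u i \<otimes>\<^bsub>A\<^esub> (c \<odot>\<^bsub>A\<^esub> x i) \<otimes>\<^bsub>A\<^esub> v i)) = sc c (ev (?y(i := u i \<otimes>\<^bsub>A\<^esub> x i \<otimes>\<^bsub>A\<^esub> v i)))"
    using smult ui by (simp add: ev_upd smult_mult_left smult_mult_right \<phi>_smult iota_sc sc_mult_left del: M_simps)
  also have "?y(i := u i \<otimes>\<^bsub>A\<^esub> x i \<otimes>\<^bsub>A\<^esub> v i) = ?y"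
    using smult by auto
  finally have *: "ev (u \<otimes>\<^bsub>M\<^esub> (x(i := c \<odot>\<^bsub>A\<^esub> x i)) \<otimes>\<^bsub>M\<^esub> v) = sc c (ev ?y)"
    using mult_upd[of u x v i] smult u v by (simp only: M_simps)
  then show ?thesis
    unfolding smult(1)
    by (simp add: monoid_algebra_diff_mult monoid_algebra_mult_single lin_ext_diff del: M_simps)
qed

lemma ideal_J: "ideal J B"
  unfolding tensor_ideal_def tuple_alg_def
  by (rule ring.genideal_ideal[OF ring_monoid_algebra[OF monoid_M]])
     (use tensor_rels_closed in \<open>auto simp del: M_simps\<close>)

lemmas J_props = ideal_monoid_algebra[OF monoid_M ideal_J]

lemma J_rel: "r \<in> tensor_rels n A \<Longrightarrow> r \<in> J"
  unfolding tensor_ideal_def tuple_alg_def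
  using ring.genideal_self[OF ring_monoid_algebra[OF monoid_M], of "tensor_rels n A"] tensor_rels_closed
  by (auto simp del: M_simps)

lemma J_add:
  "x \<in> N \<rightarrow>\<^sub>E carrier A \<Longrightarrow> i \<in> N \<Longrightarrow> u \<in> carrier A \<Longrightarrow> v \<in> carrier A \<Longrightarrow>
    single (x(i := u \<oplus>\<^bsub>A\<^esub> v)) 1 - (single (x(i := u)) 1 + single (x(i := v)) 1) \<in> J"
  by (rule J_rel, unfold tensor_rels_def Un_iff) blast

lemma J_smult:
  "x \<in> N \<rightarrow>\<^sub>E carrier A \<Longrightarrow> i \<in> N \<Longrightarrow> single (x(i := c \<odot>\<^bsub>A\<^esub> x i)) 1 - single x c \<in> J"
  by (rule J_rel, unfold tensor_rels_def Un_iff) blast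

lemma ev_basis:
  assumes "\<gamma> \<in> mono_set n K"
  shows "ev (\<lambda>i\<in>N. \<psi> (single (\<gamma> i) 1)) = single \<gamma> 1"
proof -
  have "ev (\<lambda>i\<in>N. \<psi> (single (\<gamma> i) 1)) = (\<Prod>i\<in>N. single (put i (\<gamma> i)) 1)"
    unfolding ev_def using assms
    by (intro prod.cong) (auto simp: \<psi> iota_single mono_set_def)
  then show ?thesis
    by (simp add: prod_single sum_put[OF assms])
qed

lemma J_trans: "f - g \<in> J \<Longrightarrow> g - h \<in> J \<Longrightarrow> f - h \<in> J"
  using J_props(3)[of "f - g" "g - h"] by simp

lemma J_trans_add: "f - (g + g') \<in> J \<Longrightarrow> g - h \<in> J \<Longrightarrow> g' - h' \<in> J \<Longrightarrow> f - (h + h') \<in> J"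
  using J_props(3)[of "f - (g + g')" "(g - h) + (g' - h')"] J_props(3)[of "g - h" "g' - h'"]
  by (simp add: algebra_simps)

text \<open>Multilinearity reduces a tuple to basis tuples one coordinate at a time.\<close>
lemma J_normal_form:
  assumes "x \<in> N \<rightarrow>\<^sub>E carrier A"
  shows "single x 1 - lin_ext nf (ev x) \<in> J"
proof -
  \<comment> \<open>\<open>E\<close> is the set of coordinates that are still arbitrary; outside it
    the tuple already consists of basis elements.\<close>
  have "single x 1 - lin_ext nf (ev x) \<in> J"
    if "finite E" "E \<subseteq> N" "x \<in> N \<rightarrow>\<^sub>E carrier A" "\<forall>i\<in>N-E. \<exists>b\<in>K. x i = \<psi> (single b 1)" for E x
    using that
  proof (induction E arbitrary: x rule: finite_induct)
    case empty
    then have "\<exists>b. \<forall>i\<in>N. b i \<in> K \<and> x i = \<psi> (single (b i) 1)"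
      by (intro bchoice) auto
    then obtain b where b: "\<forall>i\<in>N. b i \<in> K \<and> x i = \<psi> (single (b i) 1)" by blast
    define \<gamma> where "\<gamma> = (\<lambda>i. if i \<in> N then b i else 0)"
    have \<gamma>: "\<gamma> \<in> mono_set n K" using b by (auto simp: \<gamma>_def mono_set_def)
    have x: "x = (\<lambda>i\<in>N. \<psi> (single (\<gamma> i) 1))"
      using b empty(2) by (auto simp: \<gamma>_def fun_eq_iff PiE_iff extensional_def)
    have "lin_ext nf (ev x) = single x 1"
      by (simp only: x ev_basis[OF \<gamma>] lin_ext_single nf_def sc_one)
    then show ?case
      using J_props(2) by simp
  next
    case (insert i E)
    have i: "i \<in> N" and E: "E \<subseteq> N" using insert by auto
    have IH: "single (x(i := \<psi> (single b 1))) 1 - lin_ext nf (ev (x(i := \<psi> (single b 1)))) \<in> J"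
      if "b \<in> K" for b
      using that insert.prems by (intro insert.IH E M_upd i \<psi>) auto
    have "single (x(i := \<psi> f)) 1 - lin_ext nf (ev (x(i := \<psi> f))) \<in> J" if "keys f \<subseteq> K" for f
      using that
    proof (induction f rule: poly_mapping_induct_on)
      case zero
      \<comment> \<open>The scalar relation with c = 0 shows that a tuple with entry 0 lies in the
        ideal.\<close>
      let ?y = "x(i := \<psi> 0)"
      have y: "?y \<in> N \<rightarrow>\<^sub>E carrier A" by (intro M_upd insert i \<psi>) auto
      have "?y(i := 0 \<odot>\<^bsub>A\<^esub> ?y i) = ?y" using \<psi>_sc[of 0 0] by simp
      then have "single ?y 1 - single ?y 0 \<in> J" using J_smult[OF y i, of 0] by simp
      moreover have "ev ?y = 0" by (simp add: ev_upd[OF i] \<psi>)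
      ultimately show ?case by (simp only: lin_ext_0 single_zero)
    next
      case (sgl b c)
      let ?y = "x(i := \<psi> (single b 1))"
      have y: "?y \<in> N \<rightarrow>\<^sub>E carrier A" using sgl by (intro M_upd insert i \<psi>) auto
      have 1: "?y(i := c \<odot>\<^bsub>A\<^esub> ?y i) = x(i := \<psi> (single b c))"
        using \<psi>_sc[of "single b 1" c] sgl by simp
      have 2: "single (x(i := \<psi> (single b c))) 1 - single ?y c \<in> J"
        using J_smult[OF y i, of c] unfolding 1 .
      have 3: "single ?y c - sc c (lin_ext nf (ev ?y)) \<in> J"
        using J_props(4)[OF IH[OF sgl], of c] by (simp add: sc_diff)
      have "ev (x(i := \<psi> (single b c))) = sc c (ev ?y)"
        using sgl by (simp add: ev_upd[OF i] \<psi> iota_single sc_mult_left flip: sc_mult_left)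
      then show ?case
        unfolding lin_ext_sc[symmetric] using J_trans[OF 2 3] by (simp only: lin_ext_sc)
    next
      case (add f g)
      have 1: "ev (x(i := \<psi> (f + g))) = ev (x(i := \<psi> f)) + ev (x(i := \<psi> g))"
        using add(1,2) by (simp add: ev_upd[OF i] \<psi> keys_add_closed iota_add distrib_right)
      have "single (x(i := \<psi> (f + g))) 1 - (single (x(i := \<psi> f)) 1 + single (x(i := \<psi> g)) 1) \<in> J"
        unfolding \<psi>_add[OF add(1,2)] by (intro J_add insert i \<psi> add)
      from J_trans_add[OF this add(3,4)] show ?case
        unfolding 1 lin_ext_add .
    qed
    from this[of "\<phi> (x i)"] show ?case
      using \<psi>(3)[OF M_mem[OF insert.prems(2) i]] \<phi>_K[OF M_mem[OF insert.prems(2) i]] by simp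
  qed
  from this[of N] assms show ?thesis by simp
qed

lemma keys_ev: "x \<in> N \<rightarrow>\<^sub>E carrier A \<Longrightarrow> keys (ev x) \<subseteq> mono_set n K"
  unfolding ev_def by (intro keys_prod_iota \<phi>_K M_mem)

lemma presentation: "presentation M (tensor_rels n A) ev nf"
proof (rule presentation.intro)
  fix w assume "w \<in> carrier M"
  then show "single w 1 - lin_ext nf (ev w) \<in> Idl\<^bsub>B\<^esub> tensor_rels n A"
    using J_normal_form by (simp add: tensor_ideal_def tuple_alg_def)
qed (intro monoid_M tensor_rels_closed tensor_rels_kill; assumption)+

interpretation P: presentation M "tensor_rels n A" ev nf
  by (rule presentation)

definition \<Psi> :: "((nat \<Rightarrow> 'a) \<Rightarrow>\<^sub>0 'k) set \<Rightarrow> ((nat \<Rightarrow> 'b) \<Rightarrow>\<^sub>0 'k)" where "\<Psi> = P.val"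

abbreviation "T \<equiv> tensor_pow n A"

lemma P_simps: "P.A = tuple_alg n A" "P.I = J" "P.Q = T"
  by (simp_all add: P.A_def P.I_def P.Q_def tuple_alg_def tensor_ideal_def tensor_pow_def)

lemma ring_T: "ring T"
  using P.Q.ring_axioms unfolding P_simps .

lemma \<Psi>_add: "X \<in> carrier T \<Longrightarrow> Y \<in> carrier T \<Longrightarrow> \<Psi> (X \<oplus>\<^bsub>T\<^esub> Y) = \<Psi> X + \<Psi> Y"
  using P.val_add unfolding P_simps \<Psi>_def .

lemma \<Psi>_one: "\<Psi> \<one>\<^bsub>T\<^esub> = 1"
  using P.val_coset[of "single \<one>\<^bsub>M\<^esub> 1"] P.Q_one
  by (simp add: \<Psi>_def P_simps ev_def \<phi>_one PiE_iff)

lemma lin_ext_ev_nf: "keys f \<subseteq> mono_set n K \<Longrightarrow> lin_ext ev (lin_ext nf f) = f"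
  unfolding lin_ext_lin_ext
  by (rule trans[OF lin_ext_cong lin_ext_single_id]) (auto simp: nf_def ev_basis)

lemma \<Psi>_bij: "bij_betw \<Psi> (carrier T) {f. keys f \<subseteq> mono_set n K}"
proof -
  have "lin_ext ev ` {f. keys f \<subseteq> carrier M} = ({f. keys f \<subseteq> mono_set n K} :: ((nat \<Rightarrow> 'b) \<Rightarrow>\<^sub>0 'k) set)"
  proof (intro equalityI subsetI)
    fix v :: "(nat \<Rightarrow> 'b) \<Rightarrow>\<^sub>0 'k" assume v: "v \<in> {f. keys f \<subseteq> mono_set n K}"
    then have "keys (lin_ext nf v) \<subseteq> carrier M"
      by (intro keys_lin_ext) (auto simp: nf_def PiE_iff mono_set_def intro!: \<psi>)
    with v show "v \<in> lin_ext ev ` {f. keys f \<subseteq> carrier M}"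
      by (intro image_eqI[of _ _ "lin_ext nf v"]) (simp_all add: lin_ext_ev_nf)
  next
    fix v :: "(nat \<Rightarrow> 'b) \<Rightarrow>\<^sub>0 'k" assume "v \<in> lin_ext ev ` {f. keys f \<subseteq> carrier M}"
    then show "v \<in> {f. keys f \<subseteq> mono_set n K}"
      using keys_ev by (auto simp only: mem_Collect_eq M_simps intro!: keys_lin_ext)
  qed
  then show ?thesis
    unfolding bij_betw_def \<Psi>_def using P.val_inj P.val_image by (simp add: P_simps)
qed

lemma T_repr:
  assumes "X \<in> carrier T" "f \<in> X"
  shows "keys f \<subseteq> N \<rightarrow>\<^sub>E carrier A" "lin_ext ev f = \<Psi> X"
  using P.Q_memD[of X f] assms by (simp_all add: P_simps \<Psi>_def)

lemma T_nonempty: "X \<in> carrier T \<Longrightarrow> X \<noteq> {}"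
  using P.Q_nonempty by (simp add: P_simps)

lemma quot_map_T:
  assumes "X \<noteq> {}" "\<And>x. x \<in> X \<Longrightarrow> keys (F x) \<subseteq> N \<rightarrow>\<^sub>E carrier A" "\<And>x. x \<in> X \<Longrightarrow> lin_ext ev (F x) = y"
  shows "quot_map (tuple_alg n A) J F X \<in> carrier T" "\<Psi> (quot_map (tuple_alg n A) J F X) = y"
  using P.quot_map[OF assms(1), of F y] assms(2,3) unfolding P_simps \<Psi>_def M_simps by blast+

text \<open>
  \<open>\<Psi>\<close> is not multiplicative, as its target is commutative; it only respects products whose left
  factors consist of elements by which left multiplication is respected by \<open>\<phi>\<close>.
\<close>
lemma \<Psi>_mult:
  assumes E: "E \<subseteq> carrier A" "\<And>x y. x \<in> E \<Longrightarrow> y \<in> carrier A \<Longrightarrow> \<phi> (x \<otimes>\<^bsub>A\<^esub> y) = \<phi> x * \<phi> y"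
    and X: "X \<in> carrier T" "f \<in> X" "keys f \<subseteq> N \<rightarrow>\<^sub>E E" and Y: "Y \<in> carrier T"
  shows "\<Psi> (X \<otimes>\<^bsub>T\<^esub> Y) = \<Psi> X * \<Psi> Y"
proof -
  obtain g where g: "keys g \<subseteq> carrier M" "Y = J +>\<^bsub>tuple_alg n A\<^esub> g" "\<Psi> Y = lin_ext ev g"
    using P.Q_cases[of Y] Y unfolding P_simps \<Psi>_def by metis
  have f: "keys f \<subseteq> carrier M" "lin_ext ev f = \<Psi> X"
    using T_repr[OF X(1,2)] by simp_all
  obtain f' where f': "keys f' \<subseteq> carrier M" "X = J +>\<^bsub>tuple_alg n A\<^esub> f'" "\<Psi> X = lin_ext ev f'"
    using P.Q_cases[of X] X(1) unfolding P_simps \<Psi>_def by metis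
  have Xf: "X = J +>\<^bsub>tuple_alg n A\<^esub> f"
    unfolding f'(2) using P.coset_eq[OF f(1)] P.coset_eq[OF f'(1)] f(2) f'(3) by (simp add: P_simps)
  have ev_mult: "ev (x \<otimes>\<^bsub>M\<^esub> y) = ev x * ev y" if "x \<in> N \<rightarrow>\<^sub>E E" "y \<in> N \<rightarrow>\<^sub>E carrier A" for x y
  proof -
    have "ev (x \<otimes>\<^bsub>M\<^esub> y) = (\<Prod>i\<in>N. iota i (\<phi> (x i \<otimes>\<^bsub>A\<^esub> y i)))"
      by (simp add: ev_def)
    also have "\<dots> = (\<Prod>i\<in>N. iota i (\<phi> (x i)) * iota i (\<phi> (y i)))"
      using E(2)[OF PiE_mem[OF that(1)] PiE_mem[OF that(2)]] by (intro prod.cong) (auto simp: iota_mult)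
    finally show ?thesis by (simp add: prod.distrib ev_def)
  qed
  have mult_single_ev: "lin_ext ev (single x c \<otimes>\<^bsub>B\<^esub> g) = sc c (ev x) * lin_ext ev g" if x: "x \<in> N \<rightarrow>\<^sub>E E" for x c
    using g(1)
  proof (induction g rule: poly_mapping_induct_on)
    case (sgl y d)
    then have "ev (x \<otimes>\<^bsub>M\<^esub> y) = ev x * ev y" by (intro ev_mult x) simp
    then show ?case
      unfolding monoid_algebra_mult_single lin_ext_single by (simp add: sc_mult_left sc_mult_right mult.commute[of d])
  qed (simp_all add: monoid_algebra_r_distr monoid_algebra_0_mult lin_ext_add distrib_left)
  have "lin_ext ev (f \<otimes>\<^bsub>B\<^esub> g) = lin_ext ev f * lin_ext ev g"
    using X(3)
    by (induction f rule: poly_mapping_induct_on)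
      (simp_all add: mult_single_ev monoid_algebra_l_distr monoid_algebra_0_mult lin_ext_add distrib_right)
  moreover have "X \<otimes>\<^bsub>T\<^esub> Y = J +>\<^bsub>tuple_alg n A\<^esub> (f \<otimes>\<^bsub>B\<^esub> g)"
    using P.Q_mult_coset[OF f(1) g(1)] unfolding P_simps Xf g(2) by (simp add: tuple_alg_def)
  ultimately show ?thesis
    using P.val_coset[OF monoid_algebra_closed[OF monoid_M f(1) g(1)]] f(2) g(3)
    by (simp add: P_simps \<Psi>_def)
qed

end

subsection \<open>Permutations of the variables\<close>

text \<open>Composing exponents with the inverse of \<pi> gives a left action that sends the
  variable at position i to the one at position \<pi> i, in accordance with
  \<open>tensor_perm\<close>.\<close>

definition permp :: "(nat \<Rightarrow> nat) \<Rightarrow> ((nat \<Rightarrow> 'b::comm_monoid_add) \<Rightarrow>\<^sub>0 'k::comm_ring_1) \<Rightarrow> ((nat \<Rightarrow> 'b) \<Rightarrow>\<^sub>0 'k)" where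
  "permp \<pi> = lin_ext (\<lambda>\<gamma>. single (\<gamma> \<circ> inv_into UNIV \<pi>) 1)"

lemma permp_mult: "permp \<pi> (f * g) = permp \<pi> f * permp \<pi> g"
  unfolding permp_def by (rule lin_ext_mult[of UNIV]) (simp_all add: mult_single plus_fun_def comp_def)

lemma permp_1 [simp]: "permp \<pi> (1 :: (nat \<Rightarrow> 'b::comm_monoid_add) \<Rightarrow>\<^sub>0 'k::comm_ring_1) = 1"
proof -
  have "0 \<circ> inv_into UNIV \<pi> = (0 :: nat \<Rightarrow> 'b)" by (simp add: fun_eq_iff)
  then show ?thesis unfolding permp_def by (intro lin_ext_1) simp
qed

lemma permp_single: "permp \<pi> (single \<gamma> c) = single (\<gamma> \<circ> inv_into UNIV \<pi>) c"
  by (simp add: permp_def)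

lemma permp_prod: "permp \<pi> (\<Prod>i\<in>I. f i) = (\<Prod>i\<in>I. permp \<pi> (f i))"
  by (induction I rule: infinite_finite_induct) (simp_all add: permp_mult)

lemma permp_add: "permp \<pi> (f + g) = permp \<pi> f + permp \<pi> g"
  by (simp add: permp_def lin_ext_add)

lemma permp_sc: "permp \<pi> (sc c f) = sc c (permp \<pi> f)"
  by (simp add: permp_def lin_ext_sc)

lemma permp_0 [simp]: "permp \<pi> 0 = 0"
  by (simp add: permp_def)

lemma permp_iota:
  fixes f :: "'b::comm_monoid_add \<Rightarrow>\<^sub>0 'k::comm_ring_1"
  assumes "bij \<pi>"
  shows "permp \<pi> (iota i f) = iota (\<pi> i) f"
proof -
  have "put i b \<circ> inv_into UNIV \<pi> = put (\<pi> i) b" for b :: 'b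
  proof
    fix j
    have "inv_into UNIV \<pi> j = i \<longleftrightarrow> j = \<pi> i"
      using assms by (metis bij_inv_eq_iff)
    then show "(put i b \<circ> inv_into UNIV \<pi>) j = put (\<pi> i) b j"
      by (auto simp: put_def)
  qed
  then show ?thesis
    by (simp add: permp_def iota_def lin_ext_lin_ext)
qed

lemma (in tensor_data) tensor_perm:
  assumes \<pi>: "\<pi> permutes {1..n}" and X: "X \<in> carrier T"
  shows tensor_perm_closed: "tensor_perm n A \<pi> X \<in> carrier T"
    and \<Psi>_tensor_perm: "\<Psi> (tensor_perm n A \<pi> X) = permp \<pi> (\<Psi> X)"
proof -
  let ?F = "lin_ext (\<lambda>x. single (\<lambda>i\<in>N. x (inv_into UNIV \<pi> i)) 1) :: _ \<Rightarrow> ((nat \<Rightarrow> 'a) \<Rightarrow>\<^sub>0 'k)"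
  have inv: "inv_into UNIV \<pi> permutes N" using \<pi> by (rule permutes_inv)
  have ev: "ev (\<lambda>i\<in>N. x (inv_into UNIV \<pi> i)) = permp \<pi> (ev x)" for x
  proof -
    have "permp \<pi> (ev x) = (\<Prod>i\<in>N. iota (\<pi> i) (\<phi> (x i)))"
      by (simp add: ev_def permp_prod permp_iota[OF permutes_bij[OF \<pi>]])
    also have "\<dots> = (\<Prod>i\<in>N. iota i (\<phi> (x (inv_into UNIV \<pi> i))))"
      using permutes_bij[OF \<pi>] permutes_in_image[OF \<pi>] permutes_in_image[OF inv]
      by (intro prod.reindex_bij_witness[of _ "inv_into UNIV \<pi>" \<pi>]) (auto simp: permutes_inverses[OF \<pi>])
    also have "\<dots> = ev (\<lambda>i\<in>N. x (inv_into UNIV \<pi> i))"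
      by (simp add: ev_def)
    finally show ?thesis by simp
  qed
  have 1: "keys (?F f) \<subseteq> N \<rightarrow>\<^sub>E carrier A" if "f \<in> X" for f
  proof (rule keys_lin_ext)
    fix x assume "x \<in> keys f"
    then have x: "x \<in> N \<rightarrow>\<^sub>E carrier A" using T_repr(1)[OF X that] by auto
    have "(\<lambda>i\<in>N. x (inv_into UNIV \<pi> i)) \<in> N \<rightarrow>\<^sub>E carrier A"
      using M_mem[OF x] permutes_in_image[OF inv] by (auto simp: PiE_iff)
    then show "keys (single (\<lambda>i\<in>N. x (inv_into UNIV \<pi> i)) (1::'k)) \<subseteq> N \<rightarrow>\<^sub>E carrier A"
      by simp
  qed
  have 2: "lin_ext ev (?F f) = permp \<pi> (\<Psi> X)" if "f \<in> X" for f
  proof -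
    have "lin_ext ev (?F f) = lin_ext (\<lambda>x. permp \<pi> (ev x)) f"
      by (simp add: lin_ext_lin_ext ev)
    also have "\<dots> = permp \<pi> (lin_ext ev f)"
      by (simp add: permp_def lin_ext_lin_ext)
    finally show ?thesis using T_repr(2)[OF X that] by simp
  qed
  show "tensor_perm n A \<pi> X \<in> carrier T" "\<Psi> (tensor_perm n A \<pi> X) = permp \<pi> (\<Psi> X)"
    unfolding tensor_perm_def using quot_map_T[OF T_nonempty[OF X] 1 2] by auto
qed

text \<open>\<open>H\<close> is a homomorphism of the commutative coordinate rings that restricts to
  \<open>h i\<close> on the i-th factor; as a pure tensor is a product over its factors,
  \<open>H\<close> is then the coordinate form of the whole tensor map. It is applied to the torus
  action and to the embedding of D^n. The third conclusion provides a representative with entries in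
  the images, as \<open>\<Psi>_mult\<close> requires.\<close>

lemma tensor_map:
  fixes A :: "('k::comm_ring_1, 'a) module" and A' :: "('k, 'c) module"
    and \<phi> :: "'a \<Rightarrow> ('b::comm_monoid_add \<Rightarrow>\<^sub>0 'k)" and \<phi>' :: "'c \<Rightarrow> ('d::comm_monoid_add \<Rightarrow>\<^sub>0 'k)"
  assumes T: "tensor_data A \<phi> K" and T': "tensor_data A' \<phi>' K'"
    and h: "\<And>i x. i \<in> {1..n} \<Longrightarrow> x \<in> carrier A' \<Longrightarrow> h i x \<in> carrier A \<and> H (iota i (\<phi>' x)) = iota i (\<phi> (h i x))"
    and H: "\<And>f g. H (f * g) = H f * H g" "H 1 = 1" "H = lin_ext \<chi>"
    and X: "X \<in> carrier (tensor_pow n A')"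
  shows "tensor_map n A h X \<in> carrier (tensor_pow n A)"
    and "tensor_data.\<Psi> \<phi> n (tensor_map n A h X) = H (tensor_data.\<Psi> \<phi>' n X)"
    and "\<exists>f\<in>tensor_map n A h X. keys f \<subseteq> (\<Pi>\<^sub>E i\<in>{1..n}. h i ` carrier A')"
proof -
  interpret T: tensor_data A \<phi> K n by fact
  interpret T': tensor_data A' \<phi>' K' n by fact
  let ?F = "lin_ext (\<lambda>x. single (\<lambda>i\<in>{1..n}. h i (x i)) 1) :: _ \<Rightarrow> ((nat \<Rightarrow> 'a) \<Rightarrow>\<^sub>0 'k)"
  have ev: "T.ev (\<lambda>i\<in>{1..n}. h i (x i)) = H (T'.ev x)" if "x \<in> {1..n} \<rightarrow>\<^sub>E carrier A'" for x
  proof -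
    have "H (\<Prod>i\<in>I. f i) = (\<Prod>i\<in>I. H (f i))" for I :: "nat set" and f
      by (induction I rule: infinite_finite_induct) (simp_all add: H(1,2))
    then have "H (T'.ev x) = (\<Prod>i\<in>{1..n}. H (iota i (\<phi>' (x i))))"
      by (simp add: T'.ev_def)
    also have "\<dots> = (\<Prod>i\<in>{1..n}. iota i (\<phi> (h i (x i))))"
      using h T'.M_mem[OF that] by (intro prod.cong) auto
    finally show ?thesis by (simp add: T.ev_def)
  qed
  have 0: "keys (?F f) \<subseteq> (\<Pi>\<^sub>E i\<in>{1..n}. h i ` carrier A')" if "f \<in> X" for f
  proof (rule keys_lin_ext)
    fix x assume "x \<in> keys f"
    then have x: "x \<in> {1..n} \<rightarrow>\<^sub>E carrier A'" using T'.T_repr(1)[OF X that] by auto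
    have "(\<lambda>i\<in>{1..n}. h i (x i)) \<in> (\<Pi>\<^sub>E i\<in>{1..n}. h i ` carrier A')"
      using T'.M_mem[OF x] by (auto simp: PiE_iff)
    then show "keys (single (\<lambda>i\<in>{1..n}. h i (x i)) (1::'k)) \<subseteq> (\<Pi>\<^sub>E i\<in>{1..n}. h i ` carrier A')"
      by simp
  qed
  have sub: "(\<Pi>\<^sub>E i\<in>{1..n}. h i ` carrier A') \<subseteq> {1..n} \<rightarrow>\<^sub>E carrier A"
    using h by (intro PiE_mono) auto
  have 1: "keys (?F f) \<subseteq> {1..n} \<rightarrow>\<^sub>E carrier A" if "f \<in> X" for f
    using 0[OF that] sub by (rule subset_trans)
  have 2: "lin_ext T.ev (?F f) = H (T'.\<Psi> X)" if "f \<in> X" for f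
  proof -
    have "lin_ext T.ev (?F f) = lin_ext (\<lambda>x. T.ev (\<lambda>i\<in>{1..n}. h i (x i))) f"
      by (simp add: lin_ext_lin_ext)
    also have "\<dots> = lin_ext (\<lambda>x. H (T'.ev x)) f"
      using T'.T_repr(1)[OF X that] ev by (intro lin_ext_cong) blast
    also have "\<dots> = H (lin_ext T'.ev f)"
      by (simp add: H(3) lin_ext_lin_ext)
    finally show ?thesis using T'.T_repr(2)[OF X that] by simp
  qed
  show "tensor_map n A h X \<in> carrier (tensor_pow n A)" "T.\<Psi> (tensor_map n A h X) = H (T'.\<Psi> X)"
    unfolding tensor_map_def using T.quot_map_T[OF T'.T_nonempty[OF X] 1 2] by auto
  obtain f where f: "f \<in> X" using T'.T_nonempty[OF X] by auto
  have "?F f \<in> tensor_map n A h X"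
  proof -
    have "0 \<in> tensor_ideal n A" by (rule T.J_props(2))
    then show ?thesis
      using f by (force simp: tensor_map_def quot_map_def a_r_coset_def r_coset_def tuple_alg_def)
  qed
  then show "\<exists>f\<in>tensor_map n A h X. keys f \<subseteq> (\<Pi>\<^sub>E i\<in>{1..n}. h i ` carrier A')"
    using 0[OF f] by blast
qed

section \<open>Polynomials and Laurent polynomials over their symmetric parts\<close>

definition var :: "nat \<Rightarrow> ((nat \<Rightarrow> int) \<Rightarrow>\<^sub>0 'k::comm_ring_1)" where
  "var i = single (put i 1) 1"

text \<open>Only the first \<open>k\<close> variables are permuted. Raising \<open>k\<close> by one
  at a time gives the tower of invariant rings along which the staircase basis is
  constructed.\<close>

definition fixed :: "nat \<Rightarrow> ((nat \<Rightarrow> int) \<Rightarrow>\<^sub>0 'k::comm_ring_1) \<Rightarrow> bool" where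
  "fixed k f \<longleftrightarrow> (\<forall>\<pi>. \<pi> permutes {1..k} \<longrightarrow> permp \<pi> f = f)"

lemma permp_id [simp]: "permp id f = f"
  by (simp add: permp_def)

lemma permp_permp:
  assumes "bij \<pi>" "bij \<rho>"
  shows "permp \<pi> (permp \<rho> f) = permp (\<pi> \<circ> \<rho>) f"
  using o_inv_distrib[OF assms] by (simp add: permp_def lin_ext_lin_ext comp_assoc)

lemma permp_diff: "permp \<pi> (f - g) = permp \<pi> f - permp \<pi> g"
  by (simp add: permp_def lin_ext_diff)

lemma permp_sum: "permp \<pi> (\<Sum>i\<in>I. f i) = (\<Sum>i\<in>I. permp \<pi> (f i))"
  by (simp add: permp_def lin_ext_sum)

lemma permp_power: "permp \<pi> (f ^ j) = permp \<pi> f ^ j"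
  by (induction j) (simp_all add: permp_mult)

lemma var_iota: "var i = iota i (single 1 1)"
  by (simp add: var_def iota_single)

lemma permp_var: "bij \<pi> \<Longrightarrow> permp \<pi> (var i) = var (\<pi> i)"
  by (simp add: var_iota permp_iota)

lemma var_power: "var i ^ j = single (put i (int j)) 1"
proof (induction j)
  case (Suc j)
  have "put i 1 + put i (int j) = put i (int (Suc j))"
    by (simp flip: put_add)
  then show ?case
    unfolding power_Suc Suc by (simp only: var_def mult_single mult_1)
qed (simp only: power_0 of_nat_0 put_0 single_one)

lemma lookup_single_mult:
  fixes f :: "'a::cancel_comm_monoid_add \<Rightarrow>\<^sub>0 'k::comm_ring_1"
  shows "lookup (single \<delta> c * f) (\<delta> + \<gamma>) = c * lookup f \<gamma>"
proof -
  have "keys f \<subseteq> UNIV" by simp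
  then show ?thesis
    by (induction f rule: poly_mapping_induct_on)
      (simp_all add: mult_single distrib_left lookup_add lookup_single when_def)
qed

text \<open>If x_i f = x_j f, the coefficients of f are constant along translation of the exponent
  by e_i - e_j. A nonzero coefficient would then recur with arbitrarily large i-th exponent,
  contrary to finite support.\<close>

lemma var_diff_mult_eq_0:
  assumes "i \<noteq> j" "(var i - var j) * f = 0"
  shows "f = 0"
proof (rule ccontr)
  assume "f \<noteq> 0"
  have eq: "single (put i 1) 1 * f = single (put j 1) 1 * f"
    using assms(2) by (simp add: var_def left_diff_distrib)
  have step: "lookup f (put i 1 - put j 1 + \<gamma>) = lookup f \<gamma>" for \<gamma>
  proof -
    have "lookup f \<gamma> = lookup (single (put i 1) 1 * f) (put i 1 + \<gamma>)"
      by (simp add: lookup_single_mult)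
    also have "\<dots> = lookup (single (put j 1) 1 * f) (put j 1 + (put i 1 - put j 1 + \<gamma>))"
      unfolding eq by (simp add: algebra_simps)
    also have "\<dots> = lookup f (put i 1 - put j 1 + \<gamma>)"
      unfolding lookup_single_mult by simp
    finally show ?thesis by simp
  qed
  define m where "m = Max ((\<lambda>\<gamma>. \<gamma> i) ` keys f)"
  have "m \<in> (\<lambda>\<gamma>. \<gamma> i) ` keys f"
    unfolding m_def using \<open>f \<noteq> 0\<close> by (intro Max_in) auto
  then obtain \<gamma> where \<gamma>: "\<gamma> \<in> keys f" "\<gamma> i = m" by auto
  then have "put i 1 - put j 1 + \<gamma> \<in> keys f" using step by (simp add: in_keys_iff)
  then have "(put i 1 - put j 1 + \<gamma>) i \<in> (\<lambda>\<gamma>. \<gamma> i) ` keys f" by (rule imageI)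
  then have "(put i 1 - put j 1 + \<gamma>) i \<le> m"
    unfolding m_def by (intro Max_ge) auto
  then show False using \<gamma>(2) assms(1) by (simp add: put_def)
qed

text \<open>The usual count of roots does not require a domain here: differences of the nodes are
  not zero divisors by \<open>var_diff_mult_eq_0\<close>, so after one linear factor is split off,
  the other nodes remain roots of the cofactor.\<close>

lemma poly_eq_0_if_many_roots:
  fixes F :: "((nat \<Rightarrow> int) \<Rightarrow>\<^sub>0 'k::comm_ring_1) poly"
  assumes "finite I" "\<And>i. i \<in> I \<Longrightarrow> poly F (var i) = 0" "\<And>j. j \<ge> card I \<Longrightarrow> coeff F j = 0"
  shows "F = 0"
  using assms
proof (induction I arbitrary: F rule: finite_induct)
  case empty
  then show ?case by (simp add: poly_eq_iff)
next
  case (insert i I)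
  obtain G where G: "F = [:- var i, 1:] * G"
    using insert.prems(1)[of i] by (auto simp: poly_eq_0_iff_dvd elim: dvdE)
  have cF: "coeff F (Suc j) = coeff G j - var i * coeff G (Suc j)" for j
    by (simp add: G coeff_pCons split: nat.splits)
  have "G = 0"
  proof (rule insert.IH)
    fix j assume j: "j \<in> I"
    then have "(var j - var i) * poly G (var j) = 0"
      using insert.prems(1)[of j] by (simp add: G algebra_simps)
    then show "poly G (var j) = 0"
      using var_diff_mult_eq_0[of j i] j insert.hyps by auto
  next
    fix j assume j: "j \<ge> card I"
    show "coeff G j = 0"
    proof (rule ccontr)
      assume *: "coeff G j \<noteq> 0"
      then have "coeff G (degree G) \<noteq> 0" "j \<le> degree G" by (auto simp: le_degree)
      \<comment> \<open>The linear factor is monic, so the leading coefficient of \<open>G\<close>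
        reappears in \<open>F\<close> one degree higher, where \<open>F\<close> is known to have no
        terms.\<close>
      moreover have "coeff F (Suc (degree G)) = coeff G (degree G)"
        unfolding cF by (simp add: coeff_eq_0)
      moreover have "coeff F (Suc (degree G)) = 0"
        using j \<open>j \<le> degree G\<close> insert.hyps by (intro insert.prems(2)) simp
      ultimately show False by simp
    qed
  qed
  then show ?case by (simp add: G)
qed

lemma poly_map_poly_hom:
  assumes "h 0 = 0" "\<And>x y. h (x + y) = h x + h y" "\<And>x y. h (x * y) = h x * h y"
  shows "poly (map_poly h F) (h x) = h (poly F x)"
  by (induction F) (simp_all add: assms map_poly_pCons)

locale lpoly_data =
  fixes S :: "int set" and n :: nat
  assumes S: "S = {0..} \<or> S = UNIV"
begin

abbreviation PI :: "((nat \<Rightarrow> int) \<Rightarrow>\<^sub>0 'k::comm_ring_1) set" where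
  "PI \<equiv> {f. keys f \<subseteq> mono_set n S}"

lemma S_nonneg: "i \<ge> 0 \<Longrightarrow> i \<in> S" and S_add: "i \<in> S \<Longrightarrow> j \<in> S \<Longrightarrow> i + j \<in> S"
  using S by auto

lemma PI_0: "0 \<in> PI" and PI_add: "f \<in> PI \<Longrightarrow> g \<in> PI \<Longrightarrow> f + g \<in> PI"
  and PI_diff: "f \<in> PI \<Longrightarrow> g \<in> PI \<Longrightarrow> f - g \<in> PI" and PI_sc: "f \<in> PI \<Longrightarrow> sc c f \<in> PI"
  by (simp_all add: keys_add_closed keys_diff_closed keys_sc_closed)

lemma mono_set_add: "\<gamma> \<in> mono_set n S \<Longrightarrow> \<delta> \<in> mono_set n S \<Longrightarrow> \<gamma> + \<delta> \<in> mono_set n S"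
  by (auto simp: mono_set_def S_add)

lemma PI_mult: "f \<in> PI \<Longrightarrow> g \<in> PI \<Longrightarrow> f * g \<in> PI"
  using keys_mult_closed[of "mono_set n S" f g] mono_set_add by simp

lemma PI_single: "\<gamma> \<in> mono_set n S \<Longrightarrow> single \<gamma> c \<in> PI"
  by simp

lemma PI_1: "1 \<in> PI"
  using S_nonneg by (auto simp: mono_set_def)

lemma PI_sum: "(\<And>i. i \<in> I \<Longrightarrow> f i \<in> PI) \<Longrightarrow> (\<Sum>i\<in>I. f i) \<in> PI"
  by (induction I rule: infinite_finite_induct) (simp_all add: PI_0 PI_add del: mem_Collect_eq)

lemma put_mono_set: "i \<in> {1..n} \<Longrightarrow> j \<in> S \<Longrightarrow> put i j \<in> mono_set n S"
  using S_nonneg by (auto simp: put_def mono_set_def)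

lemma PI_var: "i \<in> {1..n} \<Longrightarrow> var i \<in> PI"
  unfolding var_def by (intro PI_single put_mono_set S_nonneg) auto

lemma mono_set_perm:
  assumes "\<pi> permutes {1..n}" "\<gamma> \<in> mono_set n S"
  shows "\<gamma> \<circ> inv_into UNIV \<pi> \<in> mono_set n S"
  using assms(2) permutes_in_image[OF permutes_inv[OF assms(1)]] by (auto simp: mono_set_def)

lemma PI_permp: "\<pi> permutes {1..n} \<Longrightarrow> f \<in> PI \<Longrightarrow> permp \<pi> f \<in> PI"
  unfolding permp_def mem_Collect_eq using mono_set_perm by (intro keys_lin_ext) auto

subsection \<open>Substituting one variable for another\<close>

definition subst :: "nat \<Rightarrow> nat \<Rightarrow> ((nat \<Rightarrow> int) \<Rightarrow>\<^sub>0 'k::comm_ring_1) \<Rightarrow> ((nat \<Rightarrow> int) \<Rightarrow>\<^sub>0 'k)" where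
  "subst l i = lin_ext (\<lambda>\<gamma>. single (\<gamma>(i := \<gamma> i + \<gamma> l, l := 0)) 1)"

lemma subst_mult: "i \<noteq> l \<Longrightarrow> subst l i (f * g) = subst l i f * subst l i g"
  unfolding subst_def
  by (rule lin_ext_mult[of UNIV]) (auto simp: mult_single fun_eq_iff intro!: arg_cong2[of _ _ _ _ single])

lemma subst_1 [simp]: "subst l i 1 = 1"
  unfolding subst_def
proof (rule lin_ext_1)
  have "(0 :: nat \<Rightarrow> int)(i := 0 i + 0 l, l := 0) = 0" by auto
  then show "single ((0 :: nat \<Rightarrow> int)(i := 0 i + 0 l, l := 0)) 1 = 1" by (simp only: single_one)
qed

lemma subst_add: "subst l i (f + g) = subst l i f + subst l i g"
  by (simp add: subst_def lin_ext_add)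

lemma subst_diff: "subst l i (f - g) = subst l i f - subst l i g"
  by (simp add: subst_def lin_ext_diff)

lemma subst_0 [simp]: "subst l i 0 = 0"
  by (simp add: subst_def)

lemma subst_prod: "i \<noteq> l \<Longrightarrow> subst l i (\<Prod>j\<in>I. f j) = (\<Prod>j\<in>I. subst l i (f j))"
  by (induction I rule: infinite_finite_induct) (simp_all add: subst_mult)

lemma subst_var: "i \<noteq> l \<Longrightarrow> subst l i (var j) = var (if j = l then i else j)"
  by (auto simp: subst_def var_def put_def fun_eq_iff intro!: arg_cong2[of _ _ _ _ single])

text \<open>After x_l has been specialised to x_i the two variables can no longer be told apart.
  This is the source of the compatibility that \<open>interpolation\<close> demands of the
  conjugates of a polynomial.\<close>

lemma subst_transpose:
  assumes "i \<noteq> l"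
  shows "subst l i (permp (transpose i l) f) = subst l i f"
proof -
  have "(\<gamma> \<circ> transpose i l)(i := (\<gamma> \<circ> transpose i l) i + (\<gamma> \<circ> transpose i l) l, l := 0)
      = \<gamma>(i := \<gamma> i + \<gamma> l, l := 0)" for \<gamma> :: "nat \<Rightarrow> int"
    using assms by (auto simp: fun_eq_iff transpose_def)
  then show ?thesis
    by (simp add: subst_def permp_def lin_ext_lin_ext)
qed

lemma var_power_diff:
  assumes "i \<in> {1..n}" "l \<in> {1..n}"
  shows "\<exists>g\<in>PI. single (put l (int m)) 1 - single (put i (int m)) 1 = (var i - var l) * (g :: _ \<Rightarrow>\<^sub>0 'k::comm_ring_1)"
proof (induction m)
  case 0
  show ?case using PI_0 by (intro bexI[of _ 0]) auto
next
  case (Suc m)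
  then obtain g where g: "g \<in> PI" "var l ^ m - var i ^ m = (var i - var l) * (g :: _ \<Rightarrow>\<^sub>0 'k)"
    by (auto simp: var_power simp del: mem_Collect_eq)
  have "var l ^ Suc m - var i ^ Suc m = (var i - var l) * (var l * g - (var i ^ m :: _ \<Rightarrow>\<^sub>0 'k))"
  proof -
    have "var l ^ Suc m - var i ^ Suc m = var l * (var l ^ m - var i ^ m) - (var i - var l) * (var i ^ m :: _ \<Rightarrow>\<^sub>0 'k)"
      by (simp add: algebra_simps)
    then show ?thesis unfolding g(2) by (simp add: algebra_simps)
  qed
  moreover have "var l * g - var i ^ m \<in> PI"
    unfolding var_power
    by (intro PI_diff PI_mult PI_var g assms PI_single put_mono_set S_nonneg) auto
  ultimately show ?case unfolding var_power by blast
qed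

lemma put_diff_factor:
  assumes "i \<in> {1..n}" "l \<in> {1..n}" "s \<in> S"
  shows "\<exists>g\<in>PI. single (put l s) 1 - single (put i s) 1 = (var i - var l) * (g :: _ \<Rightarrow>\<^sub>0 'k::comm_ring_1)"
proof (cases "s \<ge> 0")
  case True
  then show ?thesis using var_power_diff[OF assms(1,2), of "nat s"] by simp
next
  case False
  then obtain g where g: "g \<in> PI"
    "single (put l (- s)) 1 - single (put i (- s)) 1 = (var i - var l) * (g :: _ \<Rightarrow>\<^sub>0 'k)"
    using var_power_diff[OF assms(1,2), of "nat (- s)"] by auto
  \<comment> \<open>The exponent s is negative here. Multiplication by this monomial turns the
    difference of powers with exponent -s into the wanted one, up to sign.\<close>
  define u where "u = (single (put l s + put i s) 1 :: _ \<Rightarrow>\<^sub>0 'k)"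
  have eq: "put l s + put i s + put l (- s) = put i s" "put l s + put i s + put i (- s) = put l s"
    by (auto simp: put_def)
  have "single (put l s) 1 - single (put i s) 1
      = - (u * (single (put l (- s)) 1 - single (put i (- s)) 1))"
    unfolding u_def right_diff_distrib mult_single eq by simp
  also have "\<dots> = (var i - var l) * (- (u * g))"
    unfolding g(2) by (simp add: algebra_simps)
  finally have "single (put l s) 1 - single (put i s) 1 = (var i - var l) * (0 - u * g)" by simp
  moreover have "0 - u * g \<in> PI"
    unfolding u_def by (intro PI_diff PI_0 PI_mult g PI_single mono_set_add put_mono_set assms)
  ultimately show ?thesis by blast
qed

lemma diff_subst_factor:
  fixes f :: "(nat \<Rightarrow> int) \<Rightarrow>\<^sub>0 'k::comm_ring_1"
  assumes "i \<in> {1..n}" "l \<in> {1..n}" "i \<noteq> l" "f \<in> PI"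
  shows "\<exists>g\<in>PI. f - subst l i f = (var i - var l) * g"
proof -
  from assms(4) have "keys f \<subseteq> mono_set n S" by simp
  then show ?thesis
  proof (induction f rule: poly_mapping_induct_on)
    case zero
    show ?case using PI_0 by (intro bexI[of _ 0]) auto
  next
    case (sgl \<gamma> c)
    have "\<gamma> l \<in> S" using sgl assms(2) by (auto simp: mono_set_def)
    then obtain g where g: "g \<in> PI"
      "single (put l (\<gamma> l)) 1 - single (put i (\<gamma> l)) 1 = (var i - var l) * (g :: _ \<Rightarrow>\<^sub>0 'k)"
      using put_diff_factor[OF assms(1,2)] by blast
    define u where "u = (single (\<gamma>(l := 0)) c :: _ \<Rightarrow>\<^sub>0 'k)"
    have eq: "\<gamma>(l := 0) + put l (\<gamma> l) = \<gamma>" "\<gamma>(l := 0) + put i (\<gamma> l) = \<gamma>(i := \<gamma> i + \<gamma> l, l := 0)"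
      using assms(3) by (auto simp: put_def fun_eq_iff)
    have "single \<gamma> c - subst l i (single \<gamma> c) = u * (single (put l (\<gamma> l)) 1 - single (put i (\<gamma> l)) 1)"
      unfolding u_def right_diff_distrib mult_single eq by (simp add: subst_def)
    also have "\<dots> = (var i - var l) * (u * g)"
      unfolding g(2) by (simp add: algebra_simps)
    finally have "single \<gamma> c - subst l i (single \<gamma> c) = (var i - var l) * (u * g)" .
    moreover have "\<gamma>(l := 0) \<in> mono_set n S"
      using sgl S_nonneg by (auto simp: mono_set_def)
    then have "u * g \<in> PI"
      unfolding u_def by (intro PI_mult g PI_single)
    ultimately show ?case by blast
  next
    case (add f f')
    then obtain g g' where "g \<in> PI" "g' \<in> PI" "f - subst l i f = (var i - var l) * g"
      "f' - subst l i f' = (var i - var l) * g'" by blast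
    then show ?case
      by (intro bexI[of _ "g + g'"] PI_add) (simp_all add: subst_add distrib_left add_diff_add)
  qed
qed

text \<open>Factors are split off one at a time. The differences x_i - x_j already found are
  unchanged when x_l is replaced by x_i and are not zero divisors, so the vanishing passes from f to
  its cofactor, which is then divisible by x_i - x_l.\<close>

lemma prod_factor:
  fixes f :: "(nat \<Rightarrow> int) \<Rightarrow>\<^sub>0 'k::comm_ring_1"
  assumes "finite I" "I \<subseteq> {1..n}" "i \<in> {1..n}" "i \<notin> I" "f \<in> PI" "\<And>l. l \<in> I \<Longrightarrow> subst l i f = 0"
  shows "\<exists>g\<in>PI. f = g * (\<Prod>l\<in>I. var i - var l)"
  using assms
proof (induction I rule: finite_induct)
  case empty
  then show ?case by (intro bexI[of _ f]) auto
next
  case (insert l I)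
  have il: "i \<noteq> l" using insert by auto
  have "\<exists>g\<in>PI. f = g * (\<Prod>l\<in>I. var i - var l)"
    using insert.prems by (intro insert.IH) auto
  then obtain g where g: "g \<in> PI" "f = g * (\<Prod>l\<in>I. var i - var l)" by blast
  have "subst l i f = subst l i g * (\<Prod>j\<in>I. var i - var j)"
    unfolding g(2) subst_mult[OF il] subst_prod[OF il]
    using insert.hyps(2) by (intro arg_cong2[of _ _ _ _ "(*)"] prod.cong refl)
      (auto simp: subst_diff subst_var[OF il] il)
  then have eq: "(\<Prod>j\<in>I. var i - var j) * subst l i g = 0"
    using insert.prems(5)[of l] by (simp add: mult.commute)
  have "subst l i g = 0"
    using \<open>finite I\<close> eq \<open>i \<notin> insert l I\<close>
  proof (induction I rule: finite_induct)
    case (insert j I)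
    have "(var i - var j) * ((\<Prod>j\<in>I. var i - var j) * subst l i g) = 0"
      using insert by (simp add: mult.assoc)
    then show ?case
      using insert var_diff_mult_eq_0[of i j] by auto
  qed simp
  then obtain g' where "g' \<in> PI" "g = (var i - var l) * g'"
    using diff_subst_factor[of i l g] insert.prems il g(1) by auto
  then show ?case
    using insert.hyps g(2) by (intro bexI[of _ g']) (simp_all add: mult_ac)
qed

subsection \<open>Interpolation\<close>

lemma coeffs_PI_mult:
  fixes F G :: "((nat \<Rightarrow> int) \<Rightarrow>\<^sub>0 'k::comm_ring_1) poly"
  assumes "\<And>j. coeff F j \<in> PI" "\<And>j. coeff G j \<in> PI"
  shows "coeff (F * G) j \<in> PI"
  unfolding coeff_mult by (intro PI_sum PI_mult assms)

text \<open>Newton interpolation. The next coefficient is the discrepancy at the new node divided by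
  the product of differences of nodes, and compatibility of the values makes this division exact
  within \<open>PI\<close>. The number \<open>r\<close> of nodes grows while the data stay indexed
  up to \<open>k\<close>.\<close>

lemma interpolation:
  fixes f :: "nat \<Rightarrow> ((nat \<Rightarrow> int) \<Rightarrow>\<^sub>0 'k::comm_ring_1)"
  assumes "r \<le> k" "k \<le> n" "\<And>i. i \<in> {1..k} \<Longrightarrow> f i \<in> PI"
    "\<And>i l. i \<in> {1..k} \<Longrightarrow> l \<in> {1..k} \<Longrightarrow> i \<noteq> l \<Longrightarrow> subst l i (f l) = subst l i (f i)"
  shows "\<exists>F. (\<forall>j. coeff F j \<in> PI) \<and> (\<forall>j\<ge>r. coeff F j = 0) \<and> (\<forall>i\<in>{1..r}. poly F (var i) = f i)"
  using assms(1)
proof (induction r)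
  case 0
  show ?case using PI_0 by (intro exI[of _ 0]) auto
next
  case (Suc r)
  then have "r \<le> k" by simp
  from Suc.IH[OF this] obtain F where "\<forall>j. coeff F j \<in> PI" "\<forall>j\<ge>r. coeff F j = 0"
    "\<forall>i\<in>{1..r}. poly F (var i) = f i" by blast
  note F = this[rule_format]
  let ?i = "Suc r"
  define u where "u = f ?i - poly F (var ?i)"
  have "poly F (var ?i) \<in> PI"
    unfolding poly_altdef var_power using Suc assms(2)
    by (intro PI_sum PI_mult F PI_single put_mono_set S_nonneg) auto
  moreover have "f ?i \<in> PI" using Suc by (intro assms(3)) auto
  ultimately have u: "u \<in> PI" unfolding u_def by (rule PI_diff[rotated])
  \<comment> \<open>When x_l is specialised to the new variable, the value of \<open>F\<close> at
    the new node agrees with its value at the old node, which is \<open>f l\<close>; compatibility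
    identifies that with the value prescribed at the new node.\<close>
  have "subst l ?i u = 0" if l: "l \<in> {1..r}" for l
  proof -
    have il: "?i \<noteq> l" using l by auto
    note hom = poly_map_poly_hom[of "subst l ?i", OF subst_0 subst_add subst_mult[OF il]]
    have "subst l ?i (poly F (var ?i)) = poly (map_poly (subst l ?i) F) (var ?i)"
      using hom[of F "var ?i"] by (simp add: subst_var[OF il])
    also have "\<dots> = subst l ?i (poly F (var l))"
      using hom[of F "var l"] by (simp add: subst_var[OF il])
    also have "\<dots> = subst l ?i (f ?i)"
      using F(3)[OF l] assms(4)[of ?i l] l il Suc by auto
    finally show ?thesis by (simp add: u_def subst_diff)
  qed
  then obtain w where w: "w \<in> PI" "u = w * (\<Prod>l\<in>{1..r}. var ?i - var l)"
    using prod_factor[of "{1..r}" ?i u] u Suc assms(2) by fastforce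
  define P where "P = (\<Prod>l\<in>{1..r}. [:- var l, 1 :: (nat \<Rightarrow> int) \<Rightarrow>\<^sub>0 'k:])"
  define F' where "F' = F + Polynomial.smult w P"
  have degP: "degree P \<le> r"
  proof -
    have "degree P \<le> (\<Sum>l\<in>{1..r}. degree [:- var l, 1 :: (nat \<Rightarrow> int) \<Rightarrow>\<^sub>0 'k:])"
      unfolding P_def using degree_prod_sum_le[of "{1..r}" "\<lambda>l. [:- var l, 1 :: (nat \<Rightarrow> int) \<Rightarrow>\<^sub>0 'k:]"]
      by (simp add: comp_def)
    also have "\<dots> \<le> (\<Sum>l\<in>{1..r}. 1)" by (intro sum_mono) simp
    finally show ?thesis by simp
  qed
  have P0: "(0 :: (nat \<Rightarrow> int) \<Rightarrow>\<^sub>0 'k) \<in> PI" and P1: "(1 :: (nat \<Rightarrow> int) \<Rightarrow>\<^sub>0 'k) \<in> PI"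
    by (rule PI_0, rule PI_1)
  have "coeff P j \<in> PI" for j
  proof -
    have "coeff (\<Prod>l\<in>I. [:- var l, 1 :: (nat \<Rightarrow> int) \<Rightarrow>\<^sub>0 'k:]) j \<in> PI" if "finite I" "I \<subseteq> {1..n}" for I
      using that
    proof (induction I arbitrary: j rule: finite_induct)
      case empty
      show ?case
        using P0 P1 by (cases "j = 0") (simp_all add: coeff_1)
    next
      case (insert l I)
      have "coeff [:- var l, 1 :: (nat \<Rightarrow> int) \<Rightarrow>\<^sub>0 'k:] j \<in> PI" for j
        using P0 P1 PI_diff[OF P0 PI_var[of l]] insert
        by (cases j; cases "j - 1") (simp_all add: coeff_pCons)
      moreover have "coeff (\<Prod>l\<in>I. [:- var l, 1 :: (nat \<Rightarrow> int) \<Rightarrow>\<^sub>0 'k:]) j \<in> PI" for j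
        using insert by auto
      ultimately show ?case
        unfolding prod.insert[OF insert.hyps] by (rule coeffs_PI_mult)
    qed
    then show ?thesis unfolding P_def using Suc assms(2) by auto
  qed
  then have "coeff F' j \<in> PI" for j
    unfolding F'_def coeff_add coeff_smult by (intro PI_add F PI_mult w)
  moreover have "coeff F' j = 0" if "j \<ge> Suc r" for j
    using that F(2)[of j] degP by (simp add: F'_def coeff_eq_0)
  moreover have "poly F' (var i) = f i" if "i \<in> {1..Suc r}" for i
  proof (cases "i = Suc r")
    case True
    have "poly P (var ?i) = (\<Prod>l\<in>{1..r}. var ?i - var l)"
      by (simp add: P_def poly_prod)
    then show ?thesis using True w(2) by (simp add: F'_def u_def algebra_simps)
  next
    case False
    then have i: "i \<in> {1..r}" using that by auto
    then have "poly P (var i) = 0"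
      unfolding P_def poly_prod by (intro prod_zero bexI[of _ i]) auto
    then show ?thesis using F(3)[OF i] by (simp add: F'_def)
  qed
  ultimately show ?case by blast
qed

end

subsection \<open>The staircase basis\<close>

text \<open>These are the exponents of Artin's monomials. The bound \<open>b i < int i\<close>
  reflects that the invariants of S_(i-1) are free over those of S_i on the powers of x_i with
  exponents 0 to i - 1.\<close>

definition stairs :: "nat \<Rightarrow> (nat \<Rightarrow> int) set" where
  "stairs k = {b. (\<forall>i\<in>{1..k}. 0 \<le> b i \<and> b i < int i) \<and> (\<forall>i. i \<notin> {1..k} \<longrightarrow> b i = 0)}"

abbreviation xm :: "(nat \<Rightarrow> int) \<Rightarrow> ((nat \<Rightarrow> int) \<Rightarrow>\<^sub>0 'k::comm_ring_1)" where
  "xm b \<equiv> single b 1"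

lemma xm_0 [simp]: "xm (\<lambda>_. 0) = 1"
  using single_one[where 'a = "nat \<Rightarrow> int"] by (simp only: zero_fun_def)

lemma stairs_0: "stairs 0 = {0}"
  by (auto simp: stairs_def fun_eq_iff)

lemma bij_stairs_Suc:
  "bij_betw (\<lambda>(b, j). b + put (Suc k) (int j)) (stairs k \<times> {..k}) (stairs (Suc k))"
proof (rule bij_betwI[where g = "\<lambda>c. (c(Suc k := 0), nat (c (Suc k)))"])
  show "(\<lambda>(b, j). b + put (Suc k) (int j)) \<in> stairs k \<times> {..k} \<rightarrow> stairs (Suc k)"
    by (auto simp: stairs_def put_def)
  show "(\<lambda>c. (c(Suc k := 0), nat (c (Suc k)))) \<in> stairs (Suc k) \<rightarrow> stairs k \<times> {..k}"
  proof
    fix c assume c: "c \<in> stairs (Suc k)"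
    then have "c (Suc k) < int (Suc k)"
      unfolding stairs_def by (auto dest!: bspec[of _ _ "Suc k"])
    then show "(c(Suc k := 0), nat (c (Suc k))) \<in> stairs k \<times> {..k}"
      using c by (auto simp: stairs_def)
  qed
  show "(\<lambda>c. (c(Suc k := 0), nat (c (Suc k)))) ((\<lambda>(b, j). b + put (Suc k) (int j)) x) = x"
    if "x \<in> stairs k \<times> {..k}" for x
    using that by (auto simp: stairs_def put_def fun_eq_iff)
  show "(\<lambda>(b, j). b + put (Suc k) (int j)) ((\<lambda>c. (c(Suc k := 0), nat (c (Suc k)))) c) = c"
    if "c \<in> stairs (Suc k)" for c
    using that by (auto simp: stairs_def put_def fun_eq_iff)
qed

lemma stairs_SucE:
  assumes "b \<in> stairs (Suc k)"
  obtains b' j where "b' \<in> stairs k" "j \<le> k" "b = b' + put (Suc k) (int j)"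
proof -
  have "b \<in> (\<lambda>(b, j). b + put (Suc k) (int j)) ` (stairs k \<times> {..k})"
    unfolding bij_betw_imp_surj_on[OF bij_stairs_Suc] by (rule assms)
  from this[unfolded image_iff]
  obtain x where x: "x \<in> stairs k \<times> {..k}" "b = (\<lambda>(b, j). b + put (Suc k) (int j)) x" ..
  show thesis
    using x(1) by (intro that[of "fst x" "snd x"]) (auto simp: x(2) case_prod_unfold)
qed

lemma finite_stairs: "finite (stairs k)"
proof (induction k)
  case (Suc k)
  then show ?case using bij_betw_finite[OF bij_stairs_Suc[of k]] by simp
qed (simp add: stairs_0)

lemma sum_stairs_Suc:
  fixes f :: "(nat \<Rightarrow> int) \<Rightarrow> 'c::comm_monoid_add"
  shows "(\<Sum>b\<in>stairs (Suc k). f b) = (\<Sum>b\<in>stairs k. \<Sum>j\<le>k. f (b + put (Suc k) (int j)))"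
proof -
  have "(\<Sum>b\<in>stairs (Suc k). f b) = (\<Sum>(b, j)\<in>stairs k \<times> {..k}. f (b + put (Suc k) (int j)))"
    using sum.reindex_bij_betw[OF bij_stairs_Suc, of f k] by (simp add: case_prod_unfold)
  then show ?thesis by (simp add: sum.cartesian_product)
qed

lemma xm_put: "xm (b + put i (int j)) = xm b * var i ^ j"
  by (simp only: var_power mult_single mult_1)

lemma fixed_mono: "fixed k f \<Longrightarrow> j \<le> k \<Longrightarrow> fixed j f"
  unfolding fixed_def by (metis atLeastatMost_subset_iff order_refl permutes_subset)

lemma fixed_0: "fixed k 0" and fixed_add: "fixed k f \<Longrightarrow> fixed k g \<Longrightarrow> fixed k (f + g)"
  and fixed_mult: "fixed k f \<Longrightarrow> fixed k g \<Longrightarrow> fixed k (f * g)"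
  and fixed_sc: "fixed k f \<Longrightarrow> fixed k (sc c f)"
  by (simp_all add: fixed_def permp_add permp_mult permp_sc)

lemma fixed_1: "fixed k 1"
  by (simp add: fixed_def)

lemma fixed_sum: "(\<And>i. i \<in> I \<Longrightarrow> fixed k (f i)) \<Longrightarrow> fixed k (\<Sum>i\<in>I. f i)"
  by (simp add: fixed_def permp_sum)

lemma fixed_var: "k < i \<Longrightarrow> fixed k (var i)"
  unfolding fixed_def by (auto simp: permp_var permutes_bij permutes_not_in)

lemma fixed_power: "fixed k f \<Longrightarrow> fixed k (f ^ j)"
  by (simp add: fixed_def permp_power)

lemma coeff_sum_monom: "coeff (\<Sum>j\<le>k. monom (d j) j) i = (if i \<le> k then d i else 0)"
  by (auto simp: coeff_sum)

lemma poly_sum_monom: "poly (\<Sum>j\<le>k. monom (d j) j) x = (\<Sum>j\<le>k. d j * x ^ j)"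
  for x :: "'c::comm_ring_1"
  by (simp add: poly_sum poly_monom)

text \<open>Transpositions fix the coefficients and move x_(k+1) to every x_i with i <= k + 1. So
  the polynomial with coefficients d_j has k + 1 roots but degree at most k.\<close>

lemma vandermonde:
  fixes d :: "nat \<Rightarrow> ((nat \<Rightarrow> int) \<Rightarrow>\<^sub>0 'k::comm_ring_1)"
  assumes "\<And>j. j \<le> k \<Longrightarrow> fixed (Suc k) (d j)" "(\<Sum>j\<le>k. d j * var (Suc k) ^ j) = 0" "j \<le> k"
  shows "d j = 0"
proof -
  have "(\<Sum>j\<le>k. monom (d j) j) = 0"
  proof (rule poly_eq_0_if_many_roots[where I = "{1..Suc k}"])
    fix i assume i: "i \<in> {1..Suc k}"
    then have \<pi>: "transpose i (Suc k) permutes {1..Suc k}"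
      by (intro permutes_swap_id) auto
    have "(\<Sum>j\<le>k. d j * var i ^ j) = permp (transpose i (Suc k)) (\<Sum>j\<le>k. d j * var (Suc k) ^ j)"
      unfolding permp_sum
    proof (rule sum.cong)
      fix j assume "j \<in> {..k}"
      then have "permp (transpose i (Suc k)) (d j) = d j"
        using assms(1) \<pi> by (auto simp: fixed_def)
      then show "d j * var i ^ j = permp (transpose i (Suc k)) (d j * var (Suc k) ^ j)"
        by (simp add: permp_mult permp_power permp_var)
    qed simp
    then show "poly (\<Sum>j\<le>k. monom (d j) j) (var i) = 0"
      by (simp only: assms(2) permp_0 poly_sum_monom)
  qed (auto simp: coeff_sum_monom)
  then show ?thesis
    using coeff_sum_monom[of d k j] assms(3) by simp
qed

text \<open>Grouping by powers of the last variable leaves coefficients fixed by S_k, as x_(k+1)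
  itself is fixed by S_k. The induction hypothesis kills each group, and \<open>vandermonde\<close>
  then kills its terms.\<close>

lemma stairs_independent:
  fixes c :: "(nat \<Rightarrow> int) \<Rightarrow> ((nat \<Rightarrow> int) \<Rightarrow>\<^sub>0 'k::comm_ring_1)"
  assumes "\<And>b. b \<in> stairs k \<Longrightarrow> fixed k (c b)" "(\<Sum>b\<in>stairs k. c b * xm b) = 0" "b \<in> stairs k"
  shows "c b = 0"
  using assms
proof (induction k arbitrary: c b)
  case 0
  then show ?case by (simp add: stairs_0)
next
  case (Suc k)
  have mem: "b + put (Suc k) (int j) \<in> stairs (Suc k)" if "b \<in> stairs k" "j \<le> k" for b j
    using that bij_betwE[OF bij_stairs_Suc[of k]] by auto
  let ?c = "\<lambda>b. \<Sum>j\<le>k. c (b + put (Suc k) (int j)) * var (Suc k) ^ j"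
  have "?c b = 0" if "b \<in> stairs k" for b
  proof (rule Suc.IH[of ?c])
    show "fixed k (?c b)" if "b \<in> stairs k" for b
      by (intro fixed_sum fixed_mult fixed_power fixed_var fixed_mono[OF Suc.prems(1)[OF mem[OF that]]]) auto
    show "(\<Sum>b\<in>stairs k. ?c b * xm b) = 0"
      using Suc.prems(2) unfolding sum_stairs_Suc xm_put
      by (simp add: sum_distrib_left sum_distrib_right mult_ac)
  qed fact
  then have zero: "?c b = 0" if "b \<in> stairs k" for b
    using that .
  have "c (b + put (Suc k) (int j)) = 0" if "b \<in> stairs k" "j \<le> k" for b j
  proof (rule vandermonde[of k "\<lambda>j. c (b + put (Suc k) (int j))"])
    show "fixed (Suc k) (c (b + put (Suc k) (int i)))" if "i \<le> k" for i
      by (rule Suc.prems(1)[OF mem[OF \<open>b \<in> stairs k\<close> that]])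
  qed (use that zero in auto)
  then show ?case
    using Suc.prems(3) by (auto elim!: stairs_SucE)
qed

context lpoly_data
begin

text \<open>
  If \<open>F\<close> is the interpolation polynomial whose values at \<open>x\<^sub>1, \<dots>, x\<^sub>k\<^sub>+\<^sub>1\<close> are the conjugates of \<open>f\<close>
  under the transpositions \<open>(i, k + 1)\<close>, then \<open>f\<close> is its value at \<open>x\<^sub>k\<^sub>+\<^sub>1\<close>, and by uniqueness of
  interpolation its coefficients are fixed by \<open>S\<^sub>k\<^sub>+\<^sub>1\<close>.
\<close>
lemma split_off_var:
  fixes f :: "(nat \<Rightarrow> int) \<Rightarrow>\<^sub>0 'k::comm_ring_1"
  assumes f: "f \<in> PI" "fixed k f" and k: "Suc k \<le> n"
  shows "\<exists>d. (\<forall>j\<le>k. d j \<in> PI \<and> fixed (Suc k) (d j)) \<and> f = (\<Sum>j\<le>k. d j * var (Suc k) ^ j)"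
proof -
  define g where "g i = permp (transpose i (Suc k)) f" for i
  have perm: "permp \<pi> (g i) = g (\<pi> i)" if \<pi>: "\<pi> permutes {1..Suc k}" and i: "i \<in> {1..Suc k}" for \<pi> i
  proof -
    \<comment> \<open>This conjugate of sorts fixes k + 1, hence lies in S_k and fixes f. It
      measures how \<pi> differs from the chosen coset representatives, so that \<pi> simply
      permutes the conjugates \<open>g i\<close>.\<close>
    define \<rho> where "\<rho> = transpose (\<pi> i) (Suc k) \<circ> \<pi> \<circ> transpose i (Suc k)"
    have \<pi>i: "\<pi> i \<in> {1..Suc k}" using permutes_in_image[OF \<pi>] i by blast
    have "\<rho> permutes {1..Suc k}"
      unfolding \<rho>_def using i \<pi>i by (intro permutes_compose \<pi> permutes_swap_id) auto
    moreover have "\<rho> x = x" if "x \<in> {1..Suc k} - {1..k}" for x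
    proof -
      have "x = Suc k" using that by auto
      then show ?thesis by (simp add: \<rho>_def)
    qed
    ultimately have "\<rho> permutes {1..k}" by (rule permutes_superset)
    then have "permp \<rho> f = f" using f(2) by (simp add: fixed_def)
    then have "g (\<pi> i) = permp (transpose (\<pi> i) (Suc k)) (permp \<rho> f)"
      by (simp add: g_def)
    also have "\<dots> = permp (transpose (\<pi> i) (Suc k) \<circ> \<rho>) f"
      by (rule permp_permp[OF bij_transpose permutes_bij[OF \<open>\<rho> permutes {1..k}\<close>]])
    also have "transpose (\<pi> i) (Suc k) \<circ> \<rho> = \<pi> \<circ> transpose i (Suc k)"
      by (simp add: \<rho>_def fun_eq_iff)
    also have "permp (\<pi> \<circ> transpose i (Suc k)) f = permp \<pi> (g i)"
      unfolding g_def by (rule permp_permp[OF permutes_bij[OF \<pi>] bij_transpose, symmetric])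
    finally show ?thesis by simp
  qed
  have "\<exists>F. (\<forall>j. coeff F j \<in> PI) \<and> (\<forall>j\<ge>Suc k. coeff F j = 0) \<and> (\<forall>i\<in>{1..Suc k}. poly F (var i) = g i)"
  proof (rule interpolation[OF order_refl k])
    fix i assume i: "i \<in> {1..Suc k}"
    then have "transpose i (Suc k) permutes {1..n}"
      using k by (intro permutes_swap_id) auto
    then show "g i \<in> PI" unfolding g_def by (rule PI_permp[OF _ f(1)])
    fix l assume l: "l \<in> {1..Suc k}" "i \<noteq> l"
    have "permp (transpose i l) (g i) = g l"
      using perm[of "transpose i l" i] i l by (simp add: permutes_swap_id)
    then show "subst l i (g l) = subst l i (g i)"
      using subst_transpose[OF l(2), of "g i"] by simp
  qed
  then obtain F where F: "\<forall>j. coeff F j \<in> PI" "\<forall>j\<ge>Suc k. coeff F j = 0"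
    "\<forall>i\<in>{1..Suc k}. poly F (var i) = g i" by blast
  have map_eq: "map_poly (permp \<pi>) F = F" if \<pi>: "\<pi> permutes {1..Suc k}" for \<pi>
  proof -
    have "map_poly (permp \<pi>) F - F = 0"
    proof (rule poly_eq_0_if_many_roots[where I = "{1..Suc k}"])
      fix i assume "i \<in> {1..Suc k}"
      then obtain l where l: "l \<in> {1..Suc k}" "i = \<pi> l"
        using permutes_image[OF \<pi>] by blast
      have "poly (map_poly (permp \<pi>) F) (var i) = permp \<pi> (poly F (var l))"
        using poly_map_poly_hom[of "permp \<pi>", OF permp_0 permp_add permp_mult, of F "var l"]
        by (simp add: permp_var[OF permutes_bij[OF \<pi>]] l(2))
      also have "\<dots> = g i"
        using F(3) l perm[OF \<pi> l(1)] by simp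
      also have "\<dots> = poly F (var i)"
        using F(3) \<open>i \<in> {1..Suc k}\<close> by simp
      finally show "poly (map_poly (permp \<pi>) F - F) (var i) = 0" by simp
    qed (use F(2) in \<open>simp_all add: coeff_map_poly\<close>)
    then show ?thesis by simp
  qed
  have "permp \<pi> (coeff F j) = coeff F j" if "\<pi> permutes {1..Suc k}" for \<pi> j
    using coeff_map_poly[of "permp \<pi>", OF permp_0, of F j] unfolding map_eq[OF that] by (rule sym)
  then have coeff: "coeff F j \<in> PI \<and> fixed (Suc k) (coeff F j)" for j
    unfolding fixed_def using F(1) by blast
  have feq: "f = (\<Sum>j\<le>k. coeff F j * var (Suc k) ^ j)"
  proof -
    have eq: "F = (\<Sum>j\<le>k. monom (coeff F j) j)"
    proof (rule poly_eqI)
      show "coeff F j = coeff (\<Sum>j\<le>k. monom (coeff F j) j) j" for j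
        unfolding coeff_sum_monom using F(2) by (cases "j \<le> k") simp_all
    qed
    have "poly F (var (Suc k)) = (\<Sum>j\<le>k. coeff F j * var (Suc k) ^ j)"
      using arg_cong[OF eq, of "\<lambda>G. poly G (var (Suc k))"] unfolding poly_sum_monom .
    then show ?thesis using F(3) by (simp add: g_def)
  qed
  show ?thesis
    by (intro exI[of _ "coeff F"] conjI[OF _ feq] allI impI coeff)
qed

text \<open>Each step of the tower expands coefficients fixed by S_k in powers of x_(k+1) with
  coefficients fixed by S_(k+1), by \<open>split_off_var\<close>.\<close>

lemma stairs_span:
  fixes f :: "(nat \<Rightarrow> int) \<Rightarrow>\<^sub>0 'k::comm_ring_1"
  assumes "f \<in> PI" "k \<le> n"
  shows "\<exists>c. (\<forall>b\<in>stairs k. c b \<in> PI \<and> fixed k (c b)) \<and> f = (\<Sum>b\<in>stairs k. c b * xm b)"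
  using assms(2)
proof (induction k)
  case 0
  have "fixed 0 f" by (simp add: fixed_def)
  then show ?case using assms(1) by (intro exI[of _ "\<lambda>_. f"]) (simp add: stairs_0)
next
  case (Suc k)
  from Suc.IH[OF Suc_leD[OF Suc.prems]]
  obtain c where c: "\<forall>b\<in>stairs k. c b \<in> PI \<and> fixed k (c b)" "f = (\<Sum>b\<in>stairs k. c b * xm b)"
    by (elim exE conjE)
  have "\<forall>b\<in>stairs k. \<exists>d. (\<forall>j\<le>k. d j \<in> PI \<and> fixed (Suc k) (d j)) \<and> c b = (\<Sum>j\<le>k. d j * var (Suc k) ^ j)"
  proof
    fix b assume "b \<in> stairs k"
    with c(1) have "c b \<in> PI" "fixed k (c b)" by auto
    then show "\<exists>d. (\<forall>j\<le>k. d j \<in> PI \<and> fixed (Suc k) (d j)) \<and> c b = (\<Sum>j\<le>k. d j * var (Suc k) ^ j)"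
      by (rule split_off_var[OF _ _ Suc.prems])
  qed
  from bchoice[OF this] obtain d where "\<forall>b\<in>stairs k. (\<forall>j\<le>k. d b j \<in> PI \<and> fixed (Suc k) (d b j)) \<and>
      c b = (\<Sum>j\<le>k. d b j * var (Suc k) ^ j)" by (elim exE)
  then have d: "b \<in> stairs k \<Longrightarrow> j \<le> k \<Longrightarrow> d b j \<in> PI \<and> fixed (Suc k) (d b j)"
    "b \<in> stairs k \<Longrightarrow> c b = (\<Sum>j\<le>k. d b j * var (Suc k) ^ j)" for b j
    by blast+
  define e where "e b = d (b(Suc k := 0)) (nat (b (Suc k)))" for b
  have e: "e (b + put (Suc k) (int j)) = d b j" if "b \<in> stairs k" for b j
  proof -
    have "(b + put (Suc k) (int j))(Suc k := 0) = b"
      using that by (auto simp: stairs_def put_def fun_eq_iff)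
    moreover have "(b + put (Suc k) (int j)) (Suc k) = int j"
      using that by (simp add: stairs_def put_def)
    ultimately show ?thesis by (simp only: e_def nat_int)
  qed
  have "f = (\<Sum>b\<in>stairs (Suc k). e b * xm b)"
    unfolding sum_stairs_Suc xm_put c(2)
  proof (intro sum.cong refl)
    fix b assume b: "b \<in> stairs k"
    show "c b * xm b = (\<Sum>j\<le>k. e (b + put (Suc k) (int j)) * (xm b * var (Suc k) ^ j))"
      unfolding d(2)[OF b] e[OF b] sum_distrib_right by (intro sum.cong refl) (simp only: mult_ac)
  qed
  moreover have "e b \<in> PI \<and> fixed (Suc k) (e b)" if "b \<in> stairs (Suc k)" for b
  proof -
    obtain b' j where "b' \<in> stairs k" "j \<le> k" "b = b' + put (Suc k) (int j)"
      using \<open>b \<in> stairs (Suc k)\<close> by (rule stairs_SucE)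
    then show ?thesis using e[of b' j] d(1)[of b' j] by (simp only:)
  qed
  ultimately show ?case by blast
qed

end

subsection \<open>A basis with a stable linear span\<close>

text \<open>The polynomial ring is singled out whichever base ring is meant: the stable basis is
  constructed here and reused for Laurent polynomials in \<open>sbasis_span\<close>.\<close>

definition PP :: "nat \<Rightarrow> ((nat \<Rightarrow> int) \<Rightarrow>\<^sub>0 'k::comm_ring_1) set" where
  "PP n = {f. keys f \<subseteq> mono_set n {0..}}"

lemma lpoly_nonneg: "lpoly_data {0..}"
  by unfold_locales simp

lemmas PP_closed =
  lpoly_data.PI_0[OF lpoly_nonneg, folded PP_def] lpoly_data.PI_add[OF lpoly_nonneg, folded PP_def]
  lpoly_data.PI_diff[OF lpoly_nonneg, folded PP_def] lpoly_data.PI_sc[OF lpoly_nonneg, folded PP_def]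
  lpoly_data.PI_mult[OF lpoly_nonneg, folded PP_def] lpoly_data.PI_1[OF lpoly_nonneg, folded PP_def]
  lpoly_data.PI_permp[OF lpoly_nonneg, folded PP_def]

lemmas PP_sum = lpoly_data.PI_sum[OF lpoly_nonneg, folded PP_def]

lemma xm_PP: "b \<in> stairs n \<Longrightarrow> xm b \<in> PP n"
  by (auto simp: PP_def stairs_def mono_set_def)

section \<open>Coordinates with respect to the staircase monomials\<close>

definition coord :: "nat \<Rightarrow> ((nat \<Rightarrow> int) \<Rightarrow>\<^sub>0 'k::comm_ring_1) \<Rightarrow> (nat \<Rightarrow> int) \<Rightarrow> ((nat \<Rightarrow> int) \<Rightarrow>\<^sub>0 'k)" where
  "coord n f = (SOME c. (\<forall>b\<in>stairs n. c b \<in> PP n \<and> fixed n (c b)) \<and> f = (\<Sum>b\<in>stairs n. c b * xm b))"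

lemma coord:
  assumes "f \<in> PP n"
  shows "b \<in> stairs n \<Longrightarrow> coord n f b \<in> PP n" "b \<in> stairs n \<Longrightarrow> fixed n (coord n f b)"
    "f = (\<Sum>b\<in>stairs n. coord n f b * xm b)"
proof -
  have "\<exists>c. (\<forall>b\<in>stairs n. c b \<in> PP n \<and> fixed n (c b)) \<and> f = (\<Sum>b\<in>stairs n. c b * xm b)"
    using lpoly_data.stairs_span[OF lpoly_nonneg, folded PP_def] assms by blast
  from someI_ex[OF this] have *: "(\<forall>b\<in>stairs n. coord n f b \<in> PP n \<and> fixed n (coord n f b)) \<and>
      f = (\<Sum>b\<in>stairs n. coord n f b * xm b)"
    unfolding coord_def .
  then show "b \<in> stairs n \<Longrightarrow> coord n f b \<in> PP n" "b \<in> stairs n \<Longrightarrow> fixed n (coord n f b)" by blast+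
  from * show "f = (\<Sum>b\<in>stairs n. coord n f b * xm b)" by (rule conjunct2)
qed

lemma fixed_diff: "fixed k f \<Longrightarrow> fixed k g \<Longrightarrow> fixed k (f - g)"
  by (simp add: fixed_def permp_diff)

lemma coord_unique:
  assumes "f \<in> PP n" "\<And>b. b \<in> stairs n \<Longrightarrow> fixed n (c b)" "f = (\<Sum>b\<in>stairs n. c b * xm b)" "b \<in> stairs n"
  shows "coord n f b = c b"
proof -
  have "coord n f b - c b = 0"
  proof (rule stairs_independent[of n "\<lambda>b. coord n f b - c b"])
    show "fixed n (coord n f b - c b)" if "b \<in> stairs n" for b
      using coord(2)[OF assms(1) that] assms(2)[OF that] by (rule fixed_diff)
    have "(\<Sum>b\<in>stairs n. (coord n f b - c b) * xm b) = f - f"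
      unfolding left_diff_distrib sum_subtractf
      using coord(3)[OF assms(1)] assms(3) by (rule arg_cong2[of _ _ _ _ minus, OF sym sym])
    then show "(\<Sum>b\<in>stairs n. (coord n f b - c b) * xm b) = 0" by simp
  qed (rule assms(4))
  then show ?thesis by simp
qed

section \<open>Reduction modulo the symmetric polynomials without constant term\<close>

abbreviation cst :: "((nat \<Rightarrow> int) \<Rightarrow>\<^sub>0 'k::comm_ring_1) \<Rightarrow> 'k" where
  "cst f \<equiv> lookup f 0"

text \<open>With nonnegative exponents a product of two monomials is constant only if both are. For
  Laurent polynomials this fails, as a variable times its inverse shows.\<close>

lemma cst_mult:
  assumes "f \<in> PP n" "g \<in> PP n"
  shows "cst (f * g) = cst f * cst g"
proof -
  have add_0: "\<gamma> + \<delta> = 0 \<longleftrightarrow> \<gamma> = 0 \<and> \<delta> = 0" if \<gamma>: "\<gamma> \<in> mono_set n {0..}" and \<delta>: "\<delta> \<in> mono_set n {0..}"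
    for \<gamma> \<delta> :: "nat \<Rightarrow> int"
  proof
    assume *: "\<gamma> + \<delta> = 0"
    have "\<gamma> i = 0 \<and> \<delta> i = 0" for i
    proof -
      have "\<gamma> i \<ge> 0" "\<delta> i \<ge> 0" using \<gamma> \<delta> by (cases "i \<in> {1..n}"; auto simp: mono_set_def)+
      moreover have "\<gamma> i + \<delta> i = 0" using fun_cong[OF *, of i] by simp
      ultimately show ?thesis by linarith
    qed
    then show "\<gamma> = 0 \<and> \<delta> = 0" by (auto simp: fun_eq_iff)
  qed simp
  have f: "keys f \<subseteq> mono_set n {0..}" and g: "keys g \<subseteq> mono_set n {0..}"
    using assms by (auto simp: PP_def)
  show ?thesis
    using f
  proof (induction f rule: poly_mapping_induct_on)
    case (sgl \<gamma> c)
    show ?case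
      using g
    proof (induction g rule: poly_mapping_induct_on)
      case (sgl \<delta> d)
      then show ?case
        using add_0[OF \<open>\<gamma> \<in> mono_set n {0..}\<close> sgl] by (simp only: mult_single lookup_single when_def) simp
    qed (simp_all add: distrib_left lookup_add)
  qed (simp_all add: distrib_right lookup_add)
qed

text \<open>The projection onto the span of the staircase monomials whose kernel is the ideal
  generated by the symmetric polynomials without constant term. Its image is a model of the
  coinvariant algebra.\<close>

definition cproj :: "nat \<Rightarrow> ((nat \<Rightarrow> int) \<Rightarrow>\<^sub>0 'k::comm_ring_1) \<Rightarrow> ((nat \<Rightarrow> int) \<Rightarrow>\<^sub>0 'k)" where
  "cproj n f = (\<Sum>b\<in>stairs n. sc (cst (coord n f b)) (xm b))"

lemma coord_add:
  assumes "f \<in> PP n" "g \<in> PP n" "b \<in> stairs n"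
  shows "coord n (f + g) b = coord n f b + coord n g b"
  using assms(3)
proof (rule coord_unique[rotated -1])
  show "f + g = (\<Sum>b\<in>stairs n. (coord n f b + coord n g b) * xm b)"
    unfolding distrib_right sum.distrib
    using coord(3)[OF assms(1)] coord(3)[OF assms(2)] by (rule arg_cong2)
qed (intro PP_closed fixed_add coord assms; assumption)+

lemma coord_mult:
  assumes "h \<in> PP n" "fixed n h" "f \<in> PP n" "b \<in> stairs n"
  shows "coord n (h * f) b = h * coord n f b"
  using assms(4)
proof (rule coord_unique[rotated -1])
  have "h * f = h * (\<Sum>b\<in>stairs n. coord n f b * xm b)"
    using coord(3)[OF assms(3)] by (rule arg_cong)
  then show "h * f = (\<Sum>b\<in>stairs n. h * coord n f b * xm b)"
    by (simp only: sum_distrib_left mult.assoc)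
qed (intro PP_closed fixed_mult coord assms; assumption)+

lemma cproj_PP: "f \<in> PP n \<Longrightarrow> cproj n f \<in> PP n"
  unfolding cproj_def by (intro PP_sum PP_closed xm_PP)

lemma cproj_add: "f \<in> PP n \<Longrightarrow> g \<in> PP n \<Longrightarrow> cproj n (f + g) = cproj n f + cproj n g"
  unfolding cproj_def sum.distrib[symmetric]
  by (intro sum.cong refl) (simp add: coord_add lookup_add single_add)

lemma cproj_mult:
  assumes "h \<in> PP n" "fixed n h" "f \<in> PP n"
  shows "cproj n (h * f) = sc (cst h) (cproj n f)"
  unfolding cproj_def sc_sum
proof (rule sum.cong[OF refl])
  fix b assume b: "b \<in> stairs n"
  show "sc (cst (coord n (h * f) b)) (xm b) = sc (cst h) (sc (cst (coord n f b)) (xm b))"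
    using coord_mult[OF assms b] cst_mult[OF assms(1) coord(1)[OF assms(3) b]] by simp
qed

lemma sc_1_PP: "sc c 1 \<in> PP n" "fixed n (sc c 1)" "cst (sc c 1) = c"
  by (intro PP_closed, intro fixed_sc fixed_1, simp)

lemma cproj_sc: "f \<in> PP n \<Longrightarrow> cproj n (sc c f) = sc c (cproj n f)"
  using cproj_mult[OF sc_1_PP(1,2), of f n c] by (simp add: sc_mult_left)

lemma cproj_0 [simp]: "cproj n 0 = 0"
  using cproj_sc[OF PP_closed(1), of n 0] by simp

lemma cproj_sum:
  "(\<And>i. i \<in> I \<Longrightarrow> f i \<in> PP n) \<Longrightarrow> cproj n (\<Sum>i\<in>I. f i) = (\<Sum>i\<in>I. cproj n (f i))"
  by (induction I rule: infinite_finite_induct) (simp_all add: cproj_add PP_sum)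

lemma lookup_cproj:
  assumes "b \<in> stairs n"
  shows "lookup (cproj n f) b = cst (coord n f b)"
proof -
  have "lookup (cproj n f) b = (\<Sum>b'\<in>stairs n. if b' = b then cst (coord n f b) else 0)"
    unfolding cproj_def lookup_sum
    by (intro sum.cong refl) (simp only: lookup_sc lookup_single when_def, simp)
  then show ?thesis using assms by (simp add: finite_stairs)
qed

text \<open>The kernel of \<open>cproj\<close> is stable under permutations: \<pi> leaves the
  symmetric coordinates alone, and under the outer projection they count only through their constant
  terms. So \<pi> acts on the quotient.\<close>

lemma cproj_permp:
  assumes \<pi>: "\<pi> permutes {1..n}" and f: "f \<in> PP n"
  shows "cproj n (permp \<pi> f) = cproj n (permp \<pi> (cproj n f))"
proof -
  have x: "permp \<pi> (xm b) \<in> PP n" if "b \<in> stairs n" for b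
    using that by (intro PP_closed(7)[OF \<pi>] xm_PP)
  have "permp \<pi> f = (\<Sum>b\<in>stairs n. coord n f b * permp \<pi> (xm b))"
  proof -
    have "permp \<pi> f = permp \<pi> (\<Sum>b\<in>stairs n. coord n f b * xm b)"
      using coord(3)[OF f] by (rule arg_cong)
    also have "\<dots> = (\<Sum>b\<in>stairs n. coord n f b * permp \<pi> (xm b))"
      unfolding permp_sum permp_mult
      using coord(2)[OF f] \<pi> by (intro sum.cong refl) (simp add: fixed_def)
    finally show ?thesis .
  qed
  then have "cproj n (permp \<pi> f) = (\<Sum>b\<in>stairs n. cproj n (coord n f b * permp \<pi> (xm b)))"
    by (simp only:) (intro cproj_sum PP_closed coord(1) f x)
  also have "\<dots> = (\<Sum>b\<in>stairs n. cproj n (sc (cst (coord n f b)) (permp \<pi> (xm b))))"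
    by (intro sum.cong refl) (simp add: cproj_mult cproj_sc coord(1,2)[OF f] x)
  also have "\<dots> = cproj n (\<Sum>b\<in>stairs n. sc (cst (coord n f b)) (permp \<pi> (xm b)))"
    by (intro cproj_sum[symmetric] PP_closed x)
  also have "(\<Sum>b\<in>stairs n. sc (cst (coord n f b)) (permp \<pi> (xm b))) = permp \<pi> (cproj n f)"
    unfolding cproj_def permp_sum permp_sc ..
  finally show ?thesis .
qed

section \<open>Averaging over the symmetric group\<close>

lemma sum_const_sc: "(\<Sum>x\<in>A. f) = sc (of_nat (card A)) f"
  by (induction A rule: infinite_finite_induct) (simp_all add: sc_add_left)

abbreviation perms :: "nat \<Rightarrow> (nat \<Rightarrow> nat) set" where
  "perms n \<equiv> {\<pi>. \<pi> permutes {1..n}}"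

lemma card_perms: "card (perms n) = fact n"
  by (rule card_permutations) simp_all

text \<open>Maschke's construction. \<open>cproj\<close> describes a linear section of the
  projection to the coinvariant quotient, and the mean of its conjugates is an equivariant one: it
  depends only on the class of f (\<open>avg_cproj\<close>), does not change that class
  (\<open>cproj_avg\<close>) and commutes with permutations (\<open>permp_avg\<close>). Division by
  n! uses characteristic zero.\<close>

definition avg :: "nat \<Rightarrow> ((nat \<Rightarrow> int) \<Rightarrow>\<^sub>0 'k::field_char_0) \<Rightarrow> ((nat \<Rightarrow> int) \<Rightarrow>\<^sub>0 'k)" where
  "avg n f = sc (inverse (fact n)) (\<Sum>\<pi>\<in>perms n. permp \<pi> (cproj n (permp (inv_into UNIV \<pi>) f)))"

lemma perms_term_PP:
  "f \<in> PP n \<Longrightarrow> \<pi> \<in> perms n \<Longrightarrow> permp \<pi> (cproj n (permp (inv_into UNIV \<pi>) f)) \<in> PP n"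
  by (intro PP_closed cproj_PP) (auto intro: permutes_inv)

lemma avg_PP: "f \<in> PP n \<Longrightarrow> avg n f \<in> PP n"
  unfolding avg_def by (intro PP_closed(4) PP_sum perms_term_PP)

lemma avg_cproj: "f \<in> PP n \<Longrightarrow> avg n (cproj n f) = avg n f"
  unfolding avg_def by (simp add: cproj_permp[symmetric] permutes_inv cong: sum.cong_simp)

text \<open>By \<open>cproj_permp\<close> the inner projection may be dropped below the outer one,
  so each of the n! summands reduces to the same element.\<close>

lemma cproj_avg:
  assumes f: "f \<in> PP n"
  shows "cproj n (avg n f) = cproj n f"
proof -
  have "cproj n (permp \<pi> (cproj n (permp (inv_into UNIV \<pi>) f))) = cproj n f" if "\<pi> \<in> perms n" for \<pi>
  proof -
    have \<pi>: "\<pi> permutes {1..n}" using that by simp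
    have "cproj n (permp \<pi> (cproj n (permp (inv_into UNIV \<pi>) f))) = cproj n (permp \<pi> (permp (inv_into UNIV \<pi>) f))"
      by (rule cproj_permp[symmetric, OF \<pi> PP_closed(7)[OF permutes_inv[OF \<pi>] f]])
    also have "permp \<pi> (permp (inv_into UNIV \<pi>) f) = f"
      using permp_permp[OF permutes_bij[OF \<pi>] permutes_bij[OF permutes_inv[OF \<pi>]], of f]
      by (simp add: permutes_inv_o[OF \<pi>])
    finally show ?thesis .
  qed
  then have "(\<Sum>\<pi>\<in>perms n. cproj n (permp \<pi> (cproj n (permp (inv_into UNIV \<pi>) f)))) = (\<Sum>\<pi>\<in>perms n. cproj n f)"
    by (rule sum.cong[OF refl])
  also have "\<dots> = sc (fact n) (cproj n f)"
    unfolding sum_const_sc card_perms of_nat_fact ..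
  finally have "(\<Sum>\<pi>\<in>perms n. cproj n (permp \<pi> (cproj n (permp (inv_into UNIV \<pi>) f)))) = sc (fact n) (cproj n f)" .
  moreover have "cproj n (avg n f) = sc (inverse (fact n))
      (\<Sum>\<pi>\<in>perms n. cproj n (permp \<pi> (cproj n (permp (inv_into UNIV \<pi>) f))))"
    unfolding avg_def by (simp only: cproj_sc[OF PP_sum[OF perms_term_PP[OF f]]] cproj_sum[OF perms_term_PP[OF f]])
  ultimately show ?thesis by simp
qed

text \<open>Left translation \<pi> to \<tau> \<circ> \<pi> merely permutes the summands.\<close>

lemma permp_avg:
  assumes \<tau>: "\<tau> permutes {1..n}"
  shows "permp \<tau> (avg n f) = avg n (permp \<tau> f)"
proof -
  have "(\<Sum>\<pi>\<in>perms n. permp \<tau> (permp \<pi> (cproj n (permp (inv_into UNIV \<pi>) f))))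
      = (\<Sum>\<pi>\<in>perms n. permp \<pi> (cproj n (permp (inv_into UNIV \<pi>) (permp \<tau> f))))"
  proof (rule sum.reindex_bij_witness[where i = "\<lambda>\<pi>. inv_into UNIV \<tau> \<circ> \<pi>" and j = "\<lambda>\<pi>. \<tau> \<circ> \<pi>"])
    fix \<pi> assume "\<pi> \<in> perms n"
    then have \<pi>: "\<pi> permutes {1..n}" by simp
    show "inv_into UNIV \<tau> \<circ> (\<tau> \<circ> \<pi>) = \<pi>" "\<tau> \<circ> (inv_into UNIV \<tau> \<circ> \<pi>) = \<pi>"
      by (simp_all add: permutes_inv_o[OF \<tau>] flip: comp_assoc)
    show "\<tau> \<circ> \<pi> \<in> perms n" "inv_into UNIV \<tau> \<circ> \<pi> \<in> perms n"
      using permutes_compose[OF \<pi> \<tau>] permutes_compose[OF \<pi> permutes_inv[OF \<tau>]] by simp_all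
    note bij = permutes_bij[OF \<pi>] permutes_bij[OF \<tau>] permutes_bij[OF permutes_inv[OF \<pi>]]
      permutes_bij[OF permutes_inv[OF \<tau>]]
    have "permp (inv_into UNIV (\<tau> \<circ> \<pi>)) (permp \<tau> f) = permp (inv_into UNIV \<pi>) f"
      unfolding o_inv_distrib[OF bij(2,1)]
      using permp_permp[OF bij_comp[OF bij(4,3)] bij(2), of f]
      by (simp add: comp_assoc permutes_inv_o[OF \<tau>])
    then show "permp (\<tau> \<circ> \<pi>) (cproj n (permp (inv_into UNIV (\<tau> \<circ> \<pi>)) (permp \<tau> f)))
        = permp \<tau> (permp \<pi> (cproj n (permp (inv_into UNIV \<pi>) f)))"
      by (simp add: permp_permp[OF bij(2,1)])
  qed
  then show ?thesis by (simp add: avg_def permp_sc permp_sum)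
qed

definition sbasis :: "nat \<Rightarrow> (nat \<Rightarrow> int) \<Rightarrow> ((nat \<Rightarrow> int) \<Rightarrow>\<^sub>0 'k::field_char_0)" where
  "sbasis n b = avg n (xm b)"

lemma sbasis_PP: "b \<in> stairs n \<Longrightarrow> sbasis n b \<in> PP n"
  unfolding sbasis_def by (intro avg_PP xm_PP)

text \<open>By equivariance the image is the average of a permuted monomial, which depends only on
  the reduction of that monomial, that is, on a scalar combination of staircase monomials. The
  coefficients \<open>r\<close> are therefore scalars and not just symmetric polynomials.\<close>

lemma permp_sbasis:
  assumes "\<tau> permutes {1..n}" "b \<in> stairs n"
  shows "\<exists>r. permp \<tau> (sbasis n b :: _ \<Rightarrow>\<^sub>0 'k::field_char_0) = (\<Sum>b'\<in>stairs n. sc (r b') (sbasis n b'))"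
proof -
  have x: "permp \<tau> (xm b) \<in> PP n" using assms by (intro PP_closed xm_PP)
  have avg_add: "avg n (f + g) = avg n f + avg n g" if "f \<in> PP n" "g \<in> PP n" for f g :: "_ \<Rightarrow>\<^sub>0 'k"
    using that by (simp add: avg_def permp_add cproj_add PP_closed permutes_inv sum.distrib sc_add_right cong: sum.cong_simp)
  have avg_sc: "avg n (sc c f) = sc c (avg n f)" if "f \<in> PP n" for f :: "_ \<Rightarrow>\<^sub>0 'k" and c
    using that by (simp add: avg_def permp_sc cproj_sc PP_closed permutes_inv sc_sum mult.commute cong: sum.cong_simp)
  have avg_sum: "avg n (\<Sum>i\<in>I. f i) = (\<Sum>i\<in>I. avg n (f i))" if "\<And>i. i \<in> I \<Longrightarrow> f i \<in> PP n"
    for I and f :: "(nat \<Rightarrow> int) \<Rightarrow> _ \<Rightarrow>\<^sub>0 'k"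
    using that
  proof (induction I rule: infinite_finite_induct)
    case (insert i I)
    then show ?case by (simp add: avg_add PP_sum)
  qed (use avg_sc[OF PP_closed(1), of 0] in simp_all)
  have "permp \<tau> (sbasis n b :: _ \<Rightarrow>\<^sub>0 'k) = avg n (cproj n (permp \<tau> (xm b)))"
    unfolding sbasis_def permp_avg[OF assms(1)] avg_cproj[OF x] ..
  also have "\<dots> = (\<Sum>b'\<in>stairs n. avg n (sc (cst (coord n (permp \<tau> (xm b)) b')) (xm b')))"
    unfolding cproj_def by (intro avg_sum PP_closed(4) xm_PP)
  also have "\<dots> = (\<Sum>b'\<in>stairs n. sc (cst (coord n (permp \<tau> (xm b)) b')) (sbasis n b'))"
    unfolding sbasis_def by (intro sum.cong refl avg_sc xm_PP)
  finally show ?thesis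
    by (intro exI[of _ "\<lambda>b'. cst (coord n (permp \<tau> (xm b)) b')"])
qed

section \<open>Total degree and triangularity\<close>

definition mdeg :: "nat \<Rightarrow> (nat \<Rightarrow> int) \<Rightarrow> int" where
  "mdeg n \<gamma> = (\<Sum>i\<in>{1..n}. \<gamma> i)"

lemma mdeg_add: "mdeg n (\<gamma> + \<delta>) = mdeg n \<gamma> + mdeg n \<delta>"
  by (simp add: mdeg_def sum.distrib)

lemma mdeg_perm: "\<pi> permutes {1..n} \<Longrightarrow> mdeg n (\<gamma> \<circ> inv_into UNIV \<pi>) = mdeg n \<gamma>"
  unfolding mdeg_def using sum.permute[OF permutes_inv, of \<pi> "{1..n}" \<gamma>] by (simp add: comp_def)

definition hcomp :: "nat \<Rightarrow> int \<Rightarrow> ((nat \<Rightarrow> int) \<Rightarrow>\<^sub>0 'k::comm_ring_1) \<Rightarrow> ((nat \<Rightarrow> int) \<Rightarrow>\<^sub>0 'k)" where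
  "hcomp n d = lin_ext (\<lambda>\<gamma>. if mdeg n \<gamma> = d then single \<gamma> 1 else 0)"

lemma hcomp_single: "hcomp n d (single \<gamma> c) = (if mdeg n \<gamma> = d then single \<gamma> c else 0)"
  by (simp add: hcomp_def)

lemma hcomp_add: "hcomp n d (f + g) = hcomp n d f + hcomp n d g"
  and hcomp_diff: "hcomp n d (f - g) = hcomp n d f - hcomp n d g"
  and hcomp_sc: "hcomp n d (sc c f) = sc c (hcomp n d f)"
  and hcomp_sum: "hcomp n d (\<Sum>i\<in>I. F i) = (\<Sum>i\<in>I. hcomp n d (F i))"
  and hcomp_0 [simp]: "hcomp n d 0 = 0"
  by (simp_all add: hcomp_def lin_ext_add lin_ext_diff lin_ext_sc lin_ext_sum)

lemma lookup_hcomp: "lookup (hcomp n d f) \<gamma> = (if mdeg n \<gamma> = d then lookup f \<gamma> else 0)"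
proof -
  have "keys f \<subseteq> UNIV" by simp
  then show ?thesis
    by (induction f rule: poly_mapping_induct_on)
      (auto simp: hcomp_single hcomp_add lookup_add lookup_single when_def)
qed

lemma hcomp_mult_xm: "hcomp n d (f * xm b) = hcomp n (d - mdeg n b) f * xm b"
proof -
  have "keys f \<subseteq> UNIV" by simp
  then show ?thesis
  proof (induction f rule: poly_mapping_induct_on)
    case (sgl \<gamma> c)
    show ?case
      unfolding mult_single hcomp_single mdeg_add by (cases "mdeg n \<gamma> = d - mdeg n b") (auto simp: mult_single)
  qed (simp_all add: hcomp_add distrib_right)
qed

lemma hcomp_permp:
  assumes "\<pi> permutes {1..n}"
  shows "hcomp n d (permp \<pi> f) = permp \<pi> (hcomp n d f)"
proof -
  have "keys f \<subseteq> UNIV" by simp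
  then show ?thesis
    by (induction f rule: poly_mapping_induct_on)
      (simp_all add: permp_single hcomp_single mdeg_perm[OF assms] hcomp_add permp_add)
qed

lemma hcomp_fixed: "fixed n f \<Longrightarrow> fixed n (hcomp n d f)"
  unfolding fixed_def by (auto simp: hcomp_permp[symmetric])

text \<open>Homogeneous components of the coordinates, shifted by the degree of the monomial, are
  again coordinates of the homogeneous f, so uniqueness applies.\<close>

lemma hcomp_coord:
  assumes "f \<in> PP n" "hcomp n d f = f" "b \<in> stairs n"
  shows "hcomp n (d - mdeg n b) (coord n f b) = coord n f b"
proof (rule coord_unique[symmetric, OF assms(1) _ _ assms(3)])
  show "fixed n (hcomp n (d - mdeg n b) (coord n f b))" if "b \<in> stairs n" for b
    by (rule hcomp_fixed[OF coord(2)[OF assms(1) that]])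
  have "hcomp n d f = hcomp n d (\<Sum>b\<in>stairs n. coord n f b * xm b)"
    using coord(3)[OF assms(1)] by (rule arg_cong)
  then show "f = (\<Sum>b\<in>stairs n. hcomp n (d - mdeg n b) (coord n f b) * xm b)"
    by (simp only: assms(2) hcomp_sum hcomp_mult_xm)
qed

text \<open>A homogeneous coordinate has a nonzero constant term only in degree 0, so only staircase
  monomials of degree d survive the reduction.\<close>

lemma hcomp_cproj:
  assumes "f \<in> PP n" "hcomp n d f = f"
  shows "hcomp n d (cproj n f) = cproj n f"
  unfolding cproj_def hcomp_sum hcomp_sc
proof (rule sum.cong[OF refl])
  fix b assume b: "b \<in> stairs n"
  have "cst (coord n f b) = lookup (hcomp n (d - mdeg n b) (coord n f b)) 0"
    by (simp only: hcomp_coord[OF assms b])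
  also have "\<dots> = (if mdeg n b = d then cst (coord n f b) else 0)"
    by (simp add: lookup_hcomp mdeg_def)
  finally have "cst (coord n f b) = (if mdeg n b = d then cst (coord n f b) else 0)" .
  then show "sc (cst (coord n f b)) (hcomp n d (xm b)) = sc (cst (coord n f b)) (xm b)"
    by (cases "mdeg n b = d") (simp_all add: hcomp_single)
qed

lemma hcomp_sbasis:
  assumes b: "b \<in> stairs n"
  shows "hcomp n (mdeg n b) (sbasis n b) = (sbasis n b :: _ \<Rightarrow>\<^sub>0 'k::field_char_0)"
proof -
  let ?d = "mdeg n b"
  have "hcomp n ?d (permp \<pi> (cproj n (permp (inv_into UNIV \<pi>) (xm b)))) =
      permp \<pi> (cproj n (permp (inv_into UNIV \<pi>) (xm b :: _ \<Rightarrow>\<^sub>0 'k)))"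
    if "\<pi> \<in> perms n" for \<pi>
  proof -
    have \<pi>: "\<pi> permutes {1..n}" "inv_into UNIV \<pi> permutes {1..n}"
      using that by (auto intro: permutes_inv)
    have "hcomp n ?d (permp (inv_into UNIV \<pi>) (xm b)) = permp (inv_into UNIV \<pi>) (xm b :: _ \<Rightarrow>\<^sub>0 'k)"
      by (simp add: hcomp_permp[OF \<pi>(2)] hcomp_single)
    from hcomp_cproj[OF PP_closed(7)[OF \<pi>(2) xm_PP[OF b]] this] show ?thesis
      unfolding hcomp_permp[OF \<pi>(1)] by simp
  qed
  then show ?thesis
    unfolding sbasis_def avg_def hcomp_sc hcomp_sum by (intro arg_cong[where f = "sc _"] sum.cong refl)
qed

text \<open>
  The coordinates of \<open>sbasis n b - xm b\<close> have constant term zero and, by homogeneity, they vanish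
  except at monomials of smaller degree.
\<close>
lemma sbasis_triangular:
  assumes b: "b \<in> stairs n"
  shows "sbasis n b = xm b + (\<Sum>b'\<in>stairs n. coord n (sbasis n b - xm b) b' * xm b' :: _ \<Rightarrow>\<^sub>0 'k::field_char_0)"
    and "b' \<in> stairs n \<Longrightarrow> mdeg n b' \<ge> mdeg n b \<Longrightarrow> coord n (sbasis n b - xm b :: _ \<Rightarrow>\<^sub>0 'k) b' = 0"
proof -
  let ?g = "sbasis n b - xm b :: _ \<Rightarrow>\<^sub>0 'k"
  have g: "?g \<in> PP n" by (intro PP_closed sbasis_PP xm_PP b)
  show "sbasis n b = xm b + (\<Sum>b'\<in>stairs n. coord n ?g b' * xm b')"
    unfolding coord(3)[OF g, symmetric] by simp
  assume b': "b' \<in> stairs n" and deg: "mdeg n b' \<ge> mdeg n b"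
  \<comment> \<open>Averaging does not change the reduction, so the correction term
    \<open>?g\<close> reduces to 0 and its coordinates have no constant term.\<close>
  have "cproj n ?g + cproj n (xm b) = cproj n (?g + xm b)"
    by (rule cproj_add[symmetric, OF g xm_PP[OF b]])
  also have "\<dots> = cproj n (xm b)"
    using cproj_avg[OF xm_PP[OF b]] by (simp add: sbasis_def)
  finally have "cproj n ?g = 0" by simp
  then have cst: "cst (coord n ?g b') = 0"
    using lookup_cproj[OF b', of ?g] by simp
  have "hcomp n (mdeg n b) ?g = ?g"
    by (simp add: hcomp_diff hcomp_sbasis[OF b] hcomp_single)
  from hcomp_coord[OF g this b'] have hom: "hcomp n (mdeg n b - mdeg n b') (coord n ?g b') = coord n ?g b'" .
  show "coord n ?g b' = 0"
  proof (rule poly_mapping_eqI, rule ccontr)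
    fix \<gamma> assume *: "lookup (coord n ?g b') \<gamma> \<noteq> lookup 0 \<gamma>"
    have "lookup (coord n ?g b') \<gamma> = (if mdeg n \<gamma> = mdeg n b - mdeg n b' then lookup (coord n ?g b') \<gamma> else 0)"
      using lookup_hcomp[of n "mdeg n b - mdeg n b'" "coord n ?g b'" \<gamma>] unfolding hom .
    with * have "mdeg n \<gamma> = mdeg n b - mdeg n b'" by (auto split: if_splits)
    \<comment> \<open>Exponents of polynomials are nonnegative, so degree at most 0 leaves only the
      constant monomial, and its coefficient has just been seen to vanish.\<close>
    then have le: "mdeg n \<gamma> \<le> 0" using deg by simp
    have "\<gamma> \<in> keys (coord n ?g b')" using * by (simp add: in_keys_iff)
    then have \<gamma>: "\<gamma> \<in> mono_set n {0..}" using coord(1)[OF g b'] by (auto simp: PP_def)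
    then have nonneg: "\<gamma> i \<ge> 0" if "i \<in> {1..n}" for i using that by (simp add: mono_set_def)
    then have "mdeg n \<gamma> = 0" using le sum_nonneg[of "{1..n}" \<gamma>] by (simp add: mdeg_def)
    then have "\<forall>i\<in>{1..n}. \<gamma> i = 0"
      unfolding mdeg_def using sum_nonneg_eq_0_iff[of "{1..n}" \<gamma>] nonneg by simp
    then have "\<gamma> i = 0" for i using \<gamma> by (cases "i \<in> {1..n}") (auto simp: mono_set_def)
    then have "\<gamma> = 0" by (simp add: fun_eq_iff)
    then show False using * cst by simp
  qed
qed

text \<open>Among the indices with nonzero coefficient take \<open>b0\<close> of maximal degree.
  After expansion in staircase monomials all corrections land in strictly smaller degrees, so the
  coefficient at \<open>b0\<close> is \<open>c b0\<close>, which must vanish. No support condition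
  is imposed on \<open>c\<close>, hence this covers Laurent coefficients.\<close>

lemma sbasis_independent:
  fixes c :: "(nat \<Rightarrow> int) \<Rightarrow> ((nat \<Rightarrow> int) \<Rightarrow>\<^sub>0 'k::field_char_0)"
  assumes c: "\<And>b. b \<in> stairs n \<Longrightarrow> fixed n (c b)" and sum: "(\<Sum>b\<in>stairs n. c b * sbasis n b) = 0"
    and b: "b \<in> stairs n"
  shows "c b = 0"
proof (rule ccontr)
  assume "c b \<noteq> 0"
  let ?N = "\<lambda>b b'. coord n (sbasis n b - xm b) b' :: _ \<Rightarrow>\<^sub>0 'k"
  define B where "B = {b \<in> stairs n. c b \<noteq> 0}"
  have B: "finite B" "B \<noteq> {}" using finite_stairs b \<open>c b \<noteq> 0\<close> by (auto simp: B_def)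
  define m where "m = Max (mdeg n ` B)"
  have "m \<in> mdeg n ` B" unfolding m_def using B by (intro Max_in) auto
  then obtain b0 where b0: "b0 \<in> B" "mdeg n b0 = m" by auto
  then have b0S: "b0 \<in> stairs n" "c b0 \<noteq> 0" by (auto simp: B_def)
  have Max: "mdeg n b \<le> m" if "b \<in> B" for b
    unfolding m_def using that B by (intro Max_ge) auto
  let ?C = "\<lambda>b'. c b' + (\<Sum>b\<in>stairs n. c b * ?N b b')"
  have "(\<Sum>b\<in>stairs n. c b * sbasis n b)
      = (\<Sum>b\<in>stairs n. c b * xm b) + (\<Sum>b\<in>stairs n. \<Sum>b'\<in>stairs n. c b * ?N b b' * xm b')"
    unfolding sum.distrib[symmetric]
  proof (intro sum.cong refl)
    fix b assume "b \<in> stairs n"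
    from arg_cong[OF sbasis_triangular(1)[OF this, where 'k = 'k], of "(*) (c b)"]
    show "c b * sbasis n b = c b * xm b + (\<Sum>b'\<in>stairs n. c b * ?N b b' * xm b')"
      by (simp only: distrib_left sum_distrib_left mult.assoc)
  qed
  also have "(\<Sum>b\<in>stairs n. \<Sum>b'\<in>stairs n. c b * ?N b b' * xm b') = (\<Sum>b'\<in>stairs n. (\<Sum>b\<in>stairs n. c b * ?N b b') * xm b')"
    unfolding sum_distrib_right by (rule sum.swap)
  finally have zero: "(\<Sum>b\<in>stairs n. ?C b * xm b) = 0"
    using sum by (simp only: distrib_right sum.distrib)
  have "?C b0 = 0"
  proof (rule stairs_independent[OF _ zero b0S(1)])
    show "fixed n (?C b')" if b': "b' \<in> stairs n" for b'
      by (intro fixed_add fixed_sum fixed_mult c b' coord(2) PP_closed(3) sbasis_PP xm_PP)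
  qed
  moreover have "c b * ?N b b0 = 0" if "b \<in> stairs n" for b
  proof (cases "b \<in> B")
    case True
    then show ?thesis using sbasis_triangular(2)[OF that b0S(1), where 'k = 'k] Max b0(2) by simp
  next
    case False
    then show ?thesis using that by (simp add: B_def)
  qed
  ultimately show False using b0S(2) by (simp add: sum.neutral)
qed

text \<open>\<open>stairs_span\<close> already holds for both rings, so it suffices to recover each
  staircase monomial from \<open>sbasis\<close>. This goes by induction on its degree: the
  corrections involve monomials of smaller degree, with symmetric polynomials as
  coefficients.\<close>

lemma (in lpoly_data) sbasis_span:
  fixes f :: "(nat \<Rightarrow> int) \<Rightarrow>\<^sub>0 'k::field_char_0"
  assumes "f \<in> PI"
  shows "\<exists>c. (\<forall>b\<in>stairs n. c b \<in> PI \<and> fixed n (c b)) \<and> f = (\<Sum>b\<in>stairs n. c b * sbasis n b)"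
proof -
  define sp where "sp g \<longleftrightarrow> (\<exists>c. (\<forall>b\<in>stairs n. c b \<in> PI \<and> fixed n (c b)) \<and> g = (\<Sum>b\<in>stairs n. c b * sbasis n b))"
    for g :: "_ \<Rightarrow>\<^sub>0 'k"
  have PP_PI: "g \<in> PI" if "g \<in> PP n" for g :: "_ \<Rightarrow>\<^sub>0 'k"
  proof -
    have "mono_set n {0..} \<subseteq> mono_set n S" using S_nonneg by (auto simp: mono_set_def)
    then show ?thesis using that by (auto simp: PP_def)
  qed
  have spI: "sp g" if "g = (\<Sum>b\<in>stairs n. c b * sbasis n b)" "\<forall>b\<in>stairs n. c b \<in> PI \<and> fixed n (c b)" for g c
    unfolding sp_def by (intro exI[of _ c] conjI that)
  have sp_0: "sp 0"
    unfolding sp_def by (intro exI[of _ "\<lambda>_. 0"]) (simp add: fixed_0)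
  have sp_add: "sp (g + h)" if "sp g" "sp h" for g h
  proof -
    obtain c where c: "\<forall>b\<in>stairs n. c b \<in> PI \<and> fixed n (c b)" "g = (\<Sum>b\<in>stairs n. c b * sbasis n b)"
      using \<open>sp g\<close> unfolding sp_def by (elim exE conjE)
    obtain d where d: "\<forall>b\<in>stairs n. d b \<in> PI \<and> fixed n (d b)" "h = (\<Sum>b\<in>stairs n. d b * sbasis n b)"
      using \<open>sp h\<close> unfolding sp_def by (elim exE conjE)
    have "g + h = (\<Sum>b\<in>stairs n. (c b + d b) * sbasis n b)"
      unfolding c(2) d(2) by (simp add: distrib_right sum.distrib)
    moreover have "\<forall>b\<in>stairs n. c b + d b \<in> PI \<and> fixed n (c b + d b)"
      using c(1) d(1) by (intro ballI conjI PI_add fixed_add) (simp_all del: mem_Collect_eq)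
    ultimately show ?thesis by (rule spI)
  qed
  have sp_mult: "sp (u * g)" if "sp g" "u \<in> PI" "fixed n u" for u g
  proof -
    obtain c where c: "\<forall>b\<in>stairs n. c b \<in> PI \<and> fixed n (c b)" "g = (\<Sum>b\<in>stairs n. c b * sbasis n b)"
      using \<open>sp g\<close> unfolding sp_def by (elim exE conjE)
    have "u * g = (\<Sum>b\<in>stairs n. (u * c b) * sbasis n b)"
      unfolding c(2) by (simp add: sum_distrib_left mult.assoc)
    moreover have "\<forall>b\<in>stairs n. u * c b \<in> PI \<and> fixed n (u * c b)"
      using c(1) that(2,3) by (intro ballI conjI PI_mult fixed_mult) (simp_all del: mem_Collect_eq)
    ultimately show ?thesis by (rule spI)
  qed
  have sp_sum: "sp (\<Sum>i\<in>I. F i)" if "\<And>i. i \<in> I \<Longrightarrow> sp (F i)" for F and I :: "(nat \<Rightarrow> int) set"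
    using that by (induction I rule: infinite_finite_induct) (auto intro: sp_0 sp_add)
  have PI1: "(1 :: _ \<Rightarrow>\<^sub>0 'k) \<in> PI" by (rule PI_1)
  have sp_sbasis: "sp (sbasis n b)" if "b \<in> stairs n" for b
  proof -
    have "sbasis n b = (\<Sum>b'\<in>stairs n. (if b' = b then 1 else 0) * (sbasis n b' :: _ \<Rightarrow>\<^sub>0 'k))"
      using that finite_stairs by (simp add: if_distrib[of "\<lambda>x. x * _"] cong: if_cong)
    moreover have "\<forall>b'\<in>stairs n. (if b' = b then 1 else 0 :: _ \<Rightarrow>\<^sub>0 'k) \<in> PI \<and>
        fixed n (if b' = b then 1 else 0 :: _ \<Rightarrow>\<^sub>0 'k)"
      using PI1 PI_0 fixed_0 fixed_1 by auto
    ultimately show ?thesis by (rule spI)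
  qed
  have sp_xm: "sp (xm b)" if "b \<in> stairs n" for b
    using that
  proof (induction "nat (mdeg n b)" arbitrary: b rule: less_induct)
    case less
    let ?N = "\<lambda>b'. coord n (sbasis n b - xm b) b' :: _ \<Rightarrow>\<^sub>0 'k"
    have g: "(sbasis n b - xm b :: _ \<Rightarrow>\<^sub>0 'k) \<in> PP n" by (intro PP_closed sbasis_PP xm_PP less.prems)
    have "sp (?N b' * xm b')" if b': "b' \<in> stairs n" for b'
    proof (cases "mdeg n b' \<ge> mdeg n b")
      case True
      then show ?thesis using sbasis_triangular(2)[OF less.prems b', where 'k = 'k] sp_0 by simp
    next
      case False
      have "mdeg n b' \<ge> 0"
        unfolding mdeg_def using b' by (intro sum_nonneg) (auto simp: stairs_def)
      with False have "nat (mdeg n b') < nat (mdeg n b)" by simp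
      from less.hyps[OF this b'] show ?thesis
        by (rule sp_mult) (intro PP_PI coord g b')+
    qed
    then have "sp (\<Sum>b'\<in>stairs n. ?N b' * xm b')" by (rule sp_sum)
    then have "sp (- 1 * (\<Sum>b'\<in>stairs n. ?N b' * xm b'))"
      by (rule sp_mult) (use PI_diff[OF PI_0 PI1] fixed_diff[OF fixed_0 fixed_1] in simp_all)
    with sp_sbasis[OF less.prems] have "sp (sbasis n b + - 1 * (\<Sum>b'\<in>stairs n. ?N b' * xm b'))"
      by (rule sp_add)
    moreover have "sbasis n b + - 1 * (\<Sum>b'\<in>stairs n. ?N b' * xm b') = xm b"
      using sbasis_triangular(1)[OF less.prems, where 'k = 'k] by (simp add: algebra_simps)
    ultimately show ?case by simp
  qed
  obtain c where c: "\<forall>b\<in>stairs n. c b \<in> PI \<and> fixed n (c b)" "f = (\<Sum>b\<in>stairs n. c b * xm b)"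
    using stairs_span[OF assms order_refl] by (elim exE conjE)
  have "sp f"
    unfolding c(2) using c(1) by (intro sp_sum sp_mult sp_xm) auto
  then show ?thesis unfolding sp_def .
qed

section \<open>Invariants of the normal form\<close>

definition embn :: "((nat \<Rightarrow> int) \<Rightarrow>\<^sub>0 'k::comm_ring_1) \<Rightarrow> ((nat \<Rightarrow> int \<times> int) \<Rightarrow>\<^sub>0 'k)" where
  "embn = lin_ext (\<lambda>\<gamma>. single (\<lambda>i. (\<gamma> i, 0)) 1)"

definition tmon :: "(nat \<Rightarrow> int) \<Rightarrow> ((nat \<Rightarrow> int \<times> int) \<Rightarrow>\<^sub>0 'k::comm_ring_1)" where
  "tmon \<alpha> = single (\<lambda>i. (0, \<alpha> i)) 1"

text \<open>The coefficient of X^\<alpha> when the normal form is read as an element of a free left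
  module over D^n.\<close>

definition slice :: "(nat \<Rightarrow> int) \<Rightarrow> ((nat \<Rightarrow> int \<times> int) \<Rightarrow>\<^sub>0 'k::comm_ring_1) \<Rightarrow> ((nat \<Rightarrow> int) \<Rightarrow>\<^sub>0 'k)" where
  "slice \<alpha> = lin_ext (\<lambda>\<gamma>. if snd \<circ> \<gamma> = \<alpha> then single (fst \<circ> \<gamma>) 1 else 0)"

definition scalen :: "nat \<Rightarrow> (nat \<Rightarrow> 'k::field) \<Rightarrow> ((nat \<Rightarrow> int \<times> int) \<Rightarrow>\<^sub>0 'k) \<Rightarrow> ((nat \<Rightarrow> int \<times> int) \<Rightarrow>\<^sub>0 'k)" where
  "scalen n \<zeta> = lin_ext (\<lambda>\<gamma>. single \<gamma> (\<Prod>i\<in>{1..n}. \<zeta> i powi snd (\<gamma> i)))"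

lemma embn_add: "embn (f + g) = embn f + embn g" and embn_0 [simp]: "embn 0 = 0"
  and embn_sc: "embn (sc c f) = sc c (embn f)" and embn_sum: "embn (\<Sum>i\<in>I. F i) = (\<Sum>i\<in>I. embn (F i))"
  by (simp_all add: embn_def lin_ext_add lin_ext_sc lin_ext_sum)

lemma embn_single: "embn (single \<gamma> c) = single (\<lambda>i. (\<gamma> i, 0)) c"
  by (simp add: embn_def)

lemma embn_mult: "embn (f * g) = embn f * embn g"
  unfolding embn_def
  by (rule lin_ext_mult[of UNIV]) (auto simp: mult_single fun_eq_iff intro!: arg_cong2[of _ _ _ _ single])

lemma embn_1 [simp]: "embn 1 = 1"
proof -
  have "(\<lambda>i. ((0 :: nat \<Rightarrow> int) i, 0)) = (0 :: nat \<Rightarrow> int \<times> int)" by (simp add: fun_eq_iff zero_prod_def)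
  then show ?thesis unfolding embn_def by (intro lin_ext_1) (simp only: single_one)
qed

lemma slice_add: "slice \<alpha> (f + g) = slice \<alpha> f + slice \<alpha> g" and slice_0 [simp]: "slice \<alpha> 0 = 0"
  and slice_sc: "slice \<alpha> (sc c f) = sc c (slice \<alpha> f)" and slice_sum: "slice \<alpha> (\<Sum>i\<in>I. F i) = (\<Sum>i\<in>I. slice \<alpha> (F i))"
  by (simp_all add: slice_def lin_ext_add lin_ext_sc lin_ext_sum)

lemma embn_tmon: "embn (single \<gamma> c) * tmon \<alpha> = single (\<lambda>i. (\<gamma> i, \<alpha> i)) c"
  by (simp add: embn_single tmon_def mult_single plus_fun_def)

lemma slice_embn_tmon: "slice \<beta> (embn f * tmon \<alpha>) = (if \<alpha> = \<beta> then f else 0)"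
proof -
  have "keys f \<subseteq> UNIV" by simp
  then show ?thesis
  proof (induction f rule: poly_mapping_induct_on)
    case (sgl \<gamma> c)
    have "snd \<circ> (\<lambda>i. (\<gamma> i, \<alpha> i)) = \<alpha>" "fst \<circ> (\<lambda>i. (\<gamma> i, \<alpha> i)) = \<gamma>" for \<alpha> :: "nat \<Rightarrow> int" by auto
    then show ?case unfolding embn_tmon by (simp add: slice_def)
  qed (simp_all add: embn_add slice_add distrib_right)
qed

lemma sum_slices:
  assumes "finite A" "(\<lambda>\<gamma>. snd \<circ> \<gamma>) ` keys f \<subseteq> A"
  shows "(\<Sum>\<alpha>\<in>A. embn (slice \<alpha> f) * tmon \<alpha>) = f"
proof -
  have "keys f \<subseteq> {\<gamma>. snd \<circ> \<gamma> \<in> A}" using assms(2) by auto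
  then show ?thesis
  proof (induction f rule: poly_mapping_induct_on)
    case (sgl \<gamma> c)
    have "(\<Sum>\<alpha>\<in>A. embn (slice \<alpha> (single \<gamma> c)) * tmon \<alpha>)
        = (\<Sum>\<alpha>\<in>A. if \<alpha> = snd \<circ> \<gamma> then embn (single (fst \<circ> \<gamma>) c) * tmon (snd \<circ> \<gamma>) else 0)"
      by (intro sum.cong refl) (simp add: slice_def)
    also have "\<dots> = embn (single (fst \<circ> \<gamma>) c) * tmon (snd \<circ> \<gamma>)"
      using sgl assms(1) by simp
    finally show ?case unfolding embn_tmon by simp
  qed (simp_all add: slice_add embn_add distrib_right sum.distrib)
qed

lemma lookup_scalen: "lookup (scalen n \<zeta> f) \<gamma> = (\<Prod>i\<in>{1..n}. \<zeta> i powi snd (\<gamma> i)) * lookup f \<gamma>"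
proof -
  have "keys f \<subseteq> UNIV" by simp
  then show ?thesis
    by (induction f rule: poly_mapping_induct_on)
      (auto simp: scalen_def lin_ext_add lookup_add lookup_single when_def distrib_left distrib_right mult.commute)
qed

lemma scalen_mult:
  assumes "\<And>i. i \<in> {1..n} \<Longrightarrow> \<zeta> i \<noteq> 0"
  shows "scalen n \<zeta> (f * g) = scalen n \<zeta> f * scalen n \<zeta> g"
  unfolding scalen_def
  by (rule lin_ext_mult[of UNIV]) (simp_all add: mult_single power_int_add assms flip: prod.distrib)

lemma scalen_1 [simp]: "scalen n \<zeta> 1 = 1"
  unfolding scalen_def by (rule lin_ext_1) simp

lemma scalen_embn: "scalen n \<zeta> (embn f) = embn f"
  by (simp add: scalen_def embn_def lin_ext_lin_ext)

lemma scalen_tmon: "scalen n \<zeta> (tmon \<alpha>) = sc (\<Prod>i\<in>{1..n}. \<zeta> i powi \<alpha> i) (tmon \<alpha>)"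
  by (simp add: scalen_def tmon_def)

lemma scalen_one: "(\<And>i. i \<in> {1..n} \<Longrightarrow> \<zeta> i = 1) \<Longrightarrow> scalen n \<zeta> f = f"
  by (rule poly_mapping_eqI) (simp add: lookup_scalen)

lemma permp_embn: "permp \<pi> (embn f) = embn (permp \<pi> f)"
  by (simp add: permp_def embn_def lin_ext_lin_ext comp_def)

lemma permp_tmon: "permp \<pi> (tmon \<alpha>) = tmon (\<alpha> \<circ> inv_into UNIV \<pi>)"
  by (simp add: permp_def tmon_def comp_def)

section \<open>The exponents on which the torus part acts trivially\<close>

lemma A_mpn_nonzero:
  assumes "\<zeta> \<in> A_mpn m p n" "i \<in> {1..n}" "m \<ge> 1"
  shows "\<zeta> i \<noteq> 0"
proof -
  have "\<zeta> i ^ m = 1" using assms by (auto simp: A_mpn_def PiE_iff)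
  then show ?thesis using assms(3) by (auto simp: power_0_left)
qed

lemma A_mpn_one: "(\<lambda>i\<in>{1..n}. 1) \<in> A_mpn m p n"
  by (simp add: A_mpn_def)

lemma A_mpn_perm:
  assumes "\<zeta> \<in> A_mpn m p n" and \<pi>: "\<pi> permutes {1..n}"
  shows "(\<lambda>i\<in>{1..n}. \<zeta> (\<pi> i)) \<in> A_mpn m p n"
proof -
  have "(\<Prod>i\<in>{1..n}. \<zeta> (\<pi> i)) = (\<Prod>i\<in>{1..n}. \<zeta> i)"
    using prod.permute[OF \<pi>, of \<zeta>] by (simp add: comp_def)
  then show ?thesis
    using assms(1) permutes_in_image[OF \<pi>] by (auto simp: A_mpn_def PiE_iff)
qed

text \<open>The exponents are described by triviality of a character rather than by congruences, so
  that stability under permutations follows from that of \<open>A_mpn\<close>. The type argument is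
  present because the roots of unity belong to the field.\<close>

definition lattice :: "nat \<Rightarrow> nat \<Rightarrow> nat \<Rightarrow> 'k::field itself \<Rightarrow> (nat \<Rightarrow> int) set" where
  "lattice m p n TYPE('k) = {\<alpha>. (\<forall>i. i \<notin> {1..n} \<longrightarrow> \<alpha> i = 0) \<and>
    (\<forall>\<zeta>\<in>A_mpn m p n. (\<Prod>i\<in>{1..n}. (\<zeta> i :: 'k) powi \<alpha> i) = 1)}"

text \<open>Reindexing the product moves the permutation from \<alpha> to \<zeta>, and
  \<open>A_mpn\<close> is stable under permuting coordinates.\<close>

lemma lattice_perm:
  assumes "\<alpha> \<in> lattice m p n TYPE('k::field)" and \<pi>: "\<pi> permutes {1..n}"
  shows "\<alpha> \<circ> inv_into UNIV \<pi> \<in> lattice m p n TYPE('k)"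
  unfolding lattice_def
proof (intro CollectI conjI ballI allI impI)
  fix i assume "i \<notin> {1..n}"
  then have "inv_into UNIV \<pi> i = i" using permutes_not_in[OF permutes_inv[OF \<pi>]] by blast
  then show "(\<alpha> \<circ> inv_into UNIV \<pi>) i = 0"
    using assms(1) \<open>i \<notin> {1..n}\<close> by (simp add: lattice_def)
next
  fix \<zeta> :: "nat \<Rightarrow> 'k" assume \<zeta>: "\<zeta> \<in> A_mpn m p n"
  have "(\<Prod>i\<in>{1..n}. \<zeta> i powi (\<alpha> \<circ> inv_into UNIV \<pi>) i) = (\<Prod>i\<in>{1..n}. \<zeta> (\<pi> i) powi \<alpha> i)"
    using prod.permute[OF \<pi>, of "\<lambda>i. \<zeta> i powi (\<alpha> \<circ> inv_into UNIV \<pi>) i"]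
    by (simp add: comp_def permutes_inverses[OF \<pi>])
  also have "\<dots> = (\<Prod>i\<in>{1..n}. (\<lambda>i\<in>{1..n}. \<zeta> (\<pi> i)) i powi \<alpha> i)"
    by (intro prod.cong) auto
  also have "\<dots> = 1"
    using assms(1) A_mpn_perm[OF \<zeta> \<pi>] by (simp only: lattice_def mem_Collect_eq)
  finally show "(\<Prod>i\<in>{1..n}. \<zeta> i powi (\<alpha> \<circ> inv_into UNIV \<pi>) i) = 1" .
qed

lemma vector_space_sc: "vector_space (sc :: 'k::field \<Rightarrow> ('a \<Rightarrow>\<^sub>0 'k) \<Rightarrow> ('a \<Rightarrow>\<^sub>0 'k))"
  by unfold_locales (simp_all add: sc_add_right sc_add_left)

section \<open>The invariants in normal form and a basis over the symmetric part\<close>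

context lpoly_data
begin

definition invs :: "nat \<Rightarrow> nat \<Rightarrow> ((nat \<Rightarrow> int \<times> int) \<Rightarrow>\<^sub>0 'k::field) set" where
  "invs m p = {f. keys f \<subseteq> mono_set n (S \<times> UNIV) \<and>
    (\<forall>\<zeta>\<in>A_mpn m p n. \<forall>\<pi>. \<pi> permutes {1..n} \<longrightarrow> scalen n \<zeta> (permp \<pi> f) = f)}"

abbreviation Lam :: "((nat \<Rightarrow> int) \<Rightarrow>\<^sub>0 'k::comm_ring_1) set" where
  "Lam \<equiv> {f. keys f \<subseteq> mono_set n S \<and> fixed n f}"

lemma Lam_closed: "0 \<in> Lam" "f \<in> Lam \<Longrightarrow> g \<in> Lam \<Longrightarrow> f + g \<in> Lam" "f \<in> Lam \<Longrightarrow> g \<in> Lam \<Longrightarrow> f * g \<in> Lam"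
  "1 \<in> Lam" "f \<in> Lam \<Longrightarrow> sc c f \<in> Lam"
  using PI_0 PI_add[of f g] PI_mult[of f g] PI_1 PI_sc[of f c]
  by (auto simp: fixed_0 fixed_add fixed_mult fixed_1 fixed_sc)

text \<open>Taking one component of a group element trivial separates torus and permutation
  invariance. The torus acts diagonally on monomials, so each monomial occurring in an invariant
  must carry a trivial character.\<close>

lemma invsD:
  fixes f :: "(nat \<Rightarrow> int \<times> int) \<Rightarrow>\<^sub>0 'k::field"
  assumes f: "f \<in> invs m p"
  shows "\<pi> permutes {1..n} \<Longrightarrow> permp \<pi> f = f" "\<zeta> \<in> A_mpn m p n \<Longrightarrow> scalen n \<zeta> f = f"
    "keys f \<subseteq> mono_set n (S \<times> UNIV)" "\<gamma> \<in> keys f \<Longrightarrow> snd \<circ> \<gamma> \<in> lattice m p n TYPE('k)"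
proof -
  show perm: "\<pi> permutes {1..n} \<Longrightarrow> permp \<pi> f = f" for \<pi>
    using f A_mpn_one[where 'a = 'k and m = m and p = p and n = n]
      scalen_one[of n "\<lambda>i\<in>{1..n}. 1" "permp \<pi> f"] by (auto simp: invs_def)
  show scale: "\<zeta> \<in> A_mpn m p n \<Longrightarrow> scalen n \<zeta> f = f" for \<zeta>
  proof -
    assume \<zeta>: "\<zeta> \<in> A_mpn m p n"
    have "\<forall>\<zeta>\<in>A_mpn m p n. \<forall>\<pi>. \<pi> permutes {1..n} \<longrightarrow> scalen n \<zeta> (permp \<pi> f) = f"
      using f by (simp add: invs_def)
    from bspec[OF this \<zeta>, rule_format, OF permutes_id] show "scalen n \<zeta> f = f" by simp
  qed
  show *: "keys f \<subseteq> mono_set n (S \<times> UNIV)" using f by (simp add: invs_def)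
  assume \<gamma>: "\<gamma> \<in> keys f"
  have "(\<Prod>i\<in>{1..n}. \<zeta> i powi snd (\<gamma> i)) = 1" if "\<zeta> \<in> A_mpn m p n" for \<zeta> :: "nat \<Rightarrow> 'k"
    using lookup_scalen[of n \<zeta> f \<gamma>] \<gamma> unfolding scale[OF that] by (simp add: in_keys_iff)
  moreover have "snd (\<gamma> i) = 0" if "i \<notin> {1..n}" for i
    using * \<gamma> that by (auto simp: mono_set_def zero_prod_def dest!: subsetD)
  ultimately show "snd \<circ> \<gamma> \<in> lattice m p n TYPE('k)" by (simp add: lattice_def)
qed

lemma keys_embn_tmon:
  assumes "keys f \<subseteq> mono_set n S" "\<forall>i. i \<notin> {1..n} \<longrightarrow> \<alpha> i = 0"
  shows "keys (embn f * tmon \<alpha>) \<subseteq> mono_set n (S \<times> UNIV)"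
  using assms(1)
proof (induction f rule: poly_mapping_induct_on)
  case (sgl \<gamma> c)
  then have "(\<lambda>i. (\<gamma> i, \<alpha> i)) \<in> mono_set n (S \<times> UNIV)"
    using assms(2) by (auto simp: mono_set_def zero_prod_def)
  then show ?case unfolding embn_tmon by simp
qed (simp_all add: embn_add distrib_right keys_add_closed)

definition wbasis :: "(nat \<Rightarrow> int) \<times> (nat \<Rightarrow> int) \<Rightarrow> ((nat \<Rightarrow> int \<times> int) \<Rightarrow>\<^sub>0 'k::field_char_0)" where
  "wbasis = (\<lambda>(b, \<alpha>). embn (sbasis n b) * tmon \<alpha>)"

text \<open>Multiplying by \<open>embn f\<close> does not mix different powers X^\<alpha>, so one
  slice retains exactly the coefficients of \<open>r\<close> at that \<alpha>.\<close>

lemma slice_wbasis: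
  fixes r :: "(nat \<Rightarrow> int) \<times> (nat \<Rightarrow> int) \<Rightarrow>\<^sub>0 'k::field_char_0"
  assumes "keys r \<subseteq> stairs n \<times> L"
  shows "slice \<alpha> (embn f * lin_ext wbasis r) = (\<Sum>b\<in>stairs n. sc (lookup r (b, \<alpha>)) f * sbasis n b)"
  using assms
proof (induction r rule: poly_mapping_induct_on)
  case (sgl x c)
  obtain b' \<beta> where x: "x = (b', \<beta>)" "b' \<in> stairs n" using sgl by auto
  have "embn f * lin_ext wbasis (single x c) = sc c (embn (f * sbasis n b') * tmon \<beta>)"
    by (simp add: x wbasis_def embn_mult mult.assoc sc_mult_right)
  then have "slice \<alpha> (embn f * lin_ext wbasis (single x c)) = (if \<beta> = \<alpha> then sc c f * sbasis n b' else 0)"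
    by (simp only: slice_sc slice_embn_tmon sc_mult_left) simp
  also have "\<dots> = (\<Sum>b\<in>stairs n. if b = b' then (if \<beta> = \<alpha> then sc c f * sbasis n b' else 0) else 0)"
    using x(2) finite_stairs by simp
  also have "\<dots> = (\<Sum>b\<in>stairs n. sc (lookup (single x c) (b, \<alpha>)) f * sbasis n b)"
    by (intro sum.cong refl) (auto simp: x(1) lookup_single when_def)
  finally show ?case .
next
  case (add r r')
  have "(\<Sum>b\<in>stairs n. sc (lookup (r + r') (b, \<alpha>)) f * sbasis n b)
      = (\<Sum>b\<in>stairs n. sc (lookup r (b, \<alpha>)) f * sbasis n b + sc (lookup r' (b, \<alpha>)) f * sbasis n b)"
    unfolding lookup_add sc_add_left by (intro sum.cong refl distrib_right)
  then show ?case
    using add(3,4) by (simp only: lin_ext_add distrib_left slice_add sum.distrib)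
qed simp

text \<open>Both ingredients of \<open>wbasis\<close> are stable: the span of \<open>sbasis\<close>
  by \<open>permp_sbasis\<close>, the set of exponents by \<open>lattice_perm\<close>.\<close>

lemma permp_wbasis:
  assumes \<pi>: "\<pi> permutes {1..n}" and x: "x \<in> stairs n \<times> lattice m p n TYPE('k::field_char_0)"
  shows "\<exists>r. keys r \<subseteq> stairs n \<times> lattice m p n TYPE('k) \<and> permp \<pi> (wbasis x :: _ \<Rightarrow>\<^sub>0 'k) = lin_ext wbasis r"
proof -
  obtain b \<alpha> where b\<alpha>: "x = (b, \<alpha>)" "b \<in> stairs n" "\<alpha> \<in> lattice m p n TYPE('k)" using x by auto
  obtain r where r: "permp \<pi> (sbasis n b :: _ \<Rightarrow>\<^sub>0 'k) = (\<Sum>b'\<in>stairs n. sc (r b') (sbasis n b'))"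
    using permp_sbasis[OF \<pi> b\<alpha>(2), where 'k = 'k] by (elim exE)
  let ?\<alpha> = "\<alpha> \<circ> inv_into UNIV \<pi>"
  let ?r = "\<Sum>b'\<in>stairs n. single (b', ?\<alpha>) (r b')"
  have "keys ?r \<subseteq> stairs n \<times> lattice m p n TYPE('k)"
    using lattice_perm[OF b\<alpha>(3) \<pi>] by (intro order.trans[OF keys_sum] UN_least) auto
  moreover have "permp \<pi> (wbasis x) = lin_ext wbasis ?r"
    by (simp add: b\<alpha>(1) wbasis_def permp_mult permp_embn permp_tmon r lin_ext_sum embn_sum embn_sc
        sum_distrib_right sc_mult_left)
  ultimately show ?thesis by (intro exI[of _ ?r] conjI)
qed

lemma wbasis_invariant:
  assumes "keys r \<subseteq> stairs n \<times> lattice m p n TYPE('k::field_char_0)" "m \<ge> 1"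
  shows "keys (lin_ext wbasis r :: _ \<Rightarrow>\<^sub>0 'k) \<subseteq> mono_set n (S \<times> UNIV)"
    and "\<zeta> \<in> A_mpn m p n \<Longrightarrow> scalen n \<zeta> (lin_ext wbasis r) = (lin_ext wbasis r :: _ \<Rightarrow>\<^sub>0 'k)"
proof -
  have sub: "mono_set n {0..} \<subseteq> mono_set n S" using S_nonneg by (auto simp: mono_set_def)
  show "keys (lin_ext wbasis r :: _ \<Rightarrow>\<^sub>0 'k) \<subseteq> mono_set n (S \<times> UNIV)"
  proof (rule keys_lin_ext)
    fix x assume "x \<in> keys r"
    then obtain b \<alpha> where x: "x = (b, \<alpha>)" "b \<in> stairs n" "\<alpha> \<in> lattice m p n TYPE('k)" using assms by auto
    have "keys (sbasis n b :: _ \<Rightarrow>\<^sub>0 'k) \<subseteq> mono_set n S"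
      using sbasis_PP[OF x(2), where 'a = 'k] sub by (auto simp: PP_def)
    then show "keys (wbasis x :: _ \<Rightarrow>\<^sub>0 'k) \<subseteq> mono_set n (S \<times> UNIV)"
      using x(3) by (simp add: x(1) wbasis_def keys_embn_tmon lattice_def)
  qed
  assume \<zeta>: "\<zeta> \<in> A_mpn m p n"
  show "scalen n \<zeta> (lin_ext wbasis r) = (lin_ext wbasis r :: _ \<Rightarrow>\<^sub>0 'k)"
  proof -
    have "scalen n \<zeta> (wbasis x) = (wbasis x :: _ \<Rightarrow>\<^sub>0 'k)" if "x \<in> keys r" for x
    proof -
      obtain b \<alpha> where x: "x = (b, \<alpha>)" "\<alpha> \<in> lattice m p n TYPE('k)" using assms(1) \<open>x \<in> keys r\<close> by auto
      have "(\<Prod>i\<in>{1..n}. \<zeta> i powi \<alpha> i) = 1" using x(2) \<zeta> by (auto simp: lattice_def)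
      moreover have "scalen n \<zeta> (embn (sbasis n b) * tmon \<alpha>) = embn (sbasis n b) * scalen n \<zeta> (tmon \<alpha> :: _ \<Rightarrow>\<^sub>0 'k)"
        using scalen_mult[of n \<zeta> "embn (sbasis n b)" "tmon \<alpha>", OF A_mpn_nonzero[OF \<zeta> _ assms(2)]]
        by (simp only: scalen_embn)
      ultimately show ?thesis
        by (simp add: x(1) wbasis_def scalen_tmon)
    qed
    then have "lin_ext (\<lambda>x. scalen n \<zeta> (wbasis x)) r = (lin_ext wbasis r :: _ \<Rightarrow>\<^sub>0 'k)"
      by (rule lin_ext_cong)
    then show ?thesis unfolding scalen_def lin_ext_lin_ext .
  qed
qed

text \<open>The Reynolds operator of S_n alone; invariance under the torus part is already secured
  by the choice of exponents in \<open>lattice\<close>.\<close>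

definition reyn :: "((nat \<Rightarrow> int \<times> int) \<Rightarrow>\<^sub>0 'k::field_char_0) \<Rightarrow> ((nat \<Rightarrow> int \<times> int) \<Rightarrow>\<^sub>0 'k)" where
  "reyn f = sc (inverse (fact n)) (\<Sum>\<pi>\<in>perms n. permp \<pi> f)"

lemma reyn_add: "reyn (f + g) = reyn f + reyn g" and reyn_0 [simp]: "reyn 0 = 0"
  by (simp_all add: reyn_def permp_add sum.distrib sc_add_right)

lemma reyn_mult: "fixed n f \<Longrightarrow> reyn (embn f * g) = embn f * reyn g"
  by (simp add: reyn_def permp_mult permp_embn fixed_def sc_mult_right sum_distrib_left)

lemma reyn_fixed:
  assumes "\<And>\<pi>. \<pi> permutes {1..n} \<Longrightarrow> permp \<pi> f = f"
  shows "reyn f = f"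
proof -
  have "(\<Sum>\<pi>\<in>perms n. permp \<pi> f) = (\<Sum>\<pi>\<in>perms n. f)"
    using assms by (intro sum.cong) auto
  also have "\<dots> = sc (fact n) f" unfolding sum_const_sc card_perms of_nat_fact ..
  finally show ?thesis by (simp add: reyn_def)
qed

lemma permp_reyn:
  assumes \<tau>: "\<tau> permutes {1..n}"
  shows "permp \<tau> (reyn f) = reyn f"
proof -
  have "(\<Sum>\<pi>\<in>perms n. permp (\<tau> \<circ> \<pi>) f) = (\<Sum>\<pi>\<in>perms n. permp \<pi> f)"
    using sum.reindex_bij_betw[OF bij_betw_byWitness[where f = "\<lambda>\<pi>. \<tau> \<circ> \<pi>" and f' = "\<lambda>\<pi>. inv_into UNIV \<tau> \<circ> \<pi>" and A = "perms n" and A' = "perms n"], of "\<lambda>\<pi>. permp \<pi> f"]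
      permutes_compose[OF _ \<tau>] permutes_compose[OF _ permutes_inv[OF \<tau>]]
    by (auto simp: permutes_inv_o[OF \<tau>] comp_assoc[symmetric])
  moreover have "permp \<tau> (permp \<pi> f) = permp (\<tau> \<circ> \<pi>) f" if "\<pi> \<in> perms n" for \<pi>
    using that by (intro permp_permp permutes_bij[OF \<tau>]) (auto intro: permutes_bij)
  ultimately show ?thesis
    by (simp add: reyn_def permp_sc permp_sum cong: sum.cong_simp)
qed

lemma scalen_add: "scalen n \<zeta> (f + g) = scalen n \<zeta> f + scalen n \<zeta> g"
  and scalen_sc: "scalen n \<zeta> (sc c f) = sc c (scalen n \<zeta> f)" and scalen_0: "scalen n \<zeta> 0 = 0"
  by (simp_all add: scalen_def lin_ext_add lin_ext_sc)

lemma invs_0: "0 \<in> invs m p" and invs_add: "f \<in> invs m p \<Longrightarrow> g \<in> invs m p \<Longrightarrow> f + g \<in> invs m p"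
  and invs_sc: "f \<in> invs m p \<Longrightarrow> sc c f \<in> invs m p"
  by (auto simp: invs_def scalen_add scalen_sc permp_add permp_sc keys_add_closed keys_sc_closed scalen_0)

lemma keys_embn: "keys f \<subseteq> mono_set n S \<Longrightarrow> keys (embn f) \<subseteq> mono_set n (S \<times> UNIV)"
  unfolding embn_def by (rule keys_lin_ext) (auto simp: mono_set_def zero_prod_def)

lemma invs_mult:
  assumes "f \<in> Lam" "g \<in> invs m p" "m \<ge> 1"
  shows "embn f * g \<in> invs m p"
proof -
  have "keys (embn f * g) \<subseteq> mono_set n (S \<times> UNIV)"
    using keys_embn[of f] assms(1,2)
    by (intro keys_mult_closed[of "mono_set n (S \<times> UNIV)"]) (auto simp: invs_def mono_set_def mem_Times_iff S_add)
  moreover have "scalen n \<zeta> (permp \<pi> (embn f * g)) = embn f * g"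
    if "\<zeta> \<in> A_mpn m p n" "\<pi> permutes {1..n}" for \<zeta> \<pi>
  proof -
    have "scalen n \<zeta> (permp \<pi> (embn f * g)) = scalen n \<zeta> (embn (permp \<pi> f)) * scalen n \<zeta> (permp \<pi> g)"
      unfolding permp_mult permp_embn by (rule scalen_mult) (rule A_mpn_nonzero[OF that(1) _ assms(3)])
    also have "permp \<pi> f = f" using assms(1) that(2) by (auto simp: fixed_def)
    also have "scalen n \<zeta> (permp \<pi> g) = g" using assms(2) that by (auto simp: invs_def)
    finally show ?thesis by (simp only: scalen_embn)
  qed
  ultimately show ?thesis by (simp add: invs_def)
qed

theorem invs_free:
  assumes m: "m \<ge> 1"
  shows "\<exists>B \<subseteq> (invs m p :: ((nat \<Rightarrow> int \<times> int) \<Rightarrow>\<^sub>0 'k::field_char_0) set).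
    (\<forall>x\<in>invs m p. \<exists>F c. finite F \<and> F \<subseteq> B \<and> (\<forall>b. c b \<in> Lam) \<and> x = (\<Sum>b\<in>F. embn (c b) * b)) \<and>
    (\<forall>F c. finite F \<longrightarrow> F \<subseteq> B \<longrightarrow> (\<forall>b\<in>F. c b \<in> Lam) \<longrightarrow> (\<Sum>b\<in>F. embn (c b) * b) = 0 \<longrightarrow> (\<forall>b\<in>F. c b = 0))"
proof -
  interpret VS: vector_space "sc :: 'k \<Rightarrow> ((nat \<Rightarrow> int \<times> int) \<Rightarrow>\<^sub>0 'k) \<Rightarrow> _" by (rule vector_space_sc)
  define J where "J = stairs n \<times> lattice m p n TYPE('k)"
  \<comment> \<open>This is the fixed part of the linear span of \<open>wbasis\<close>, written W^G
    in the overview. Torus invariance is built into the index set \<open>J\<close>.\<close>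
  define W where "W = {f :: (nat \<Rightarrow> int \<times> int) \<Rightarrow>\<^sub>0 'k. (\<exists>r. keys r \<subseteq> J \<and> f = lin_ext wbasis r) \<and>
    (\<forall>\<pi>. \<pi> permutes {1..n} \<longrightarrow> permp \<pi> f = f)}"
  obtain B where B: "B \<subseteq> W" "VS.independent B" "W \<subseteq> VS.span B"
    using VS.maximal_independent_subset[of W] by metis
  have W_inv: "W \<subseteq> invs m p"
  proof
    fix f assume "f \<in> W"
    then obtain r where "keys r \<subseteq> J" "f = lin_ext wbasis r" "\<forall>\<pi>. \<pi> permutes {1..n} \<longrightarrow> permp \<pi> f = f"
      by (auto simp: W_def)
    then show "f \<in> invs m p"
      using wbasis_invariant[of r m p] m unfolding J_def invs_def by simp
  qed
  \<comment> \<open>The coefficients are required to vanish outside \<open>F\<close> so that two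
    combinations can be added over the union of their index sets.\<close>
  define sp where "sp x \<longleftrightarrow> (\<exists>F c. finite F \<and> F \<subseteq> B \<and> (\<forall>b. c b \<in> Lam) \<and> (\<forall>b. b \<notin> F \<longrightarrow> c b = 0) \<and> x = (\<Sum>b\<in>F. embn (c b) * b))"
    for x :: "(nat \<Rightarrow> int \<times> int) \<Rightarrow>\<^sub>0 'k"
  have spI: "sp x" if "x = (\<Sum>b\<in>F. embn (c b) * b)" "finite F" "F \<subseteq> B" "\<forall>b. c b \<in> Lam" "\<forall>b. b \<notin> F \<longrightarrow> c b = 0" for x F c
    unfolding sp_def by (intro exI[of _ F] exI[of _ c] conjI that)
  have sp_0: "sp 0"
    using Lam_closed(1) by (intro spI[of _ "\<lambda>_. 0" "{}"]) auto
  have sp_add: "sp (x + y)" if "sp x" "sp y" for x y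
  proof -
    obtain F c where c: "finite F" "F \<subseteq> B" "\<forall>b. c b \<in> Lam" "\<forall>b. b \<notin> F \<longrightarrow> c b = 0" "x = (\<Sum>b\<in>F. embn (c b) * b)"
      using \<open>sp x\<close> unfolding sp_def by (elim exE conjE)
    obtain G d where d: "finite G" "G \<subseteq> B" "\<forall>b. d b \<in> Lam" "\<forall>b. b \<notin> G \<longrightarrow> d b = 0" "y = (\<Sum>b\<in>G. embn (d b) * b)"
      using \<open>sp y\<close> unfolding sp_def by (elim exE conjE)
    have "x = (\<Sum>b\<in>F \<union> G. embn (c b) * b)"
      unfolding c(5) using c(1,4) d(1) by (intro sum.mono_neutral_left) auto
    moreover have "y = (\<Sum>b\<in>F \<union> G. embn (d b) * b)"
      unfolding d(5) using d(1,4) c(1) by (intro sum.mono_neutral_left) auto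
    ultimately have "x + y = (\<Sum>b\<in>F \<union> G. embn (c b + d b) * b)"
      by (simp only: embn_add distrib_right sum.distrib)
    then show ?thesis
    proof (rule spI)
      show "\<forall>b. c b + d b \<in> Lam"
        using c(3) d(3) by (intro allI Lam_closed(2)) blast+
    qed (use c d in auto)
  qed
  have sp_mult: "sp (embn f * x)" if "sp x" "f \<in> Lam" for f x
  proof -
    obtain F c where c: "finite F" "F \<subseteq> B" "\<forall>b. c b \<in> Lam" "\<forall>b. b \<notin> F \<longrightarrow> c b = 0" "x = (\<Sum>b\<in>F. embn (c b) * b)"
      using \<open>sp x\<close> unfolding sp_def by (elim exE conjE)
    have "embn f * x = (\<Sum>b\<in>F. embn (f * c b) * b)"
      unfolding c(5) by (simp add: sum_distrib_left embn_mult mult.assoc)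
    then show ?thesis
    proof (rule spI)
      show "\<forall>b. f * c b \<in> Lam"
        using c(3) that(2) by (intro allI Lam_closed(3)) blast+
    qed (use c in auto)
  qed
  have sp_sum: "sp (\<Sum>i\<in>I. F i)" if "\<And>i. i \<in> I \<Longrightarrow> sp (F i)" for F and I :: "(nat \<Rightarrow> int) set"
    using that by (induction I rule: infinite_finite_induct) (auto intro: sp_0 sp_add)
  have sp_W: "sp x" if "x \<in> W" for x
  proof -
    have "x \<in> VS.span B" using that B(3) by blast
    then show ?thesis
    proof (induction rule: VS.span_induct_alt)
      case base
      show ?case by (rule sp_0)
    next
      case (step k b y)
      have "sp (embn (sc k 1) * b)"
      proof (rule spI[of _ "\<lambda>b'. if b' = b then sc k 1 else 0" "{b}"])
        show "\<forall>b'. (if b' = b then sc k 1 else 0) \<in> Lam"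
          using Lam_closed(1) Lam_closed(5)[OF Lam_closed(4)] by auto
      qed (use step in auto)
      then have "sp (sc k b)" by (simp add: embn_sc sc_mult_left)
      then show ?case using sp_add step by blast
    qed
  qed
  have W_reyn: "reyn (wbasis x) \<in> W" if x: "x \<in> J" for x
  proof -
    have "\<forall>\<pi>. \<exists>r. \<pi> permutes {1..n} \<longrightarrow> keys r \<subseteq> J \<and> permp \<pi> (wbasis x :: _ \<Rightarrow>\<^sub>0 'k) = lin_ext wbasis r"
      using permp_wbasis[where 'k = 'k and m = m and p = p and x = x] x unfolding J_def by blast
    then obtain r where r: "\<And>\<pi>. \<pi> permutes {1..n} \<Longrightarrow> keys (r \<pi>) \<subseteq> J \<and> permp \<pi> (wbasis x :: _ \<Rightarrow>\<^sub>0 'k) = lin_ext wbasis (r \<pi>)"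
      by metis
    let ?r = "sc (inverse (fact n)) (\<Sum>\<pi>\<in>perms n. r \<pi>)"
    have "keys (\<Sum>\<pi>\<in>perms n. r \<pi>) \<subseteq> J"
      using r by (intro order.trans[OF keys_sum] UN_least) auto
    then have kr: "keys ?r \<subseteq> J" by (rule keys_sc_closed)
    have "reyn (wbasis x) = lin_ext wbasis ?r"
      unfolding reyn_def lin_ext_sc lin_ext_sum using r
      by (intro arg_cong[of _ _ "sc (inverse (fact n))"] sum.cong) auto
    then show ?thesis
      unfolding W_def by (intro CollectI conjI exI[of _ ?r] allI impI permp_reyn kr)
  qed
  have span: "sp x" if x: "x \<in> invs m p" for x
  proof -
    define A where "A = (\<lambda>\<gamma>. snd \<circ> \<gamma>) ` keys x"
    have finA: "finite A" by (simp add: A_def)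
    have AL: "\<alpha> \<in> lattice m p n TYPE('k)" if "\<alpha> \<in> A" for \<alpha>
      using invsD(4)[OF x] that by (auto simp: A_def)
    have "keys (slice \<alpha> x) \<subseteq> mono_set n S" for \<alpha>
      unfolding slice_def using invsD(3)[OF x]
      by (intro keys_lin_ext) (auto simp: mono_set_def zero_prod_def dest!: subsetD)
    then have "\<exists>c. (\<forall>b\<in>stairs n. c b \<in> PI \<and> fixed n (c b)) \<and> slice \<alpha> x = (\<Sum>b\<in>stairs n. c b * sbasis n b)" for \<alpha>
      by (intro sbasis_span) simp
    then have "\<forall>\<alpha>. \<exists>c. (\<forall>b\<in>stairs n. c b \<in> PI \<and> fixed n (c b)) \<and> slice \<alpha> x = (\<Sum>b\<in>stairs n. c b * sbasis n b)"
      by (rule allI)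
    from choice[OF this] obtain d where d: "\<forall>\<alpha>. (\<forall>b\<in>stairs n. d \<alpha> b \<in> PI \<and> fixed n (d \<alpha> b)) \<and>
        slice \<alpha> x = (\<Sum>b\<in>stairs n. d \<alpha> b * sbasis n b)" by (elim exE)
    have reyn_sum: "reyn (\<Sum>i\<in>I. F i) = (\<Sum>i\<in>I. reyn (F i))" for F :: "(nat \<Rightarrow> int) \<Rightarrow> _ \<Rightarrow>\<^sub>0 'k" and I
      by (induction I rule: infinite_finite_induct) (simp_all add: reyn_add)
    have "x = (\<Sum>\<alpha>\<in>A. embn (slice \<alpha> x) * tmon \<alpha>)"
      using sum_slices[OF finA, of x] by (simp add: A_def)
    also have "\<dots> = (\<Sum>\<alpha>\<in>A. \<Sum>b\<in>stairs n. embn (d \<alpha> b) * wbasis (b, \<alpha>))"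
    proof (rule sum.cong[OF refl])
      fix \<alpha>
      have "slice \<alpha> x = (\<Sum>b\<in>stairs n. d \<alpha> b * sbasis n b)" using d by blast
      then show "embn (slice \<alpha> x) * tmon \<alpha> = (\<Sum>b\<in>stairs n. embn (d \<alpha> b) * wbasis (b, \<alpha>))"
        by (simp only: wbasis_def prod.case embn_sum embn_mult sum_distrib_right mult.assoc)
    qed
    \<comment> \<open>The Reynolds operator fixes the invariant on the left; on the right it passes
      the symmetric coefficients and turns each \<open>wbasis\<close> element into an element of
      \<open>W\<close>, which \<open>B\<close> spans linearly.\<close>
    finally have "reyn x = reyn (\<Sum>\<alpha>\<in>A. \<Sum>b\<in>stairs n. embn (d \<alpha> b) * wbasis (b, \<alpha>))"
      by (rule arg_cong)
    also have "\<dots> = (\<Sum>\<alpha>\<in>A. \<Sum>b\<in>stairs n. reyn (embn (d \<alpha> b) * wbasis (b, \<alpha>)))"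
      by (simp only: reyn_sum)
    also have "\<dots> = (\<Sum>\<alpha>\<in>A. \<Sum>b\<in>stairs n. embn (d \<alpha> b) * reyn (wbasis (b, \<alpha>)))"
      using d by (intro sum.cong refl reyn_mult) blast
    finally have "x = (\<Sum>\<alpha>\<in>A. \<Sum>b\<in>stairs n. embn (d \<alpha> b) * reyn (wbasis (b, \<alpha>)))"
      using reyn_fixed[OF invsD(1)[OF x]] by simp
    moreover have "sp (embn (d \<alpha> b) * reyn (wbasis (b, \<alpha>)))" if "\<alpha> \<in> A" "b \<in> stairs n" for \<alpha> b
    proof (rule sp_mult[OF sp_W[OF W_reyn]])
      show "(b, \<alpha>) \<in> J" using AL that by (simp add: J_def)
      show "d \<alpha> b \<in> Lam" using d that by blast
    qed
    ultimately show ?thesis by (simp only:) (intro sp_sum)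
  qed
  have indep: "c b = 0"
    if F: "finite F" "F \<subseteq> B" and c: "\<forall>b\<in>F. c b \<in> Lam" and zero: "(\<Sum>b\<in>F. embn (c b) * b) = 0" and b: "b \<in> F" for F c b
  proof -
    have "\<forall>w\<in>F. \<exists>r. keys r \<subseteq> J \<and> w = lin_ext wbasis r"
      using F(2) B(1) unfolding W_def by blast
    from bchoice[OF this] obtain r where r: "\<forall>w\<in>F. keys (r w) \<subseteq> J \<and> w = lin_ext wbasis (r w)" by (elim exE)
    \<comment> \<open>First comparison: expand every w in \<open>wbasis\<close> with scalar
      coefficients, take the part at X^\<alpha>, and use independence of \<open>sbasis\<close> over
      symmetric coefficients.\<close>
    have coeff: "(\<Sum>w\<in>F. sc (lookup (r w) (b', \<alpha>)) (c w)) = 0" if "b' \<in> stairs n" for b' \<alpha>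
      using _ _ that
    proof (rule sbasis_independent[where c = "\<lambda>b'. \<Sum>w\<in>F. sc (lookup (r w) (b', \<alpha>)) (c w)"])
      show "fixed n (\<Sum>w\<in>F. sc (lookup (r w) (b, \<alpha>)) (c w))" for b
        using c by (intro fixed_sum fixed_sc) blast
      have "0 = slice \<alpha> (\<Sum>w\<in>F. embn (c w) * w)" unfolding zero by simp
      also have "\<dots> = (\<Sum>w\<in>F. slice \<alpha> (embn (c w) * lin_ext wbasis (r w)))"
        unfolding slice_sum using r by (intro sum.cong refl) simp
      also have "\<dots> = (\<Sum>w\<in>F. \<Sum>b'\<in>stairs n. sc (lookup (r w) (b', \<alpha>)) (c w) * sbasis n b')"
        using r unfolding J_def by (intro sum.cong refl slice_wbasis) blast
      also have "\<dots> = (\<Sum>b'\<in>stairs n. (\<Sum>w\<in>F. sc (lookup (r w) (b', \<alpha>)) (c w)) * sbasis n b')"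
        unfolding sum_distrib_right by (rule sum.swap)
      finally show "(\<Sum>b'\<in>stairs n. (\<Sum>w\<in>F. sc (lookup (r w) (b', \<alpha>)) (c w)) * sbasis n b') = 0" by simp
    qed
    show "c b = 0"
    proof (rule poly_mapping_eqI)
      fix \<gamma>
      \<comment> \<open>Second comparison: the coefficient of a fixed monomial \<gamma> in these
        identities gives a relation with scalar coefficients between the vectors \<open>r w\<close>,
        hence between the elements of \<open>F\<close>, which are linearly independent.\<close>
      have "(\<Sum>w\<in>F. sc (lookup (c w) \<gamma>) (r w)) = 0"
      proof (rule poly_mapping_eqI)
        fix j :: "(nat \<Rightarrow> int) \<times> (nat \<Rightarrow> int)"
        obtain b' \<alpha> where j: "j = (b', \<alpha>)" by (cases j)
        show "lookup (\<Sum>w\<in>F. sc (lookup (c w) \<gamma>) (r w)) j = lookup 0 j"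
        proof (cases "b' \<in> stairs n")
          case True
          from arg_cong[OF coeff[OF True, of \<alpha>], of "\<lambda>f. lookup f \<gamma>"]
          show ?thesis by (simp add: lookup_sum j mult.commute)
        next
          case False
          then have "lookup (r w) j = 0" if "w \<in> F" for w
            using r that by (auto simp: J_def j in_keys_iff dest!: bspec)
          then show ?thesis by (simp add: lookup_sum)
        qed
      qed
      then have "lin_ext wbasis (\<Sum>w\<in>F. sc (lookup (c w) \<gamma>) (r w)) = (0 :: _ \<Rightarrow>\<^sub>0 'k)" by simp
      then have "(\<Sum>w\<in>F. sc (lookup (c w) \<gamma>) (lin_ext wbasis (r w))) = (0 :: _ \<Rightarrow>\<^sub>0 'k)"
        by (simp add: lin_ext_sum lin_ext_sc)
      moreover have "(\<Sum>w\<in>F. sc (lookup (c w) \<gamma>) (lin_ext wbasis (r w))) = (\<Sum>w\<in>F. sc (lookup (c w) \<gamma>) w)"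
        using r by (intro sum.cong refl) auto
      ultimately have "(\<Sum>w\<in>F. sc (lookup (c w) \<gamma>) w) = 0" by simp
      from VS.independentD[OF B(2) F this b] show "lookup (c b) \<gamma> = lookup 0 \<gamma>" by simp
    qed
  qed
  show ?thesis
  proof (rule exI[of _ B], intro conjI ballI allI impI)
    show "B \<subseteq> invs m p" using B(1) W_inv by blast
    fix x :: "(nat \<Rightarrow> int \<times> int) \<Rightarrow>\<^sub>0 'k" assume "x \<in> invs m p"
    from span[OF this] show "\<exists>F c. finite F \<and> F \<subseteq> B \<and> (\<forall>b. c b \<in> Lam) \<and> x = (\<Sum>b\<in>F. embn (c b) * b)"
      unfolding sp_def by blast
  qed (rule indep; assumption)
qed

end

section \<open>The invariants of the tensorial generalized Weyl algebra\<close>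

lemma left_mult_module_simps:
  "carrier (left_mult_module A) = carrier A" "add (left_mult_module A) = add A"
  "\<zero>\<^bsub>left_mult_module A\<^esub> = \<zero>\<^bsub>A\<^esub>" "x \<odot>\<^bsub>left_mult_module A\<^esub> y = x \<otimes>\<^bsub>A\<^esub> y"
  by (simp_all add: left_mult_module_def ring.extend_def ring.truncate_def module.fields_def)

locale tensor_gwa_data = gwa_data S D a \<sigma> + L: lpoly_data S n
  for S :: "int set" and D :: "('k::field_char_0, int \<Rightarrow>\<^sub>0 'k) module" and a \<sigma> and n :: nat +
  fixes m p :: nat
  assumes m: "m \<ge> 1"
begin

lemma ring_D: "ring D"
proof (rule ringI)
  show "abelian_group D"
  proof (rule abelian_groupI)
    fix x assume "x \<in> carrier D"
    then show "\<exists>y\<in>carrier D. y \<oplus>\<^bsub>D\<^esub> x = \<zero>\<^bsub>D\<^esub>" by (intro bexI[of _ "- x"]) simp_all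
  qed (simp_all add: add_ac keys_add_closed)
  show "monoid D"
  proof (rule monoidI)
    show "x \<otimes>\<^bsub>D\<^esub> y \<in> carrier D" if "x \<in> carrier D" "y \<in> carrier D" for x y
      using C_mult[of x y] that by simp
  qed (simp_all add: mult.assoc S_0)
qed (simp_all add: distrib_left distrib_right)

lemma tensor_data_D: "tensor_data D (\<lambda>x. x) S"
  by (rule tensor_data.intro)
    (simp_all add: ring_D sc_mult_left sc_mult_right keys_sc_closed bij_betw_def)

lemma tensor_data_G: "tensor_data G \<phi> (S \<times> UNIV)"
  by (rule tensor_data.intro)
    (simp_all add: ring_G \<phi>_add \<phi>_smult G_smult_closed G_smult_mult \<phi>_bij \<phi>_one)

interpretation TD: tensor_data D "\<lambda>x. x" S n by (rule tensor_data_D)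
interpretation TG: tensor_data G \<phi> "S \<times> UNIV" n by (rule tensor_data_G)

section \<open>Coordinates of the tensorial algebra, its invariants and D^*\<close>

abbreviation "T \<equiv> tensor_gwa n D a \<sigma>"
abbreviation "Val \<equiv> TG.\<Psi>"
abbreviation "DS \<equiv> D_star n D a \<sigma>"
abbreviation "Inv \<equiv> tensor_gwa_invariants m p n D a \<sigma>"

lemma T_eq: "T = tensor_pow n G"
  by (simp add: tensor_gwa_def)

interpretation T: ring T
  unfolding T_eq by (rule TG.ring_T)

lemma Val_add: "X \<in> carrier T \<Longrightarrow> Y \<in> carrier T \<Longrightarrow> Val (X \<oplus>\<^bsub>T\<^esub> Y) = Val X + Val Y"
  using TG.\<Psi>_add by (simp add: T_eq)

lemma Val_0 [simp]: "Val \<zero>\<^bsub>T\<^esub> = 0"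
  using Val_add[of "\<zero>\<^bsub>T\<^esub>" "\<zero>\<^bsub>T\<^esub>"] by simp

lemma Val_minus: "X \<in> carrier T \<Longrightarrow> Val (\<ominus>\<^bsub>T\<^esub> X) = - Val X"
  using Val_add[of "\<ominus>\<^bsub>T\<^esub> X" X] by (simp add: T.l_neg eq_neg_iff_add_eq_0)

lemma Val_eqD: "X \<in> carrier T \<Longrightarrow> Y \<in> carrier T \<Longrightarrow> Val X = Val Y \<Longrightarrow> X = Y"
  using TG.\<Psi>_bij by (auto simp: T_eq bij_betw_def dest: inj_onD)

lemma Val_surj:
  assumes "keys f \<subseteq> mono_set n (S \<times> UNIV)"
  shows "\<exists>X. X \<in> carrier T \<and> Val X = f"
proof -
  have "f \<in> Val ` carrier T" using TG.\<Psi>_bij assms by (simp add: T_eq bij_betw_def)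
  then show ?thesis by blast
qed

text \<open>In coordinates, \<open>scalen\<close> acts on the i-th tensor factor as
  \<open>scale1\<close> with \<open>\<zeta> i\<close>, because the other positions have exponent 0
  there and contribute the factor 1. This is the compatibility that \<open>tensor_map\<close> asks
  for.\<close>

lemma act:
  assumes \<zeta>: "\<zeta> \<in> A_mpn m p n" and \<pi>: "\<pi> permutes {1..n}" and X: "X \<in> carrier T"
  shows "G_mpn_act n D a \<sigma> (\<zeta>, \<pi>) X \<in> carrier T"
    and "Val (G_mpn_act n D a \<sigma> (\<zeta>, \<pi>) X) = scalen n \<zeta> (permp \<pi> (Val X))"
proof -
  have nz: "\<zeta> i \<noteq> 0" if "i \<in> {1..n}" for i by (rule A_mpn_nonzero[OF \<zeta> that m])
  have X': "tensor_perm n G \<pi> X \<in> carrier (tensor_pow n G)"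
    using TG.tensor_perm(1)[OF \<pi>] X by (simp add: T_eq)
  have h: "gwa_scale D a \<sigma> (\<zeta> i) x \<in> carrier G \<and>
      scalen n \<zeta> (iota i (\<phi> x)) = iota i (\<phi> (gwa_scale D a \<sigma> (\<zeta> i) x))"
    if i: "i \<in> {1..n}" and x: "x \<in> carrier G" for i x
  proof -
    have "scalen n \<zeta> (iota i f) = iota i (scale1 (\<zeta> i) f)" for f
    proof -
      have "(\<Prod>j\<in>{1..n}. \<zeta> j powi snd (put i b j)) = \<zeta> i powi snd b" for b :: "int \<times> int"
      proof -
        have "(\<Prod>j\<in>{1..n}. \<zeta> j powi snd (put i b j)) = (\<Prod>j\<in>{1..n}. if j = i then \<zeta> i powi snd b else 1)"
          by (intro prod.cong refl) (auto simp: put_def)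
        then show ?thesis using i by simp
      qed
      then show ?thesis
        by (simp add: scalen_def iota_def scale1_def lin_ext_lin_ext)
    qed
    then show ?thesis
      using gwa_scale[OF nz[OF i] x] by simp
  qed
  note map = tensor_map[OF tensor_data_G tensor_data_G h scalen_mult[OF nz] scalen_1 scalen_def X']
  show "G_mpn_act n D a \<sigma> (\<zeta>, \<pi>) X \<in> carrier T"
    using map(1) by (simp add: G_mpn_act_def T_eq)
  show "Val (G_mpn_act n D a \<sigma> (\<zeta>, \<pi>) X) = scalen n \<zeta> (permp \<pi> (Val X))"
    using map(2) TG.tensor_perm(2)[OF \<pi>, of X] X by (simp add: G_mpn_act_def T_eq)
qed

lemma Inv_iff: "X \<in> carrier Inv \<longleftrightarrow> X \<in> carrier T \<and> Val X \<in> L.invs m p"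
proof (cases "X \<in> carrier T")
  case True
  have kX: "keys (Val X) \<subseteq> mono_set n (S \<times> UNIV)"
    using TG.\<Psi>_bij True by (auto simp: T_eq bij_betw_def)
  have "G_mpn_act n D a \<sigma> (\<zeta>, \<pi>) X = X \<longleftrightarrow> scalen n \<zeta> (permp \<pi> (Val X)) = Val X"
    if "\<zeta> \<in> A_mpn m p n" "\<pi> permutes {1..n}" for \<zeta> \<pi>
    using act[OF that True] Val_eqD[OF act(1)[OF that True] True] by auto
  then show ?thesis
    using True kX unfolding tensor_gwa_invariants_def L.invs_def G_mpn_def by auto
qed (simp add: tensor_gwa_invariants_def)

lemma embn_iota: "embn (iota i f) = iota i (emb f)"
proof -
  have "(\<lambda>j. (put i b j, 0 :: int)) = put i (b, 0)" for b :: int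
    by (auto simp: put_def fun_eq_iff zero_prod_def)
  then show ?thesis
    by (simp add: embn_def iota_def emb_def lin_ext_lin_ext)
qed

lemma gwa_incl_map:
  assumes "X \<in> carrier (tensor_pow n D)"
  shows "tensor_map n G (\<lambda>i. gwa_incl D a \<sigma>) X \<in> carrier T"
    and "Val (tensor_map n G (\<lambda>i. gwa_incl D a \<sigma>) X) = embn (TD.\<Psi> X)"
    and "\<exists>f\<in>tensor_map n G (\<lambda>i. gwa_incl D a \<sigma>) X. keys f \<subseteq> {1..n} \<rightarrow>\<^sub>E gwa_incl D a \<sigma> ` C"
proof -
  have h: "gwa_incl D a \<sigma> x \<in> carrier G \<and> embn (iota i x) = iota i (\<phi> (gwa_incl D a \<sigma> x))"
    if "i \<in> {1..n}" "x \<in> carrier D" for i x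
    using gwa_incl[of x] that by (simp add: embn_iota)
  note map = tensor_map[OF tensor_data_G tensor_data_D h embn_mult embn_1 embn_def assms]
  show "tensor_map n G (\<lambda>i. gwa_incl D a \<sigma>) X \<in> carrier T" "Val (tensor_map n G (\<lambda>i. gwa_incl D a \<sigma>) X) = embn (TD.\<Psi> X)"
    "\<exists>f\<in>tensor_map n G (\<lambda>i. gwa_incl D a \<sigma>) X. keys f \<subseteq> {1..n} \<rightarrow>\<^sub>E gwa_incl D a \<sigma> ` C"
    using map by (simp_all add: T_eq)
qed

lemma D_sym_iff:
  assumes "X \<in> carrier (tensor_pow n D)"
  shows "(\<forall>\<pi>. \<pi> permutes {1..n} \<longrightarrow> tensor_perm n D \<pi> X = X) \<longleftrightarrow> fixed n (TD.\<Psi> X)"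
proof -
  have "tensor_perm n D \<pi> X = X \<longleftrightarrow> permp \<pi> (TD.\<Psi> X) = TD.\<Psi> X" if "\<pi> permutes {1..n}" for \<pi>
    using TD.tensor_perm[OF that assms] TD.\<Psi>_bij assms by (metis bij_betw_imp_inj_on inj_onD)
  then show ?thesis by (auto simp: fixed_def)
qed

text \<open>Both directions go through the coordinates of D^n, in which symmetry of a tensor is
  \<open>fixed\<close> and the embedding into the larger algebra is \<open>embn\<close>.\<close>

lemma DS_iff: "X \<in> carrier DS \<longleftrightarrow> X \<in> carrier T \<and> (\<exists>f\<in>L.Lam. Val X = embn f)"
proof
  assume "X \<in> carrier DS"
  then obtain Y where Y: "Y \<in> carrier (tensor_pow n D)" "X = tensor_map n G (\<lambda>i. gwa_incl D a \<sigma>) Y"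
    "\<forall>\<pi>. \<pi> permutes {1..n} \<longrightarrow> tensor_perm n D \<pi> Y = Y"
    by (auto simp: D_star_def)
  have "TD.\<Psi> Y \<in> L.Lam"
    using D_sym_iff[OF Y(1)] Y(3) TD.\<Psi>_bij Y(1) by (auto simp: bij_betw_def)
  then show "X \<in> carrier T \<and> (\<exists>f\<in>L.Lam. Val X = embn f)"
    using gwa_incl_map(1,2)[OF Y(1)] unfolding Y(2) by blast
next
  assume "X \<in> carrier T \<and> (\<exists>f\<in>L.Lam. Val X = embn f)"
  then obtain f where X: "X \<in> carrier T" and f: "keys f \<subseteq> mono_set n S" "fixed n f" "Val X = embn f" by auto
  have "f \<in> TD.\<Psi> ` carrier (tensor_pow n D)"
    using TD.\<Psi>_bij f(1) by (simp add: bij_betw_def)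
  then obtain Y where Y: "Y \<in> carrier (tensor_pow n D)" "TD.\<Psi> Y = f" by auto
  have "X = tensor_map n G (\<lambda>i. gwa_incl D a \<sigma>) Y"
    using gwa_incl_map(1,2)[OF Y(1)] X f(3) Y(2) by (intro Val_eqD) simp_all
  then show "X \<in> carrier DS"
    using D_sym_iff[OF Y(1)] Y f(2) by (auto simp: D_star_def)
qed

text \<open>An element of D^* has a representative whose tuples have all entries in the image of D,
  and \<open>\<phi>\<close> respects left multiplication by such entries in each factor. This is all
  the multiplicativity that the module structure involves.\<close>

lemma DS_mult:
  assumes X: "X \<in> carrier DS" and Y: "Y \<in> carrier T"
  shows "Val (X \<otimes>\<^bsub>T\<^esub> Y) = Val X * Val Y"
proof -
  obtain Z where Z: "Z \<in> carrier (tensor_pow n D)" "X = tensor_map n G (\<lambda>i. gwa_incl D a \<sigma>) Z"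
    using X by (auto simp: D_star_def)
  obtain f where f: "f \<in> X" "keys f \<subseteq> {1..n} \<rightarrow>\<^sub>E gwa_incl D a \<sigma> ` C"
    using gwa_incl_map(3)[OF Z(1)] unfolding Z(2) by blast
  have XT: "X \<in> carrier (tensor_pow n G)" using X by (simp add: DS_iff flip: T_eq)
  show ?thesis
    unfolding T_eq
  proof (rule TG.\<Psi>_mult[OF _ _ XT f])
    show "gwa_incl D a \<sigma> ` C \<subseteq> carrier G" using gwa_incl(1) by blast
    show "\<phi> (x \<otimes>\<^bsub>G\<^esub> y) = \<phi> x * \<phi> y" if "x \<in> gwa_incl D a \<sigma> ` C" "y \<in> carrier G" for x y
    proof -
      obtain d where d: "x = gwa_incl D a \<sigma> d" "d \<in> C" using \<open>x \<in> gwa_incl D a \<sigma> ` C\<close> by (rule imageE)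
      show ?thesis unfolding d(1) using gwa_incl(2,3)[OF d(2)] that(2) by simp
    qed
    show "Y \<in> carrier (tensor_pow n G)" using Y by (simp add: T_eq)
  qed
qed

section \<open>The ring D^* and the invariants as a module over it\<close>

lemma DS_simps:
  "X \<otimes>\<^bsub>DS\<^esub> Y = X \<otimes>\<^bsub>T\<^esub> Y" "X \<oplus>\<^bsub>DS\<^esub> Y = X \<oplus>\<^bsub>T\<^esub> Y" "\<one>\<^bsub>DS\<^esub> = \<one>\<^bsub>T\<^esub>" "\<zero>\<^bsub>DS\<^esub> = \<zero>\<^bsub>T\<^esub>"
  by (simp_all add: D_star_def)

lemma DS_T: "X \<in> carrier DS \<Longrightarrow> X \<in> carrier T"
  by (simp add: DS_iff)

lemma DS_closed:
  "\<one>\<^bsub>T\<^esub> \<in> carrier DS" "X \<in> carrier DS \<Longrightarrow> \<ominus>\<^bsub>T\<^esub> X \<in> carrier DS"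
  "X \<in> carrier DS \<Longrightarrow> Y \<in> carrier DS \<Longrightarrow> X \<otimes>\<^bsub>T\<^esub> Y \<in> carrier DS"
  "X \<in> carrier DS \<Longrightarrow> Y \<in> carrier DS \<Longrightarrow> X \<oplus>\<^bsub>T\<^esub> Y \<in> carrier DS"
proof -
  have "Val \<one>\<^bsub>T\<^esub> = embn 1" using TG.\<Psi>_one by (simp add: T_eq)
  then show "\<one>\<^bsub>T\<^esub> \<in> carrier DS"
    unfolding DS_iff using L.Lam_closed(4) by blast
  show "\<ominus>\<^bsub>T\<^esub> X \<in> carrier DS" if X: "X \<in> carrier DS"
  proof -
    obtain f where f: "f \<in> L.Lam" "Val X = embn f" using X by (auto simp: DS_iff)
    have "sc (-1) f + f = sc (-1 + 1) f" by (simp only: sc_add_left sc_one)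
    then have "embn (sc (-1) f) + embn f = 0" unfolding embn_add[symmetric] by simp
    then have "embn (sc (-1) f) = - embn f" by (simp only: eq_neg_iff_add_eq_0)
    then have "Val (\<ominus>\<^bsub>T\<^esub> X) = embn (sc (-1) f)"
      using Val_minus[OF DS_T[OF X]] f(2) by simp
    then show ?thesis
      unfolding DS_iff using L.Lam_closed(5)[OF f(1)] DS_T[OF X] by blast
  qed
  assume X: "X \<in> carrier DS" and Y: "Y \<in> carrier DS"
  obtain f where f: "f \<in> L.Lam" "Val X = embn f" using X by (auto simp: DS_iff)
  obtain g where g: "g \<in> L.Lam" "Val Y = embn g" using Y by (auto simp: DS_iff)
  have "Val (X \<otimes>\<^bsub>T\<^esub> Y) = embn (f * g)" "Val (X \<oplus>\<^bsub>T\<^esub> Y) = embn (f + g)"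
    using DS_mult[OF X DS_T[OF Y]] Val_add[OF DS_T[OF X] DS_T[OF Y]] f(2) g(2)
    by (simp_all add: embn_mult embn_add)
  then show "X \<otimes>\<^bsub>T\<^esub> Y \<in> carrier DS" "X \<oplus>\<^bsub>T\<^esub> Y \<in> carrier DS"
    unfolding DS_iff
    using L.Lam_closed(2,3)[OF f(1) g(1)] DS_T[OF X] DS_T[OF Y] by blast+
qed

lemma DS_0: "\<zero>\<^bsub>T\<^esub> \<in> carrier DS"
  using DS_closed(4)[OF DS_closed(1) DS_closed(2)[OF DS_closed(1)]] by (simp add: T.r_neg)

text \<open>Commutativity is read off in coordinates: \<open>DS_mult\<close> applies to both orders
  of the product, and the coordinate ring is commutative.\<close>

lemma cring_DS: "cring DS"
proof (rule cringI)
  show "abelian_group DS"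
  proof (rule abelian_groupI)
    fix X assume X: "X \<in> carrier DS"
    then show "\<exists>Y\<in>carrier DS. Y \<oplus>\<^bsub>DS\<^esub> X = \<zero>\<^bsub>DS\<^esub>"
      by (intro bexI[of _ "\<ominus>\<^bsub>T\<^esub> X"]) (simp_all add: DS_simps DS_closed DS_T T.l_neg)
  qed (simp_all add: DS_simps DS_closed DS_0 DS_T T.a_ac)
  show "comm_monoid DS"
  proof (rule comm_monoidI)
    fix X Y assume "X \<in> carrier DS" "Y \<in> carrier DS"
    then show "X \<otimes>\<^bsub>DS\<^esub> Y = Y \<otimes>\<^bsub>DS\<^esub> X"
      unfolding DS_simps using DS_mult[of X Y] DS_mult[of Y X] DS_T[of X] DS_T[of Y]
      by (intro Val_eqD) (simp_all add: mult.commute)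
  qed (simp_all add: DS_simps DS_closed DS_T T.m_assoc)
qed (simp_all add: DS_simps DS_T T.l_distr)

abbreviation "M \<equiv> left_mult_module Inv"

lemma Inv_simps:
  "X \<otimes>\<^bsub>Inv\<^esub> Y = X \<otimes>\<^bsub>T\<^esub> Y" "X \<oplus>\<^bsub>Inv\<^esub> Y = X \<oplus>\<^bsub>T\<^esub> Y" "\<zero>\<^bsub>Inv\<^esub> = \<zero>\<^bsub>T\<^esub>"
  by (simp_all add: tensor_gwa_invariants_def)

lemma M_simps:
  "carrier M = carrier Inv" "X \<oplus>\<^bsub>M\<^esub> Y = X \<oplus>\<^bsub>T\<^esub> Y" "\<zero>\<^bsub>M\<^esub> = \<zero>\<^bsub>T\<^esub>" "X \<odot>\<^bsub>M\<^esub> Y = X \<otimes>\<^bsub>T\<^esub> Y"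
  by (simp_all add: left_mult_module_simps Inv_simps)

lemma Inv_T: "X \<in> carrier Inv \<Longrightarrow> X \<in> carrier T"
  by (simp add: Inv_iff)

lemma Inv_closed:
  "\<zero>\<^bsub>T\<^esub> \<in> carrier Inv" "X \<in> carrier Inv \<Longrightarrow> Y \<in> carrier Inv \<Longrightarrow> X \<oplus>\<^bsub>T\<^esub> Y \<in> carrier Inv"
  "X \<in> carrier Inv \<Longrightarrow> \<ominus>\<^bsub>T\<^esub> X \<in> carrier Inv" "Z \<in> carrier DS \<Longrightarrow> X \<in> carrier Inv \<Longrightarrow> Z \<otimes>\<^bsub>T\<^esub> X \<in> carrier Inv"
proof -
  show "\<zero>\<^bsub>T\<^esub> \<in> carrier Inv" by (simp add: Inv_iff L.invs_0)
  show "X \<in> carrier Inv \<Longrightarrow> Y \<in> carrier Inv \<Longrightarrow> X \<oplus>\<^bsub>T\<^esub> Y \<in> carrier Inv"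
    by (simp add: Inv_iff Val_add L.invs_add)
  show "\<ominus>\<^bsub>T\<^esub> X \<in> carrier Inv" if "X \<in> carrier Inv"
  proof -
    have "- Val X = sc (-1) (Val X)" by (rule poly_mapping_eqI) simp
    then show ?thesis using that L.invs_sc[of "Val X" m p "-1"] by (simp add: Inv_iff Val_minus)
  qed
  show "Z \<otimes>\<^bsub>T\<^esub> X \<in> carrier Inv" if Z: "Z \<in> carrier DS" and X: "X \<in> carrier Inv"
  proof -
    obtain f where f: "f \<in> L.Lam" "Val Z = embn f" using Z by (auto simp: DS_iff)
    show ?thesis
      using L.invs_mult[OF f(1) _ m, of "Val X" p] DS_mult[OF Z Inv_T[OF X]] X DS_T[OF Z]
      by (simp add: Inv_iff f(2))
  qed
qed

lemma abelian_group_M: "abelian_group M"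
proof (rule abelian_groupI)
  fix X assume X: "X \<in> carrier M"
  then show "\<exists>Y\<in>carrier M. Y \<oplus>\<^bsub>M\<^esub> X = \<zero>\<^bsub>M\<^esub>"
    by (intro bexI[of _ "\<ominus>\<^bsub>T\<^esub> X"]) (simp_all add: M_simps Inv_closed Inv_T T.l_neg)
qed (simp_all add: M_simps Inv_closed Inv_T T.a_ac)

lemma module_M: "Module.module DS M"
  by (rule moduleI[OF cring_DS abelian_group_M])
    (simp_all add: M_simps DS_simps Inv_closed Inv_T DS_T T.l_distr T.r_distr T.m_assoc)

lemma Val_finsum:
  assumes "finite E" "E \<subseteq> carrier Inv" "c \<in> E \<rightarrow> carrier DS"
  shows "(\<Oplus>\<^bsub>M\<^esub>b\<in>E. c b \<odot>\<^bsub>M\<^esub> b) \<in> carrier T" "Val (\<Oplus>\<^bsub>M\<^esub>b\<in>E. c b \<odot>\<^bsub>M\<^esub> b) = (\<Sum>b\<in>E. Val (c b) * Val b)"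
proof -
  interpret M: abelian_group M by (rule abelian_group_M)
  have "(\<Oplus>\<^bsub>M\<^esub>b\<in>E. c b \<odot>\<^bsub>M\<^esub> b) \<in> carrier Inv \<and> Val (\<Oplus>\<^bsub>M\<^esub>b\<in>E. c b \<odot>\<^bsub>M\<^esub> b) = (\<Sum>b\<in>E. Val (c b) * Val b)"
    using assms
  proof (induction E rule: finite_induct)
    case empty
    then show ?case by (simp add: M_simps Inv_closed)
  next
    case (insert b E)
    have cb: "c b \<in> carrier DS" "b \<in> carrier Inv" using insert by auto
    have mem: "(\<lambda>b. c b \<odot>\<^bsub>M\<^esub> b) \<in> E \<rightarrow> carrier M" "c b \<odot>\<^bsub>M\<^esub> b \<in> carrier M"
      using insert.prems by (auto simp: M_simps intro!: Inv_closed(4))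
    have IH: "(\<Oplus>\<^bsub>M\<^esub>b\<in>E. c b \<odot>\<^bsub>M\<^esub> b) \<in> carrier Inv" "Val (\<Oplus>\<^bsub>M\<^esub>b\<in>E. c b \<odot>\<^bsub>M\<^esub> b) = (\<Sum>b\<in>E. Val (c b) * Val b)"
      using insert by auto
    have eq: "(\<Oplus>\<^bsub>M\<^esub>b\<in>insert b E. c b \<odot>\<^bsub>M\<^esub> b) = (c b \<otimes>\<^bsub>T\<^esub> b) \<oplus>\<^bsub>T\<^esub> (\<Oplus>\<^bsub>M\<^esub>b\<in>E. c b \<odot>\<^bsub>M\<^esub> b)"
      using M.finsum_insert[OF insert.hyps mem] by (simp only: M_simps)
    have cbT: "c b \<otimes>\<^bsub>T\<^esub> b \<in> carrier Inv" by (rule Inv_closed(4)[OF cb])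
    show ?case
      unfolding eq sum.insert[OF insert.hyps]
      using Inv_closed(2)[OF cbT IH(1)] Val_add[OF Inv_T[OF cbT] Inv_T[OF IH(1)]]
        DS_mult[OF cb(1) Inv_T[OF cb(2)]] IH(2) by simp
  qed
  then show "(\<Oplus>\<^bsub>M\<^esub>b\<in>E. c b \<odot>\<^bsub>M\<^esub> b) \<in> carrier T" "Val (\<Oplus>\<^bsub>M\<^esub>b\<in>E. c b \<odot>\<^bsub>M\<^esub> b) = (\<Sum>b\<in>E. Val (c b) * Val b)"
    using Inv_T by blast+
qed

text \<open>\<open>Val\<close> is injective and carries the action of D^* to multiplication by
  \<open>embn\<close> of symmetric elements, so the basis found for \<open>L.invs\<close> can be
  pulled back along it.\<close>

theorem free: "free_module DS M"
proof -
  obtain B :: "((nat \<Rightarrow> int \<times> int) \<Rightarrow>\<^sub>0 'k) set" where B: "B \<subseteq> L.invs m p"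
    and span: "\<forall>x\<in>L.invs m p. \<exists>E c. finite E \<and> E \<subseteq> B \<and> (\<forall>b. c b \<in> L.Lam) \<and> x = (\<Sum>b\<in>E. embn (c b) * b)"
    and indep: "\<forall>E c. finite E \<longrightarrow> E \<subseteq> B \<longrightarrow> (\<forall>b\<in>E. c b \<in> L.Lam) \<longrightarrow> (\<Sum>b\<in>E. embn (c b) * b) = 0 \<longrightarrow> (\<forall>b\<in>E. c b = 0)"
    using L.invs_free[OF m, of p, where 'k = 'k] by (elim exE conjE)
  define B' where "B' = {X \<in> carrier T. Val X \<in> B}"
  have B'_Inv: "B' \<subseteq> carrier Inv" using B by (auto simp: B'_def Inv_iff)
  have inj: "inj_on Val E" if "E \<subseteq> B'" for E
    using that Val_eqD unfolding inj_on_def B'_def by blast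
  have "is_basis DS M B'"
    unfolding is_basis_def
  proof (intro conjI ballI allI impI)
    show "B' \<subseteq> carrier M" using B'_Inv by (simp add: M_simps)
  next
    fix X assume "X \<in> carrier M"
    then have X: "X \<in> carrier T" "Val X \<in> L.invs m p" by (simp_all add: M_simps Inv_iff)
    from bspec[OF span X(2)] obtain E c where E: "finite E" "E \<subseteq> B" "\<forall>b. c b \<in> L.Lam"
      "Val X = (\<Sum>b\<in>E. embn (c b) * b)" by (elim exE conjE)
    have "\<forall>b\<in>E. \<exists>Y. Y \<in> carrier T \<and> Val Y = b"
    proof
      fix b assume "b \<in> E"
      then have "b \<in> L.invs m p" using E(2) B by blast
      then show "\<exists>Y. Y \<in> carrier T \<and> Val Y = b" by (intro Val_surj L.invsD(3))
    qed
    from bchoice[OF this] obtain u where u: "\<forall>b\<in>E. u b \<in> carrier T \<and> Val (u b) = b" by (elim exE)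
    have "\<forall>b. \<exists>Y. Y \<in> carrier T \<and> Val Y = embn (c b)"
    proof
      fix b
      have "keys (c b) \<subseteq> mono_set n S" using E(3) by blast
      then have "keys (embn (c b)) \<subseteq> mono_set n (S \<times> UNIV)" by (rule L.keys_embn)
      then show "\<exists>Y. Y \<in> carrier T \<and> Val Y = embn (c b)" by (rule Val_surj)
    qed
    from choice[OF this] obtain d where d: "\<forall>b. d b \<in> carrier T \<and> Val (d b) = embn (c b)" by (elim exE)
    have dDS: "d b \<in> carrier DS" for b
      unfolding DS_iff using d E(3) by blast
    define E' where "E' = u ` E"
    \<comment> \<open>Coefficients are now indexed by elements of the algebra, so the ones belonging
      to \<open>E\<close> are looked up through coordinates.\<close>
    define c' where "c' Y = d (Val Y)" for Y
    have E': "finite E'" "E' \<subseteq> B'" using E(1,2) u by (auto simp: E'_def B'_def)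
    have c': "c' \<in> E' \<rightarrow> carrier DS" using dDS by (auto simp: c'_def)
    have inj_u: "inj_on u E" using u by (metis inj_onI)
    have "Val (\<Oplus>\<^bsub>M\<^esub>b\<in>E'. c' b \<odot>\<^bsub>M\<^esub> b) = (\<Sum>b\<in>E'. Val (c' b) * Val b)"
      using E' B'_Inv c' by (intro Val_finsum) auto
    also have "\<dots> = (\<Sum>b\<in>E. Val (c' (u b)) * Val (u b))"
      unfolding E'_def using sum.reindex[OF inj_u] by (simp add: comp_def)
    also have "\<dots> = (\<Sum>b\<in>E. embn (c b) * b)"
      using u d by (intro sum.cong refl) (simp add: c'_def)
    finally have "Val (\<Oplus>\<^bsub>M\<^esub>b\<in>E'. c' b \<odot>\<^bsub>M\<^esub> b) = Val X" using E(4) by simp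
    then have "X = (\<Oplus>\<^bsub>M\<^esub>b\<in>E'. c' b \<odot>\<^bsub>M\<^esub> b)"
      using Val_finsum(1)[OF E'(1) _ c'] E'(2) B'_Inv X(1) by (intro Val_eqD) auto
    then show "\<exists>E c. finite E \<and> E \<subseteq> B' \<and> c \<in> E \<rightarrow> carrier DS \<and> X = (\<Oplus>\<^bsub>M\<^esub>b\<in>E. c b \<odot>\<^bsub>M\<^esub> b)"
      using E' c' by (intro exI[of _ E'] exI[of _ c'] conjI)
  next
    fix E c b
    assume E: "finite E" "E \<subseteq> B'" and c: "c \<in> E \<rightarrow> carrier DS"
      and zero: "(\<Oplus>\<^bsub>M\<^esub>b\<in>E. c b \<odot>\<^bsub>M\<^esub> b) = \<zero>\<^bsub>M\<^esub>" and b: "b \<in> E"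
    have "\<forall>b\<in>E. \<exists>f. f \<in> L.Lam \<and> Val (c b) = embn f"
      using c by (auto simp: DS_iff Pi_iff)
    from bchoice[OF this] obtain e where e: "\<forall>b\<in>E. e b \<in> L.Lam \<and> Val (c b) = embn (e b)" by (elim exE)
    \<comment> \<open>The independence statement concerns families on the image of \<open>E\<close>,
      so the coefficients are transported along the inverse of the injective map
      \<open>Val\<close>.\<close>
    let ?e = "\<lambda>x. e (inv_into E Val x)"
    have inv: "inv_into E Val (Val b) = b" if "b \<in> E" for b
      using inj[OF E(2)] that by simp
    have "(\<Sum>b\<in>E. Val (c b) * Val b) = 0"
      using Val_finsum(2)[OF E(1) _ c] E(2) B'_Inv zero by (simp add: M_simps subset_trans)
    moreover have "(\<Sum>x\<in>Val ` E. embn (?e x) * x) = (\<Sum>b\<in>E. Val (c b) * Val b)"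
      unfolding sum.reindex[OF inj[OF E(2)]] comp_def
      using e inv by (intro sum.cong refl) simp
    ultimately have sum0: "(\<Sum>x\<in>Val ` E. embn (?e x) * x) = 0" by simp
    have "Val ` E \<subseteq> B" using E(2) by (auto simp: B'_def)
    moreover have "\<forall>x\<in>Val ` E. ?e x \<in> L.Lam" using e inv by auto
    ultimately have "\<forall>x\<in>Val ` E. ?e x = 0"
      using indep[rule_format, of "Val ` E" ?e] E(1) sum0 by blast
    then have "e b = 0" using b inv by auto
    then have "Val (c b) = Val \<zero>\<^bsub>T\<^esub>" using e b by simp
    then show "c b = \<zero>\<^bsub>DS\<^esub>"
      unfolding DS_simps using c b DS_T by (intro Val_eqD) auto
  qed
  then show ?thesis
    unfolding free_module_def using module_M by blast
qed

end

theorem theorem7p16: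
  fixes D :: "('k::{alg_closed_field, field_char_0}, int \<Rightarrow>\<^sub>0 'k) module"
    and a :: "int \<Rightarrow>\<^sub>0 'k"
    and \<sigma> :: "(int \<Rightarrow>\<^sub>0 'k) \<Rightarrow> (int \<Rightarrow>\<^sub>0 'k)"
    and m p n :: nat
  assumes "D = poly_alg \<or> D = laurent_alg"
    and "a \<in> carrier D" and "a \<noteq> \<zero>\<^bsub>D\<^esub>"
    and "\<sigma> \<in> alg_auts D" and "infinite_order D \<sigma>"
    and "n \<ge> 1" and "m \<ge> 1" and "p dvd m"
  shows "free_module (D_star n D a \<sigma>) (left_mult_module (tensor_gwa_invariants m p n D a \<sigma>))"
proof -
  \<comment> \<open>Either base ring is the Laurent algebra with exponents restricted to a suitable
    \<open>S\<close>.\<close>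
  obtain S :: "int set" where S: "S = {0..} \<or> S = UNIV" "D = laurent_alg\<lparr>carrier := {f. keys f \<subseteq> S}\<rparr>"
  proof -
    have "laurent_alg = (laurent_alg :: ('k, int \<Rightarrow>\<^sub>0 'k) module)\<lparr>carrier := {f. keys f \<subseteq> UNIV}\<rparr>"
      by (simp add: laurent_alg_def)
    then show thesis
      using assms(1) that[of "{0..}"] that[of UNIV] by (auto simp: poly_alg_def)
  qed
  interpret tensor_gwa_data S D a \<sigma> n m p
    by unfold_locales (use S assms in auto)
  show ?thesis by (rule free)
qed

end
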